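(* Let $M$ be a compact surface without boundary embedded in $(\mathbb{R}^3,\|\cdot\|)$. If $M$ has constant non-zero Minkowski mean curvature, then $M$ is a Minkowski sphere.
   Context: $\|\cdot\|$ is a smooth and strictly convex norm on $\mathbb{R}^3$ with unit sphere $\partial B=\{x:\|x\|=1\}$; the usual (Euclidean) Gaussian curvature of the surface $\partial B$ is assumed to vanish nowhere. A vector $v$ is Birkhoff orthogonal to a plane $P\subseteq\mathbb{R}^3$ (through the origin) if $\|v\|\le\|v+tw\|$ for all $w\in P$, $t\in\mathbb{R}$. For an (orientable) surface $M$ in $\mathbb{R}^3$, the Birkhoff-Gauss map $\eta:M\to\partial B$ is a smooth map such that $\eta(p)$ is Birkhoff orthogonal to $T_pM$ for each $p$; here it is chosen outward-pointing. Since $T_{\eta(p)}\partial B=T_pM$ as linear planes, $d\eta_p$ is an endomorphism of $T_pM$, and the Minkowski mean curvature is $H(p)=\tfrac12\mathrm{tr}(d\eta_p)$. A Minkowski sphere is a set $\{x:\|x-a\|=r\}$ with $a\in\mathbb{R}^3$, $r>0$. *)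

theory Defs
  imports "HOL-Analysis.Analysis"
begin

section \<open>Smooth maps\<close>

text \<open>Both notions are meant for open S only.\<close>

primrec Ck_on :: "nat \<Rightarrow> 'a::real_normed_vector set \<Rightarrow> ('a \<Rightarrow> 'b::real_normed_vector) \<Rightarrow> bool" where
  "Ck_on 0 S f \<longleftrightarrow> continuous_on S f"
| "Ck_on (Suc k) S f \<longleftrightarrow>
     (\<forall>x\<in>S. f differentiable (at x)) \<and>
     (\<forall>v. Ck_on k S (\<lambda>x. frechet_derivative f (at x) v))"

definition smooth_on :: "'a::real_normed_vector set \<Rightarrow> ('a \<Rightarrow> 'b::real_normed_vector) \<Rightarrow> bool" where
  "smooth_on S f \<longleftrightarrow> (\<forall>k. Ck_on k S f)"

section \<open>Trace and determinant of an endomorphism of a subspace\<close>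

text \<open>For a finite-dimensional subspace T and a linear map L from T to T, the values below do not
  depend on the basis. The values of L outside T are irrelevant.\<close>

definition basis_of :: "'a::real_vector set \<Rightarrow> 'a set" where
  "basis_of T = (SOME B. B \<subseteq> T \<and> independent B \<and> span B = T)"

definition trace_on :: "'a::real_vector set \<Rightarrow> ('a \<Rightarrow> 'a) \<Rightarrow> real" where
  "trace_on T L = (\<Sum>b\<in>basis_of T. representation (basis_of T) (L b) b)"

definition det_on :: "'a::real_vector set \<Rightarrow> ('a \<Rightarrow> 'a) \<Rightarrow> real" where
  "det_on T L =
     (\<Sum>\<pi> | \<pi> permutes basis_of T.
        of_int (sign \<pi>) * (\<Prod>b\<in>basis_of T. representation (basis_of T) (L b) (\<pi> b)))"

section \<open>Embedded surfaces in space\<close>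

definition local_parametrization :: "(real^3) set \<Rightarrow> (real^2) set \<Rightarrow> (real^2 \<Rightarrow> real^3) \<Rightarrow> bool" where
  "local_parametrization M V \<phi> \<longleftrightarrow>
     open V \<and> smooth_on V \<phi> \<and> (\<forall>u\<in>V. inj (frechet_derivative \<phi> (at u))) \<and>
     openin (top_of_set M) (\<phi> ` V) \<and> (\<exists>\<psi>. homeomorphism V (\<phi> ` V) \<phi> \<psi>)"

text \<open>The parameter domains are open in the plane, so such a surface has no boundary points.\<close>

definition smooth_surface :: "(real^3) set \<Rightarrow> bool" where
  "smooth_surface M \<longleftrightarrow> (\<forall>p\<in>M. \<exists>V \<phi>. local_parametrization M V \<phi> \<and> p \<in> \<phi> ` V)"

definition smooth_on_surface :: "(real^3) set \<Rightarrow> (real^3 \<Rightarrow> real^3) \<Rightarrow> bool" where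
  "smooth_on_surface M f \<longleftrightarrow> (\<forall>V \<phi>. local_parametrization M V \<phi> \<longrightarrow> smooth_on V (f \<circ> \<phi>))"

definition curve_through :: "(real^3) set \<Rightarrow> real^3 \<Rightarrow> real^3 \<Rightarrow> (real \<Rightarrow> real^3) \<Rightarrow> bool" where
  "curve_through M p v \<gamma> \<longleftrightarrow>
     (\<exists>e>0. smooth_on {-e<..<e} \<gamma> \<and> \<gamma> ` {-e<..<e} \<subseteq> M) \<and>
     \<gamma> 0 = p \<and> (\<gamma> has_vector_derivative v) (at 0)"

definition tangent_space :: "(real^3) set \<Rightarrow> real^3 \<Rightarrow> (real^3) set" where
  "tangent_space M p = {v. \<exists>\<gamma>. curve_through M p v \<gamma>}"

text \<open>The differential at p of a map f on M. It is only meaningful on tangent vectors v, for f smooth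
  on M.\<close>

definition surface_differential ::
    "(real^3) set \<Rightarrow> (real^3 \<Rightarrow> real^3) \<Rightarrow> real^3 \<Rightarrow> real^3 \<Rightarrow> real^3" where
  "surface_differential M f p v =
     (THE w. \<forall>\<gamma>. curve_through M p v \<gamma> \<longrightarrow> (f \<circ> \<gamma> has_vector_derivative w) (at 0))"

section \<open>Euclidean Gaussian curvature\<close>

definition unit_normal_field :: "(real^3) set \<Rightarrow> (real^3 \<Rightarrow> real^3) \<Rightarrow> bool" where
  "unit_normal_field M n \<longleftrightarrow>
     smooth_on_surface M n \<and>
     (\<forall>p\<in>M. norm (n p) = 1 \<and> (\<forall>v\<in>tangent_space M p. n p \<bullet> v = 0))"

text \<open>The determinant of the differential of the Euclidean Gauss map. A smooth unit normal field
  exists near every point of a smooth surface, and the determinant does not depend on its sign.\<close>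

definition gaussian_curvature :: "(real^3) set \<Rightarrow> real^3 \<Rightarrow> real" where
  "gaussian_curvature M p =
     (THE k. \<forall>U n. open U \<and> p \<in> U \<and> unit_normal_field (M \<inter> U) n \<longrightarrow>
        k = det_on (tangent_space M p) (surface_differential (M \<inter> U) n p))"

section \<open>Norms and the Birkhoff-Gauss map\<close>

definition is_norm :: "('a::real_vector \<Rightarrow> real) \<Rightarrow> bool" where
  "is_norm N \<longleftrightarrow>
     (\<forall>x. N x \<ge> 0) \<and> (\<forall>x. N x = 0 \<longleftrightarrow> x = 0) \<and>
     (\<forall>c x. N (c *\<^sub>R x) = \<bar>c\<bar> * N x) \<and> (\<forall>x y. N (x + y) \<le> N x + N y)"

definition minkowski_sphere :: "('a::real_vector \<Rightarrow> real) \<Rightarrow> 'a \<Rightarrow> real \<Rightarrow> 'a set" where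
  "minkowski_sphere N a r = {x. N (x - a) = r}"

definition smooth_norm :: "(real^3 \<Rightarrow> real) \<Rightarrow> bool" where
  "smooth_norm N \<longleftrightarrow> is_norm N \<and> smooth_on (- {0}) N"

text \<open>The unit sphere contains no nondegenerate segment.\<close>

definition strictly_convex_norm :: "('a::real_vector \<Rightarrow> real) \<Rightarrow> bool" where
  "strictly_convex_norm N \<longleftrightarrow>
     (\<forall>x y t. N x = 1 \<and> N y = 1 \<and> x \<noteq> y \<and> 0 < t \<and> t < 1 \<longrightarrow>
        N ((1 - t) *\<^sub>R x + t *\<^sub>R y) < 1)"

definition birkhoff_orthogonal :: "('a::real_vector \<Rightarrow> real) \<Rightarrow> 'a \<Rightarrow> 'a set \<Rightarrow> bool" where
  "birkhoff_orthogonal N v P \<longleftrightarrow> (\<forall>w\<in>P. \<forall>t. N v \<le> N (v + t *\<^sub>R w))"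

definition birkhoff_gauss_map :: "(real^3 \<Rightarrow> real) \<Rightarrow> (real^3) set \<Rightarrow> (real^3 \<Rightarrow> real^3) \<Rightarrow> bool" where
  "birkhoff_gauss_map N M \<eta> \<longleftrightarrow>
     smooth_on_surface M \<eta> \<and> \<eta> ` M \<subseteq> minkowski_sphere N 0 1 \<and>
     (\<forall>p\<in>M. birkhoff_orthogonal N (\<eta> p) (tangent_space M p))"

text \<open>Here \<open>outside M\<close> is the unbounded part of the complement of M.\<close>

definition outward_pointing :: "(real^3) set \<Rightarrow> (real^3 \<Rightarrow> real^3) \<Rightarrow> bool" where
  "outward_pointing M \<eta> \<longleftrightarrow>
     (\<forall>p\<in>M. \<forall>\<^sub>F t in at_right (0::real). p + t *\<^sub>R \<eta> p \<in> outside M)"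

definition minkowski_mean_curvature :: "(real^3) set \<Rightarrow> (real^3 \<Rightarrow> real^3) \<Rightarrow> real^3 \<Rightarrow> real" where
  "minkowski_mean_curvature M \<eta> p =
     1 / 2 * trace_on (tangent_space M p) (surface_differential M \<eta> p)"

end

theory Submission
  imports Defs
begin

text \<open>The proof follows Montiel and Ros. Let V be the volume enclosed by M and A the area of M in the
  sense that a tube of small thickness h on one side of M has volume about hA. The divergence theorem,
  applied to the position vector field and to its projection along \<open>\<eta>\<close> to the tangent planes, gives
  the Minkowski formula 3cV = A; in particular c > 0. On the other hand, if p is a point of M nearest
  to an interior point y, then y = p - r \<open>\<eta>\<close>(p) with rc \<le> 1. So the maps p \<open>\<mapsto>\<close> p - r \<open>\<eta>\<close>(p), where
  0 \<le> r \<le> 1/c, cover the interior. As \<open>d\<eta>\<close> is self-adjoint for the second derivative of the norm, which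
  is positive definite on tangent planes because the Gaussian curvature of the unit sphere does not
  vanish, their Jacobian determinants are at most \<open>(1 - rc)\<^sup>2\<close>, and integration gives 3cV \<le> A, where
  equality forces \<open>d\<eta>\<close> = c everywhere. Then \<open>\<eta>\<close>(p) - cp is constant, so M is a Minkowski sphere.

  All integrals are Lebesgue integrals over thin tubes around M, which avoids integration on M.\<close>

section \<open>Calculus of smooth maps\<close>

text \<open>The formula rests on two divergences. With the conormal \<nu> = \<open>G (E x)\<close>,
  the tangential part of the position field has divergence 2 - (x \<bullet> \<nu>) tr D, the
  position field itself has divergence 3, and tr D = 2c on M. The reverse inequality comes from the
  integral of (1 - rc)^2 over [0, 1/c], which is 1/(3c). Here E extends \<eta> to a tube, constant
  along the lines p + t \<eta>(p), and D is its derivative. Since \<nu> is also the gradient of the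
  signed height s over M, \<open>H (E y)\<close> composed with \<open>D y\<close> is a second
  derivative; this is the source of self-adjointness. The mean curvature is prescribed on M only, so
  on a tube all relations carry an error, uniform by compactness, and rigidity needs a gain that
  does not depend on this error: distinct principal curvatures at one point save a fixed volume. One
  step is global: the hypothesis places p + t \<eta>(p) outside M for small t > 0, but the
  divergence theorem also needs p - t \<eta>(p) inside, a separation statement that is proved by
  lifting a map into the circle.\<close>

lemma Ck_on_Suc_imp: "Ck_on (Suc k) S f \<Longrightarrow> Ck_on k S f"
proof (induction k arbitrary: f)
  case 0
  then show ?case
    by (auto intro!: differentiable_imp_continuous_on differentiable_at_imp_differentiable_on)
next
  case (Suc k)
  show ?case
    unfolding Ck_on.simps(2)[of k]
  proof (intro conjI allI)
    show "\<forall>x\<in>S. f differentiable at x" using Suc.prems by simp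
    fix v
    have "Ck_on (Suc k) S (\<lambda>x. frechet_derivative f (at x) v)"
      using Suc.prems unfolding Ck_on.simps(2)[of "Suc k"] by blast
    then show "Ck_on k S (\<lambda>x. frechet_derivative f (at x) v)" by (rule Suc.IH)
  qed
qed

lemma Ck_on_subset: "Ck_on k S f \<Longrightarrow> T \<subseteq> S \<Longrightarrow> Ck_on k T f"
  by (induction k arbitrary: f) (auto intro: continuous_on_subset)

lemma Ck_on_cong:
  assumes "open S" "\<And>x. x \<in> S \<Longrightarrow> f x = g x" "Ck_on k S f"
  shows "Ck_on k S g"
  using assms(2,3)
proof (induction k arbitrary: f g)
  case 0
  then show ?case by (simp cong: continuous_on_cong)
next
  case (Suc k)
  have der: "(g has_derivative frechet_derivative f (at x)) (at x)" if "x \<in> S" for x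
  proof (rule has_derivative_transform_within_open[OF _ assms(1) that])
    show "(f has_derivative frechet_derivative f (at x)) (at x)"
      using Suc.prems(2) that by (simp add: frechet_derivative_works)
  qed (use Suc.prems in auto)
  then have eq: "frechet_derivative f (at x) = frechet_derivative g (at x)" if "x \<in> S" for x
    using frechet_derivative_at that by blast
  show ?case
    unfolding Ck_on.simps(2)
  proof (intro conjI allI ballI)
    show "g differentiable at x" if "x \<in> S" for x
      using der[OF that] differentiable_def by blast
    fix v
    show "Ck_on k S (\<lambda>x. frechet_derivative g (at x) v)"
    proof (rule Suc.IH)
      show "Ck_on k S (\<lambda>x. frechet_derivative f (at x) v)"
        using Suc.prems(2) by simp
    qed (simp add: eq)
  qed
qed

text \<open>The definition speaks of \<open>frechet_derivative\<close>; this rule accepts any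
  explicit candidate f' instead, which is how the closure rules below pass through their
  inductions.\<close>

lemma Ck_on_SucI:
  assumes "open S" "\<And>x. x \<in> S \<Longrightarrow> (f has_derivative f' x) (at x)"
    and "\<And>v. Ck_on k S (\<lambda>x. f' x v)"
  shows "Ck_on (Suc k) S f"
  unfolding Ck_on.simps(2)
proof (intro conjI allI ballI)
  show "f differentiable at x" if "x \<in> S" for x
    using assms(2)[OF that] differentiable_def by blast
  have eq: "f' x = frechet_derivative f (at x)" if "x \<in> S" for x
    using assms(2)[OF that] frechet_derivative_at by blast
  show "Ck_on k S (\<lambda>x. frechet_derivative f (at x) v)" for v
    by (rule Ck_on_cong[OF assms(1) _ assms(3)[of v]]) (simp add: eq)
qed

lemma Ck_on_SucD:
  assumes "Ck_on (Suc k) S f"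
  shows "x \<in> S \<Longrightarrow> (f has_derivative frechet_derivative f (at x)) (at x)"
    and "Ck_on k S (\<lambda>x. frechet_derivative f (at x) v)"
  using assms by (auto simp: frechet_derivative_works)

lemma Ck_on_const: "open S \<Longrightarrow> Ck_on k S (\<lambda>x. c)"
proof (induction k arbitrary: c)
  case (Suc k)
  show ?case by (rule Ck_on_SucI[where f' = "\<lambda>x v. 0"]) (use Suc in auto)
qed auto

lemma Ck_on_bounded_linear:
  assumes "open S" "bounded_linear f"
  shows "Ck_on k S f"
proof (cases k)
  case 0
  then show ?thesis using assms(2) by (simp add: linear_continuous_on)
next
  case (Suc m)
  show ?thesis unfolding Suc
    by (rule Ck_on_SucI[where f' = "\<lambda>x. f"])
       (use assms in \<open>auto intro: bounded_linear_imp_has_derivative Ck_on_const\<close>)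
qed

lemma Ck_on_add:
  assumes "open S"
  shows "Ck_on k S f \<Longrightarrow> Ck_on k S g \<Longrightarrow> Ck_on k S (\<lambda>x. f x + g x)"
proof (induction k arbitrary: f g)
  case (Suc k)
  show ?case
    by (rule Ck_on_SucI[OF assms, where
          f' = "\<lambda>x v. frechet_derivative f (at x) v + frechet_derivative g (at x) v"])
       (use Suc.prems in \<open>auto intro!: has_derivative_add Ck_on_SucD(1)[of k] Suc.IH simp del: Ck_on.simps
         dest: Ck_on_SucD(2)\<close>)
qed (auto intro: continuous_on_add)

lemma Ck_on_sum:
  assumes "open S" "finite I" "\<And>i. i \<in> I \<Longrightarrow> Ck_on k S (f i)"
  shows "Ck_on k S (\<lambda>x. \<Sum>i\<in>I. f i x)"
  using assms(2,3)
  by (induction I rule: finite_induct) (auto intro: Ck_on_add Ck_on_const assms(1))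

lemma Ck_on_bilinear:
  assumes "bounded_bilinear B" "open S"
  shows "Ck_on k S f \<Longrightarrow> Ck_on k S g \<Longrightarrow> Ck_on k S (\<lambda>x. B (f x) (g x))"
proof (induction k arbitrary: f g)
  case 0
  then show ?case by (simp add: bounded_bilinear.continuous_on[OF assms(1)])
next
  case (Suc k)
  interpret bounded_bilinear B by fact
  show ?case
    by (rule Ck_on_SucI[OF assms(2), where
          f' = "\<lambda>x v. B (f x) (frechet_derivative g (at x) v)
                    + B (frechet_derivative f (at x) v) (g x)"])
       (use Suc.prems in \<open>auto intro!: FDERIV Ck_on_SucD(1)[of k] Suc.IH Ck_on_add assms(2)
         simp del: Ck_on.simps intro: Ck_on_SucD(2) Ck_on_Suc_imp\<close>)
qed

lemmas Ck_on_scaleR = Ck_on_bilinear[OF bounded_bilinear_scaleR]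
  and Ck_on_inner = Ck_on_bilinear[OF bounded_bilinear_inner]

text \<open>The chain rule differentiates f in the direction g'(x) v, which moves with x, whereas
  the induction hypothesis concerns fixed directions. Expanding the moving direction in the basis of
  the middle space, which is Euclidean for this reason, gives a finite sum of products to which the
  hypothesis applies.\<close>

lemma Ck_on_compose:
  fixes g :: "'a::real_normed_vector \<Rightarrow> 'b::euclidean_space" and f :: "'b \<Rightarrow> 'c::real_normed_vector"
  assumes "open S" "open T" "g ` S \<subseteq> T"
  shows "Ck_on k S g \<Longrightarrow> Ck_on k T f \<Longrightarrow> Ck_on k S (\<lambda>x. f (g x))"
proof (induction k arbitrary: f)
  case 0
  then show ?case using assms(3)
    by (simp add: continuous_on_compose2[of T f S g])
next
  case (Suc k)
  let ?g' = "\<lambda>x. frechet_derivative g (at x)" and ?f' = "\<lambda>x. frechet_derivative f (at x)"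
  have gx: "g x \<in> T" if "x \<in> S" for x using that assms(3) by blast
  have g': "(g has_derivative ?g' x) (at x)" if "x \<in> S" for x
    by (rule Ck_on_SucD(1)[OF Suc.prems(1) that])
  have f': "(f has_derivative ?f' x) (at x)" if "x \<in> T" for x
    by (rule Ck_on_SucD(1)[OF Suc.prems(2) that])
  have expand: "?f' (g x) (?g' x v) = (\<Sum>b\<in>Basis. (?g' x v \<bullet> b) *\<^sub>R ?f' (g x) b)" if "x \<in> S" for x v
  proof -
    have lin: "linear (?f' (g x))" using f'[OF gx[OF that]] by (rule has_derivative_linear)
    have "?f' (g x) (?g' x v) = ?f' (g x) (\<Sum>b\<in>Basis. (?g' x v \<bullet> b) *\<^sub>R b)"
      by (simp add: euclidean_representation)
    then show ?thesis by (simp add: linear_sum[OF lin] linear_scale[OF lin])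
  qed
  show ?case
  proof (rule Ck_on_SucI[OF assms(1), where f' = "\<lambda>x v. \<Sum>b\<in>Basis. (?g' x v \<bullet> b) *\<^sub>R ?f' (g x) b"])
    fix x assume x: "x \<in> S"
    have "((\<lambda>x. f (g x)) has_derivative (\<lambda>v. ?f' (g x) (?g' x v))) (at x)"
      using has_derivative_compose[OF g'[OF x] f'[OF gx[OF x]]] .
    then show "((\<lambda>x. f (g x)) has_derivative (\<lambda>v. \<Sum>b\<in>Basis. (?g' x v \<bullet> b) *\<^sub>R ?f' (g x) b)) (at x)"
      by (simp add: expand[OF x])
  next
    fix v
    show "Ck_on k S (\<lambda>x. \<Sum>b\<in>Basis. (?g' x v \<bullet> b) *\<^sub>R ?f' (g x) b)"
    proof (intro Ck_on_sum Ck_on_scaleR Ck_on_inner Ck_on_const assms(1) finite_Basis)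
      show "Ck_on k S (\<lambda>x. ?g' x v)" by (rule Ck_on_SucD(2)[OF Suc.prems(1)])
      show "Ck_on k S (\<lambda>x. ?f' (g x) b)" for b
        by (rule Suc.IH[OF Ck_on_Suc_imp[OF Suc.prems(1)] Ck_on_SucD(2)[OF Suc.prems(2)]])
    qed
  qed
qed

text \<open>Coefficient and exponent vary in the induction because differentiation changes both. The
  powers -1 and -1/2 later serve to normalise vectors smoothly.\<close>

lemma Ck_on_powr: "Ck_on k {0<..} (\<lambda>x::real. c * x powr a)"
proof (induction k arbitrary: c a)
  case 0
  show ?case by (auto intro!: continuous_intros)
next
  case (Suc k)
  show ?case
  proof (rule Ck_on_SucI[where f' = "\<lambda>x v. v * (c * a * x powr (a - 1))"])
    fix x :: real assume "x \<in> {0<..}"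
    then show "((\<lambda>x. c * x powr a) has_derivative (\<lambda>v. v * (c * a * x powr (a - 1)))) (at x)"
      by (auto intro!: derivative_eq_intros simp: powr_diff field_simps)
  next
    show "Ck_on k {0<..} (\<lambda>x. v * (c * a * x powr (a - 1)))" for v
      using Suc.IH[of "v * (c * a)" "a - 1"] by (simp add: mult.assoc)
  qed simp
qed

lemma smooth_on_imp_differentiable: "smooth_on S f \<Longrightarrow> x \<in> S \<Longrightarrow> f differentiable (at x)"
  unfolding smooth_on_def by (metis Ck_on.simps(2))

lemma smooth_on_imp_has_derivative:
  "smooth_on S f \<Longrightarrow> x \<in> S \<Longrightarrow> (f has_derivative frechet_derivative f (at x)) (at x)"
  by (simp add: smooth_on_imp_differentiable flip: frechet_derivative_works)

lemma smooth_on_derivative: "smooth_on S f \<Longrightarrow> smooth_on S (\<lambda>x. frechet_derivative f (at x) v)"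
  unfolding smooth_on_def by (metis Ck_on.simps(2))

lemma smooth_on_imp_continuous_on: "smooth_on S f \<Longrightarrow> continuous_on S f"
  unfolding smooth_on_def by (metis Ck_on.simps(1))

lemma smooth_on_subset: "smooth_on S f \<Longrightarrow> T \<subseteq> S \<Longrightarrow> smooth_on T f"
  unfolding smooth_on_def by (blast intro: Ck_on_subset)

lemma smooth_on_const: "open S \<Longrightarrow> smooth_on S (\<lambda>x. c)"
  unfolding smooth_on_def by (blast intro: Ck_on_const)

lemma smooth_on_bounded_linear: "open S \<Longrightarrow> bounded_linear f \<Longrightarrow> smooth_on S f"
  unfolding smooth_on_def by (blast intro: Ck_on_bounded_linear)

lemma smooth_on_add:
  "open S \<Longrightarrow> smooth_on S f \<Longrightarrow> smooth_on S g \<Longrightarrow> smooth_on S (\<lambda>x. f x + g x)"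
  unfolding smooth_on_def by (blast intro: Ck_on_add)

lemma smooth_on_sum:
  "open S \<Longrightarrow> finite I \<Longrightarrow> (\<And>i. i \<in> I \<Longrightarrow> smooth_on S (f i)) \<Longrightarrow> smooth_on S (\<lambda>x. \<Sum>i\<in>I. f i x)"
  unfolding smooth_on_def by (blast intro: Ck_on_sum)

lemma smooth_on_scaleR:
  "open S \<Longrightarrow> smooth_on S f \<Longrightarrow> smooth_on S g \<Longrightarrow> smooth_on S (\<lambda>x. f x *\<^sub>R g x)"
  unfolding smooth_on_def by (blast intro: Ck_on_scaleR)

lemma smooth_on_inner:
  "open S \<Longrightarrow> smooth_on S f \<Longrightarrow> smooth_on S g \<Longrightarrow> smooth_on S (\<lambda>x. f x \<bullet> g x)"
  unfolding smooth_on_def by (blast intro: Ck_on_inner)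

lemma smooth_on_compose:
  fixes g :: "'a::real_normed_vector \<Rightarrow> 'b::euclidean_space" and f :: "'b \<Rightarrow> 'c::real_normed_vector"
  shows "open S \<Longrightarrow> open T \<Longrightarrow> g ` S \<subseteq> T \<Longrightarrow> smooth_on S g \<Longrightarrow> smooth_on T f
    \<Longrightarrow> smooth_on S (\<lambda>x. f (g x))"
  unfolding smooth_on_def by (blast intro: Ck_on_compose)

lemma smooth_on_powr:
  assumes "open S" "smooth_on S f" "\<And>x. x \<in> S \<Longrightarrow> f x > 0"
  shows "smooth_on S (\<lambda>x. (f x :: real) powr a)"
proof (rule smooth_on_compose[OF assms(1) _ _ assms(2)])
  show "smooth_on {0<..} (\<lambda>x::real. x powr a)"
    unfolding smooth_on_def using Ck_on_powr[of _ 1 a] by simp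
qed (use assms(3) in auto)

section \<open>Symmetry of second derivatives\<close>

text \<open>The mean value theorem turns the second difference into a difference of first
  derivatives in direction u at two points that are t v apart; the expansion of g at x then
  evaluates it. The limit serves twice: its symmetry in u and v gives symmetric Hessians, and for u
  = v it transfers convexity of N to H.\<close>

lemma second_difference_limit:
  fixes f :: "'a::euclidean_space \<Rightarrow> real"
  assumes "open U" "x \<in> U"
    and f': "\<And>y. y \<in> U \<Longrightarrow> (f has_derivative (\<lambda>v. g y \<bullet> v)) (at y)"
    and g': "(g has_derivative h) (at x)"
  shows "((\<lambda>t. (f (x + t *\<^sub>R u + t *\<^sub>R v) - f (x + t *\<^sub>R u) - f (x + t *\<^sub>R v) + f x) / t\<^sup>2)
           \<longlongrightarrow> h v \<bullet> u) (at_right 0)"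
proof (rule tendstoI)
  fix e :: real assume "e > 0"
  define K where "K = norm u + norm v + 1"
  have K: "K > 0" "norm u \<le> K" "norm u + norm v \<le> K" "norm u < K"
    unfolding K_def using norm_ge_zero[of u] norm_ge_zero[of v] by linarith+
  interpret h: bounded_linear h using g' by (rule has_derivative_bounded_linear)
  \<comment> \<open>Two expansion errors of size \<open>e' * (t * K)\<close> are paired with a
    vector of norm at most K and divided by t, which leaves
    \<open>2 * e' * K\<^sup>2 = e / 2\<close>.\<close>
  define e' where "e' = e / (4 * K\<^sup>2)"
  have "e' > 0" unfolding e'_def using \<open>e > 0\<close> K by simp
  then obtain d where d: "d > 0" "\<And>y. norm (y - x) < d \<Longrightarrow> norm (g y - g x - h (y - x)) \<le> e' * norm (y - x)"
    using g' unfolding has_derivative_at_alt by blast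
  obtain d2 where d2: "d2 > 0" "ball x d2 \<subseteq> U" using assms(1,2) openE by blast
  define d3 where "d3 = min d d2 / K"
  have d3: "d3 > 0" unfolding d3_def using d d2 K by simp
  show "\<forall>\<^sub>F t in at_right 0. dist ((f (x + t *\<^sub>R u + t *\<^sub>R v) - f (x + t *\<^sub>R u) - f (x + t *\<^sub>R v) + f x) / t\<^sup>2) (h v \<bullet> u) < e"
    unfolding eventually_at_right_field
  proof (intro exI[of _ d3] conjI allI impI d3)
    fix t assume t: "0 < t" "t < d3"
    have tK: "t * K < d" "t * K < d2" using t K unfolding d3_def by (auto simp: field_simps)
    have small: "norm ((\<tau> * t) *\<^sub>R u + (\<sigma> * t) *\<^sub>R v) \<le> t * K" if "0 \<le> \<tau>" "\<tau> \<le> 1" "\<sigma> \<in> {0, 1}" for \<tau> \<sigma>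
    proof -
      have "norm ((\<tau> * t) *\<^sub>R u + (\<sigma> * t) *\<^sub>R v) \<le> \<tau> * t * norm u + \<sigma> * t * norm v"
        using norm_triangle_ineq[of "(\<tau> * t) *\<^sub>R u" "(\<sigma> * t) *\<^sub>R v"] that t by auto
      also have "\<dots> \<le> 1 * t * norm u + 1 * t * norm v"
        using that t by (intro add_mono mult_right_mono) auto
      also have "\<dots> \<le> t * K" using K(3) t by (metis distrib_left mult_1 mult_left_mono less_imp_le)
      finally show ?thesis .
    qed
    \<comment> \<open>Only the step along u is interpolated; the step along v stays complete, so the
      mean value theorem leaves gradients at two points that differ by
      \<open>t *\<^sub>R v\<close>.\<close>
    define F where "F = (\<lambda>\<tau>. f (x + (\<tau> * t) *\<^sub>R u + t *\<^sub>R v) - f (x + (\<tau> * t) *\<^sub>R u))"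
    have inU: "x + (\<tau> * t) *\<^sub>R u + (\<sigma> * t) *\<^sub>R v \<in> U" if "0 \<le> \<tau>" "\<tau> \<le> 1" "\<sigma> \<in> {0, 1}" for \<tau> \<sigma>
      using small[OF that] tK d2(2) by (force simp: dist_norm norm_minus_commute algebra_simps)
    have F': "(F has_real_derivative t * ((g (x + (\<tau> * t) *\<^sub>R u + t *\<^sub>R v) - g (x + (\<tau> * t) *\<^sub>R u)) \<bullet> u)) (at \<tau>)"
      if "0 \<le> \<tau>" "\<tau> \<le> 1" for \<tau>
    proof -
      have 1: "(f has_derivative (\<lambda>w. g (x + (\<tau> * t) *\<^sub>R u + t *\<^sub>R v) \<bullet> w)) (at (x + (\<tau> * t) *\<^sub>R u + t *\<^sub>R v))"
        using f'[OF inU[OF that, of 1]] by simp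
      have 2: "(f has_derivative (\<lambda>w. g (x + (\<tau> * t) *\<^sub>R u) \<bullet> w)) (at (x + (\<tau> * t) *\<^sub>R u))"
        using f'[OF inU[OF that, of 0]] by simp
      have L: "((\<lambda>\<tau>. x + (\<tau> * t) *\<^sub>R u + w) has_derivative (\<lambda>r. (r * t) *\<^sub>R u)) (at \<tau>)"
        and L0: "((\<lambda>\<tau>. x + (\<tau> * t) *\<^sub>R u) has_derivative (\<lambda>r. (r * t) *\<^sub>R u)) (at \<tau>)" for w
        by (auto intro!: derivative_eq_intros)
      have "(F has_derivative (\<lambda>r. g (x + (\<tau> * t) *\<^sub>R u + t *\<^sub>R v) \<bullet> ((r * t) *\<^sub>R u)
               - g (x + (\<tau> * t) *\<^sub>R u) \<bullet> ((r * t) *\<^sub>R u))) (at \<tau>)"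
        unfolding F_def
        by (intro has_derivative_diff has_derivative_compose[where g = f, OF L 1]
            has_derivative_compose[where g = f, OF L0 2])
      then show ?thesis
        unfolding has_field_derivative_def
        by (rule has_derivative_eq_rhs) (auto simp: fun_eq_iff inner_diff_left algebra_simps)
    qed
    obtain \<tau> where \<tau>: "0 < \<tau>" "\<tau> < 1"
      "F 1 - F 0 = (1 - 0) * (t * ((g (x + (\<tau> * t) *\<^sub>R u + t *\<^sub>R v) - g (x + (\<tau> * t) *\<^sub>R u)) \<bullet> u))"
      using MVT2[of 0 1 F "\<lambda>\<tau>. t * ((g (x + (\<tau> * t) *\<^sub>R u + t *\<^sub>R v) - g (x + (\<tau> * t) *\<^sub>R u)) \<bullet> u)"] F'
      by auto
    let ?a = "(\<tau> * t) *\<^sub>R u + t *\<^sub>R v" and ?b = "(\<tau> * t) *\<^sub>R u"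
    have na: "norm ?a \<le> t * K" and nb: "norm ?b \<le> t * K"
      using small[of \<tau> 1] small[of \<tau> 0] \<tau> by auto
    have A: "norm (g (x + ?a) - g x - h ?a) \<le> e' * (t * K)"
      using d(2)[of "x + ?a"] na tK \<open>e' > 0\<close>
      by (smt (verit) add_diff_cancel_left' mult_left_mono)
    have B: "norm (g (x + ?b) - g x - h ?b) \<le> e' * (t * K)"
      using d(2)[of "x + ?b"] nb tK \<open>e' > 0\<close>
      by (smt (verit) add_diff_cancel_left' mult_left_mono)
    have hab: "h ?a - h ?b = t *\<^sub>R h v" by (simp add: h.add h.scaleR)
    have "norm (g (x + ?a) - g (x + ?b) - t *\<^sub>R h v)
        = norm ((g (x + ?a) - g x - h ?a) - (g (x + ?b) - g x - h ?b))"
      unfolding hab[symmetric] by (simp add: algebra_simps)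
    also have "\<dots> \<le> 2 * (e' * (t * K))" using A B norm_triangle_ineq4 by (smt (verit))
    finally have C: "norm (g (x + ?a) - g (x + ?b) - t *\<^sub>R h v) \<le> 2 * (e' * (t * K))" .
    have "\<bar>(g (x + ?a) - g (x + ?b) - t *\<^sub>R h v) \<bullet> u\<bar> \<le> 2 * (e' * (t * K)) * norm u"
      using Cauchy_Schwarz_ineq2 C by (meson mult_right_mono norm_ge_zero order_trans)
    also have "\<dots> \<le> 2 * (e' * (t * K)) * K"
      using K \<open>e' > 0\<close> t by (intro mult_left_mono) auto
    also have "\<dots> = t * (e / 2)" unfolding e'_def using K by (simp add: field_simps power2_eq_square)
    finally have D: "\<bar>(g (x + ?a) - g (x + ?b)) \<bullet> u - t * (h v \<bullet> u)\<bar> \<le> t * (e / 2)"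
      by (simp add: inner_diff_left)
    have F01: "F 1 - F 0 = f (x + t *\<^sub>R u + t *\<^sub>R v) - f (x + t *\<^sub>R u) - f (x + t *\<^sub>R v) + f x"
      by (simp add: F_def)
    have Q: "(F 1 - F 0) / t\<^sup>2 - h v \<bullet> u = ((g (x + ?a) - g (x + ?b)) \<bullet> u - t * (h v \<bullet> u)) / t"
      using \<tau>(3) t by (simp add: field_simps power2_eq_square)
    have "\<bar>(F 1 - F 0) / t\<^sup>2 - h v \<bullet> u\<bar> \<le> e / 2"
      unfolding Q using D t by (simp add: field_simps)
    then show "dist ((f (x + t *\<^sub>R u + t *\<^sub>R v) - f (x + t *\<^sub>R u) - f (x + t *\<^sub>R v) + f x) / t\<^sup>2) (h v \<bullet> u) < e"
      unfolding dist_real_def F01 using \<open>e > 0\<close> by linarith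
  qed
qed

text \<open>The second difference does not change when u and v are exchanged. Besides f = N, the
  important instance is the height s over the surface, which makes the shape operator
  self-adjoint.\<close>

lemma second_derivative_symmetric:
  fixes f :: "'a::euclidean_space \<Rightarrow> real"
  assumes "open U" "x \<in> U"
    and "\<And>y. y \<in> U \<Longrightarrow> (f has_derivative (\<lambda>v. g y \<bullet> v)) (at y)"
    and "(g has_derivative h) (at x)"
  shows "h v \<bullet> u = h u \<bullet> v"
proof (rule tendsto_unique[OF trivial_limit_at_right_real])
  show "((\<lambda>t. (f (x + t *\<^sub>R u + t *\<^sub>R v) - f (x + t *\<^sub>R u) - f (x + t *\<^sub>R v) + f x) / t\<^sup>2)
           \<longlongrightarrow> h v \<bullet> u) (at_right 0)"
    by (rule second_difference_limit[OF assms])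
  have eq: "f (x + t *\<^sub>R u + t *\<^sub>R v) - f (x + t *\<^sub>R u) - f (x + t *\<^sub>R v) + f x =
       f (x + t *\<^sub>R v + t *\<^sub>R u) - f (x + t *\<^sub>R v) - f (x + t *\<^sub>R u) + f x" for t
    by (simp add: algebra_simps)
  show "((\<lambda>t. (f (x + t *\<^sub>R u + t *\<^sub>R v) - f (x + t *\<^sub>R u) - f (x + t *\<^sub>R v) + f x) / t\<^sup>2)
           \<longlongrightarrow> h u \<bullet> v) (at_right 0)"
    unfolding eq by (rule second_difference_limit[OF assms])
qed

section \<open>Norms of class C2\<close>

text \<open>For differentiating identities that hold near a point, such as homogeneity or the
  constancy of N on unit vectors.\<close>

lemma has_derivative_at_transform_eq:
  assumes "(f has_derivative f') (at x)" "(g has_derivative g') (at x)"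
    and "open U" "x \<in> U" "\<And>y. y \<in> U \<Longrightarrow> f y = g y"
  shows "f' = g'"
  using has_derivative_transform_within_open[OF assms(1,3,4), of g] assms(2,5)
    has_derivative_unique by blast

locale minkowski_norm =
  fixes N :: "real^3 \<Rightarrow> real" and G :: "real^3 \<Rightarrow> real^3" and H :: "real^3 \<Rightarrow> real^3^3"
  assumes is_norm: "is_norm N"
    and strict: "strictly_convex_norm N"
    and dN: "x \<noteq> 0 \<Longrightarrow> (N has_derivative (\<lambda>v. G x \<bullet> v)) (at x)"
    and dG: "x \<noteq> 0 \<Longrightarrow> (G has_derivative (\<lambda>v. H x *v v)) (at x)"
    and contH: "continuous_on (-{0}) H"
begin

lemma N_nonneg: "N x \<ge> 0" and N_eq_0: "N x = 0 \<longleftrightarrow> x = 0"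
  and N_scale: "N (c *\<^sub>R x) = \<bar>c\<bar> * N x" and N_triangle: "N (x + y) \<le> N x + N y"
  using is_norm unfolding is_norm_def by auto

lemma N_zero [simp]: "N 0 = 0" using N_eq_0 by simp

lemma N_pos: "x \<noteq> 0 \<Longrightarrow> N x > 0"
  using N_nonneg[of x] N_eq_0[of x] by linarith

lemma N_minus [simp]: "N (- x) = N x"
  using N_scale[of "-1" x] by simp

lemma N_minus_commute: "N (x - y) = N (y - x)"
  using N_minus[of "x - y"] by simp

lemma N_diff_triangle: "N x - N y \<le> N (x - y)"
  using N_triangle[of "x - y" y] by simp

lemma N_bound: obtains C where "C > 0" "\<And>x. N x \<le> C * norm x"
proof -
  define C where "C = (\<Sum>b\<in>Basis. N b) + 1"
  have "N x \<le> C * norm x" for x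
  proof -
    have sum_le: "N (\<Sum>i\<in>A. f i) \<le> (\<Sum>i\<in>A. N (f i))" if "finite A" for f and A :: "(real^3) set"
      using that
    proof (induction A rule: finite_induct)
      case (insert i A)
      then show ?case using N_triangle[of "f i" "\<Sum>i\<in>A. f i"] by simp
    qed simp
    have "N x = N (\<Sum>b\<in>Basis. (x \<bullet> b) *\<^sub>R b)" by (simp add: euclidean_representation)
    also have "\<dots> \<le> (\<Sum>b\<in>Basis. N ((x \<bullet> b) *\<^sub>R b))" by (rule sum_le) simp
    also have "\<dots> \<le> (\<Sum>b\<in>Basis. norm x * N b)"
      by (intro sum_mono) (auto simp: N_scale intro!: mult_right_mono Basis_le_norm N_nonneg)
    also have "\<dots> \<le> C * norm x" unfolding C_def by (simp add: sum_distrib_left algebra_simps)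
    finally show ?thesis .
  qed
  moreover have "C > 0" unfolding C_def using sum_nonneg[of Basis N] N_nonneg by (simp add: add_nonneg_pos)
  ultimately show ?thesis using that by blast
qed

lemma continuous_on_N: "continuous_on S N"
proof -
  obtain C where C: "C > 0" "\<And>x. N x \<le> C * norm x" using N_bound by blast
  have "\<bar>N x - N y\<bar> \<le> C * norm (x - y)" for x y
    using N_diff_triangle[of x y] N_diff_triangle[of y x] C(2)[of "x - y"] N_minus_commute[of x y]
    by linarith
  then have "C-lipschitz_on S N"
    using C(1) by (intro lipschitz_onI) (auto simp: dist_norm)
  then show ?thesis by (rule lipschitz_on_continuous_on)
qed

lemma continuous_on_G: "continuous_on (-{0}) G"
  using dG by (intro has_derivative_continuous_on[where f' = "\<lambda>x v. H x *v v"])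
    (auto intro: has_derivative_at_withinI)

text \<open>Euler's relation for a function homogeneous of degree 1. Accordingly G has degree 0 and
  H has degree -1 in the next two lemmas; the factor 1/c of the latter is the curvature of a
  Minkowski sphere of radius c.\<close>

lemma G_self: assumes "x \<noteq> 0" shows "G x \<bullet> x = N x"
proof -
  have "((\<lambda>t. N (t *\<^sub>R x)) has_derivative (\<lambda>t. G (1 *\<^sub>R x) \<bullet> (t *\<^sub>R x))) (at 1)"
    using assms by (intro has_derivative_compose[where g = N, OF _ dN]) (auto intro!: derivative_eq_intros)
  moreover have "((\<lambda>t. t * N x) has_derivative (\<lambda>t. t * N x)) (at 1)"
    by (auto intro!: derivative_eq_intros)
  ultimately have "(\<lambda>t. G (1 *\<^sub>R x) \<bullet> (t *\<^sub>R x)) = (\<lambda>t. t * N x)"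
    by (rule has_derivative_at_transform_eq[where U = "{0<..}"]) (auto simp: N_scale)
  from fun_cong[OF this, of 1] show ?thesis by simp
qed

lemma G_scale: assumes "x \<noteq> 0" "c > 0" shows "G (c *\<^sub>R x) = G x"
proof -
  have "((\<lambda>y. N (c *\<^sub>R y)) has_derivative (\<lambda>v. G (c *\<^sub>R x) \<bullet> (c *\<^sub>R v))) (at x)"
    using assms by (intro has_derivative_compose[where g = N, OF _ dN]) (auto intro!: derivative_eq_intros)
  moreover have "((\<lambda>y. c * N y) has_derivative (\<lambda>v. c * (G x \<bullet> v))) (at x)"
    using dN[OF assms(1)] by (auto intro!: derivative_eq_intros)
  ultimately have "(\<lambda>v. G (c *\<^sub>R x) \<bullet> (c *\<^sub>R v)) = (\<lambda>v. c * (G x \<bullet> v))"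
    by (rule has_derivative_at_transform_eq[where U = UNIV]) (use assms in \<open>auto simp: N_scale\<close>)
  then have "G (c *\<^sub>R x) \<bullet> v = G x \<bullet> v" for v using fun_cong[of _ _ v] assms(2) by fastforce
  then show ?thesis using vector_eq_rdot by blast
qed

lemma H_scale: assumes "x \<noteq> 0" "c > 0" shows "H (c *\<^sub>R x) *v v = (H x *v v) /\<^sub>R c"
proof -
  have "((\<lambda>y. G (c *\<^sub>R y)) has_derivative (\<lambda>v. H (c *\<^sub>R x) *v (c *\<^sub>R v))) (at x)"
    using assms by (intro has_derivative_compose[where g = G, OF _ dG]) (auto intro!: derivative_eq_intros)
  moreover note dG[OF assms(1)]
  ultimately have "(\<lambda>v. H (c *\<^sub>R x) *v (c *\<^sub>R v)) = (\<lambda>v. H x *v v)"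
    by (rule has_derivative_at_transform_eq[where U = "-{0}"]) (use assms G_scale in auto)
  from fun_cong[OF this, of "v /\<^sub>R c"] assms(2) show ?thesis
    by (simp add: matrix_vector_mult_scaleR)
qed

lemma H_symmetric: assumes "x \<noteq> 0" shows "(H x *v u) \<bullet> v = (H x *v v) \<bullet> u"
  by (rule second_derivative_symmetric[where U = "-{0}" and f = N and g = G]) (use assms dN dG in auto)

text \<open>By convexity the difference quotients of N along the segment from x to y are at most
  \<open>N y - N x\<close>, and so is their limit at x.\<close>

lemma N_supporting: assumes "x \<noteq> 0" shows "N y \<ge> N x + G x \<bullet> (y - x)"
proof -
  define f where "f = (\<lambda>t. N (x + t *\<^sub>R (y - x)))"
  have f': "(f has_real_derivative G x \<bullet> (y - x)) (at 0)"
    unfolding f_def has_field_derivative_def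
    by (rule has_derivative_eq_rhs, rule has_derivative_compose[where g = N, OF _ dN])
       (use assms in \<open>auto intro!: derivative_eq_intros\<close>)
  then have lim: "((\<lambda>t. (f t - f 0) / t) \<longlongrightarrow> G x \<bullet> (y - x)) (at_right 0)"
    unfolding has_field_derivative_iff by (simp add: filterlim_at_split)
  have "\<forall>\<^sub>F t in at_right 0. (f t - f 0) / t \<le> N y - N x"
    unfolding eventually_at_right_field
  proof (intro exI[of _ 1] conjI allI impI)
    fix t :: real assume t: "0 < t" "t < 1"
    have "f t = N ((1 - t) *\<^sub>R x + t *\<^sub>R y)" unfolding f_def by (simp add: algebra_simps)
    also have "\<dots> \<le> (1 - t) * N x + t * N y"
      using N_triangle[of "(1 - t) *\<^sub>R x" "t *\<^sub>R y"] t by (simp add: N_scale)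
    finally have "f t - f 0 \<le> t * (N y - N x)" unfolding f_def by (simp add: algebra_simps)
    then show "(f t - f 0) / t \<le> N y - N x" using t by (simp add: field_simps)
  qed simp
  from tendsto_upperbound[OF lim this] show ?thesis by simp
qed

lemma G_le_N: assumes "x \<noteq> 0" shows "G x \<bullet> y \<le> N y"
  using N_supporting[OF assms, of y] G_self[OF assms] by (simp add: inner_diff_right)

text \<open>With both directions equal to v the second difference is nonnegative, because
  \<open>x + t *\<^sub>R v\<close> is the midpoint of the two outer points.\<close>

lemma H_nonneg: assumes "x \<noteq> 0" shows "(H x *v v) \<bullet> v \<ge> 0"
proof -
  have lim: "((\<lambda>t. (N (x + t *\<^sub>R v + t *\<^sub>R v) - N (x + t *\<^sub>R v) - N (x + t *\<^sub>R v) + N x) / t\<^sup>2)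
           \<longlongrightarrow> (H x *v v) \<bullet> v) (at_right 0)"
    by (rule second_difference_limit[where U = "-{0}" and g = G]) (use assms dN dG in auto)
  have "N (x + t *\<^sub>R v + t *\<^sub>R v) - N (x + t *\<^sub>R v) - N (x + t *\<^sub>R v) + N x \<ge> 0" for t
  proof -
    have eq: "2 *\<^sub>R (x + t *\<^sub>R v) = (x + t *\<^sub>R v + t *\<^sub>R v) + x" by (simp add: scaleR_2)
    have "2 * N (x + t *\<^sub>R v) \<le> N (x + t *\<^sub>R v + t *\<^sub>R v) + N x"
      using N_triangle[of "x + t *\<^sub>R v + t *\<^sub>R v" x] N_scale[of 2 "x + t *\<^sub>R v"]
      unfolding eq by simp
    then show ?thesis by linarith
  qed
  then show ?thesis
    by (intro tendsto_lowerbound[OF lim]) (auto intro!: always_eventually divide_nonneg_nonneg)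
qed

text \<open>A vector on which a semidefinite form vanishes minimises the form, so the derivative
  there, twice \<open>H x *v v\<close>, vanishes as well.\<close>

lemma H_kernel:
  assumes "x \<noteq> 0" "(H x *v v) \<bullet> v = 0" shows "H x *v v = 0"
proof -
  let ?w = "H x *v v"
  have "?w \<bullet> ?w \<le> 0"
  proof (rule ccontr)
    assume "\<not> ?w \<bullet> ?w \<le> 0"
    then have pos: "?w \<bullet> ?w > 0" by (simp only: not_le)
    define q where "q = (H x *v ?w) \<bullet> ?w"
    have q: "q \<ge> 0" unfolding q_def by (rule H_nonneg[OF assms(1)])
    have "0 \<le> (H x *v (v + t *\<^sub>R ?w)) \<bullet> (v + t *\<^sub>R ?w)" for t by (rule H_nonneg[OF assms(1)])
    then have ineq: "0 \<le> 2 * t * (?w \<bullet> ?w) + t\<^sup>2 * q" for t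
      using assms(2) H_symmetric[OF assms(1), of "?w" v] unfolding q_def
      by (simp add: matrix_vector_mult_scaleR matrix_vector_right_distrib inner_add_left inner_add_right
          power2_eq_square algebra_simps)
    \<comment> \<open>At this t the parabola
      \<open>2 * t * (?w \<bullet> ?w) + t\<^sup>2 * q\<close> has the negative value
      \<open>- (t\<^sup>2 * (q + 2))\<close>; the summand 1 keeps the denominator positive when q is
      0.\<close>
    define t where "t = - (?w \<bullet> ?w) / (q + 1)"
    have wt: "?w \<bullet> ?w = - t * (q + 1)" unfolding t_def using q by simp
    have "2 * t * (?w \<bullet> ?w) + t\<^sup>2 * q = - (t\<^sup>2 * (q + 2))"
      unfolding wt by (simp add: power2_eq_square algebra_simps)
    also have "\<dots> < 0" using q pos unfolding wt by (auto simp: zero_less_mult_iff)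
    finally show False using ineq[of t] by simp
  qed
  then show ?thesis using inner_eq_zero_iff[of ?w] inner_ge_zero[of ?w] by linarith
qed

lemma birkhoff_orthogonal_imp:
  assumes "birkhoff_orthogonal N x P" "x \<noteq> 0" "v \<in> P" shows "G x \<bullet> v = 0"
proof -
  have "((\<lambda>t. N (x + t *\<^sub>R v)) has_derivative (\<lambda>t. G (x + 0 *\<^sub>R v) \<bullet> (t *\<^sub>R v))) (at 0)"
    by (rule has_derivative_compose[where g = N, OF _ dN])
       (use assms(2) in \<open>auto intro!: derivative_eq_intros\<close>)
  then have "((\<lambda>t. N (x + t *\<^sub>R v)) has_derivative (\<lambda>t. t * (G x \<bullet> v))) (at 0)" by simp
  then have der: "DERIV (\<lambda>t. N (x + t *\<^sub>R v)) 0 :> G x \<bullet> v"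
    by (simp add: has_field_derivative_def mult_commute_abs)
  show ?thesis
    by (rule DERIV_local_min[OF der zero_less_one]) (use assms(1,3) in \<open>auto simp: birkhoff_orthogonal_def\<close>)
qed

text \<open>Strict convexity lets a plane direction touch the unit sphere in two opposite points
  only. If a = \<open>G x \<bullet> y\<close> is nonnegative, \<open>G y\<close> annihilates
  \<open>y - a *\<^sub>R x\<close>, and the supporting inequality at y gives a \<ge> 1; for y
  different from x the midpoint of both then has \<open>G x\<close>-value at least 1 but norm less
  than 1.\<close>

lemma G_kernel_determines:
  assumes "N x = 1" "N y = 1" "\<And>v. G x \<bullet> v = 0 \<Longrightarrow> G y \<bullet> v = 0"
  shows "y = x \<or> y = - x"
proof -
  have nz: "x \<noteq> 0" "y \<noteq> 0" using assms(1,2) by auto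
  have gen: "y = x" if y: "N y = 1" "\<And>v. G x \<bullet> v = 0 \<Longrightarrow> G y \<bullet> v = 0" "G x \<bullet> y \<ge> 0" for y
  proof (rule ccontr)
    assume ne: "y \<noteq> x"
    have nz': "y \<noteq> 0" using y(1) by auto
    define a where "a = G x \<bullet> y"
    have "G x \<bullet> (y - a *\<^sub>R x) = 0" using G_self[OF nz(1)] assms(1) unfolding a_def by (simp add: inner_diff_right)
    then have 0: "G y \<bullet> (y - a *\<^sub>R x) = 0" by (rule y(2))
    have "N (a *\<^sub>R x) \<ge> N y + G y \<bullet> (a *\<^sub>R x - y)" by (rule N_supporting[OF nz'])
    then have "\<bar>a\<bar> \<ge> 1" using 0 y(1) assms(1) by (simp add: N_scale inner_diff_right)
    then have a1: "a \<ge> 1" using y(3) unfolding a_def by simp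
    have "N ((1 - 1/2) *\<^sub>R x + (1/2) *\<^sub>R y) < 1"
      using strict[unfolded strictly_convex_norm_def, rule_format, of x y "1/2"] assms(1) y(1) ne by auto
    moreover have "G x \<bullet> ((1 - 1/2) *\<^sub>R x + (1/2) *\<^sub>R y) \<ge> 1"
      using a1 G_self[OF nz(1)] assms(1) unfolding a_def by (simp add: inner_add_right)
    ultimately show False using G_le_N[OF nz(1), of "(1 - 1/2) *\<^sub>R x + (1/2) *\<^sub>R y"] by linarith
  qed
  have Gm: "G (- y) = - G y"
  proof -
    have "((\<lambda>y. N (- y)) has_derivative (\<lambda>v. G (- y) \<bullet> (- v))) (at y)"
      by (rule has_derivative_compose[where g = N, OF _ dN]) (use nz in \<open>auto intro!: derivative_eq_intros\<close>)
    then have "(\<lambda>v. G (- y) \<bullet> (- v)) = (\<lambda>v. G y \<bullet> v)"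
      by (rule has_derivative_at_transform_eq[where U = UNIV]) (use dN[OF nz(2)] in auto)
    then have "G (- y) \<bullet> v = (- G y) \<bullet> v" for v using fun_cong[of _ _ v] by fastforce
    then show ?thesis using vector_eq_rdot by blast
  qed
  show ?thesis
  proof (cases "G x \<bullet> y \<ge> 0")
    case True
    then show ?thesis using gen assms by blast
  next
    case False
    then have "- y = x" using assms by (intro gen) (auto simp: Gm)
    then show ?thesis by auto
  qed
qed

end

section \<open>Gradients and Jacobian matrices of smooth maps\<close>

definition gradient :: "(real^3 \<Rightarrow> real) \<Rightarrow> real^3 \<Rightarrow> real^3" where
  "gradient f x = (\<Sum>b\<in>Basis. frechet_derivative f (at x) b *\<^sub>R b)"

definition jacobian_matrix :: "(real^3 \<Rightarrow> real^3) \<Rightarrow> real^3 \<Rightarrow> real^3^3" where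
  "jacobian_matrix f x = matrix (frechet_derivative f (at x))"

lemma smooth_on_gradient: assumes "open S" "smooth_on S f" shows "smooth_on S (gradient f)"
  unfolding gradient_def
  by (intro smooth_on_sum smooth_on_scaleR smooth_on_const smooth_on_derivative assms finite_Basis)

lemma has_derivative_gradient:
  assumes "smooth_on S f" "x \<in> S"
  shows "(f has_derivative (\<lambda>v. gradient f x \<bullet> v)) (at x)"
proof -
  note d = smooth_on_imp_has_derivative[OF assms]
  have "frechet_derivative f (at x) v = gradient f x \<bullet> v" for v
  proof -
    have lin: "linear (frechet_derivative f (at x))" using d by (rule has_derivative_linear)
    have "frechet_derivative f (at x) v = frechet_derivative f (at x) (\<Sum>b\<in>Basis. (v \<bullet> b) *\<^sub>R b)"
      by (simp add: euclidean_representation)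
    also have "\<dots> = gradient f x \<bullet> v"
      unfolding gradient_def
      by (simp add: linear_sum[OF lin] linear_scale[OF lin] inner_sum_left inner_sum_right inner_commute mult.commute)
    finally show ?thesis .
  qed
  then have "frechet_derivative f (at x) = (\<lambda>v. gradient f x \<bullet> v)" by blast
  then show ?thesis using d by simp
qed

lemma has_derivative_jacobian_matrix:
  assumes "smooth_on S f" "x \<in> S"
  shows "(f has_derivative (\<lambda>v. jacobian_matrix f x *v v)) (at x)"
proof -
  note d = smooth_on_imp_has_derivative[OF assms]
  show ?thesis using d unfolding jacobian_matrix_def matrix_vector_mul(2)[OF has_derivative_linear[OF d]] .
qed

lemma continuous_on_jacobian_matrix:
  assumes "smooth_on S f" shows "continuous_on S (jacobian_matrix f)"
proof -
  have "continuous_on S (\<lambda>x. \<chi> i j. frechet_derivative f (at x) (axis j 1) $ i)"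
    by (intro continuous_on_vec_lambda continuous_on_component smooth_on_imp_continuous_on
        smooth_on_derivative assms)
  then show ?thesis unfolding jacobian_matrix_def[abs_def] matrix_def by simp
qed

lemma smooth_norm_minkowski_norm:
  assumes "smooth_norm N" "strictly_convex_norm N"
  shows "minkowski_norm N (gradient N) (jacobian_matrix (gradient N))"
proof -
  have s: "smooth_on (-{0}) N" and "is_norm N" using assms(1) unfolding smooth_norm_def by auto
  have g: "smooth_on (-{0}) (gradient N)" by (rule smooth_on_gradient[OF _ s]) (simp add: open_Compl)
  show ?thesis
    by unfold_locales
      (use \<open>is_norm N\<close> assms(2) has_derivative_gradient[OF s] has_derivative_jacobian_matrix[OF g]
        continuous_on_jacobian_matrix[OF g] in auto)
qed

section \<open>Curvature of the unit sphere\<close>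

lemma basis_of:
  assumes "subspace (T :: 'a::euclidean_space set)"
  shows "basis_of T \<subseteq> T" "independent (basis_of T)" "span (basis_of T) = T"
    "finite (basis_of T)" "card (basis_of T) = dim T"
proof -
  obtain B where B: "B \<subseteq> T" "independent B" "T \<subseteq> span B" by (rule basis_exists[of T])
  then have ex: "\<exists>B. B \<subseteq> T \<and> independent B \<and> span B = T"
    using span_minimal[OF B(1) assms] by blast
  have *: "basis_of T \<subseteq> T \<and> independent (basis_of T) \<and> span (basis_of T) = T"
    using someI_ex[OF ex] unfolding basis_of_def .
  show "basis_of T \<subseteq> T" "independent (basis_of T)" "span (basis_of T) = T"
    using * by blast+
  show "finite (basis_of T)" using * independent_imp_finite by blast
  show "card (basis_of T) = dim T" using * dim_span_eq_card_independent by metis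
qed

text \<open>\<open>det_on\<close> evaluates L at the two basis vectors only, so L may be replaced
  there by the linear map A. The coordinates of the kernel vector v are then a linear dependence of
  the two columns.\<close>

lemma det_on_eq_0:
  assumes T: "subspace (T :: 'a::euclidean_space set)" "dim T = 2"
    and L: "\<And>v. v \<in> T \<Longrightarrow> L v = A v" "linear A" "\<And>v. v \<in> T \<Longrightarrow> A v \<in> T"
    and v: "v \<in> T" "v \<noteq> 0" "A v = 0"
  shows "det_on T L = 0"
proof -
  define B where "B = basis_of T"
  note B = basis_of[OF T(1), folded B_def]
  obtain b1 b2 where b: "B = {b1, b2}" "b1 \<noteq> b2"
    using B(5) T(2) card_2_iff by metis
  define r where "r = representation B"
  have bT: "b1 \<in> T" "b2 \<in> T" using B(1) b by auto
  have AT: "A b1 \<in> span B" "A b2 \<in> span B" using L(3) bT B(3) by auto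
  have "det_on T L = (\<Sum>\<pi> | \<pi> permutes {b1, b2}.
        of_int (sign \<pi>) * (\<Prod>b\<in>{b1, b2}. r (A b) (\<pi> b)))"
    unfolding det_on_def B_def[symmetric] b(1)[symmetric] r_def
    by (intro sum.cong prod.cong refl arg_cong2[where f = times])
       (use B(1) L(1) in auto)
  also have "{\<pi>. \<pi> permutes {b1, b2}} = {id, Transposition.transpose b1 b2}"
    by (auto simp: permutes_doubleton_iff)
  also have "(\<Sum>\<pi> \<in> {id, Transposition.transpose b1 b2}.
        of_int (sign \<pi>) * (\<Prod>b\<in>{b1, b2}. r (A b) (\<pi> b)))
      = r (A b1) b1 * r (A b2) b2 - r (A b1) b2 * r (A b2) b1"
  proof -
    have "id \<noteq> Transposition.transpose b1 b2"
      using b(2) by (metis id_apply transpose_apply_first)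
    then show ?thesis using b(2) by (simp add: sign_id sign_swap_id)
  qed
  also have "\<dots> = 0"
  proof -
    define \<alpha> where "\<alpha> = r v b1"
    define \<beta> where "\<beta> = r v b2"
    have vs: "v = \<alpha> *\<^sub>R b1 + \<beta> *\<^sub>R b2"
      using sum_representation_eq[OF B(2), of v B] v(1) B(3,4) b unfolding \<alpha>_def \<beta>_def r_def by auto
    have "\<alpha> *\<^sub>R A b1 + \<beta> *\<^sub>R A b2 = 0"
      using v(3) unfolding vs by (simp add: linear_add[OF L(2)] linear_scale[OF L(2)])
    then have "r (\<alpha> *\<^sub>R A b1 + \<beta> *\<^sub>R A b2) = (\<lambda>b. 0)" unfolding r_def by (simp add: representation_zero)
    then have "\<alpha> * r (A b1) b + \<beta> * r (A b2) b = 0" for b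
      using AT B(2) unfolding r_def
      by (simp add: representation_add span_scale representation_scale fun_eq_iff)
    then have e: "\<alpha> * r (A b1) b1 + \<beta> * r (A b2) b1 = 0" "\<alpha> * r (A b1) b2 + \<beta> * r (A b2) b2 = 0" by auto
    \<comment> \<open>Elimination shows that \<alpha> times the determinant and \<beta> times the
      determinant vanish; one of the two factors is not 0.\<close>
    have nz: "\<alpha> \<noteq> 0 \<or> \<beta> \<noteq> 0" using vs v(2) by auto
    have "\<alpha> * (r (A b1) b1 * r (A b2) b2 - r (A b1) b2 * r (A b2) b1) = 0"
      "\<beta> * (r (A b1) b1 * r (A b2) b2 - r (A b1) b2 * r (A b2) b1) = 0"
      using e by algebra+
    then show ?thesis using nz by auto
  qed
  finally show ?thesis .
qed

text \<open>One explicit left inverse, differentiable in the ambient space, supplies both remaining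
  clauses: by the chain rule the derivative of \<phi> is injective, and continuity of \<psi> gives
  the homeomorphism.\<close>

lemma local_parametrization_left_inverse:
  assumes "open V" "smooth_on V \<phi>" "openin (top_of_set M) (\<phi> ` V)"
    and inv: "\<And>u. u \<in> V \<Longrightarrow> \<psi> (\<phi> u) = u"
    and diff: "\<And>u. u \<in> V \<Longrightarrow> \<psi> differentiable (at (\<phi> u))"
  shows "local_parametrization M V \<phi>"
  unfolding local_parametrization_def
proof (intro conjI ballI assms(1-3) exI[of _ \<psi>])
  fix u assume u: "u \<in> V"
  note d = smooth_on_imp_has_derivative[OF assms(2) u]
  have "(\<psi> has_derivative frechet_derivative \<psi> (at (\<phi> u))) (at (\<phi> u))"
    using diff[OF u] frechet_derivative_works by blast
  from has_derivative_compose[OF d this]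
  have c: "((\<lambda>x. \<psi> (\<phi> x)) has_derivative
      (\<lambda>x. frechet_derivative \<psi> (at (\<phi> u)) (frechet_derivative \<phi> (at u) x))) (at u)" .
  have "(\<lambda>x. frechet_derivative \<psi> (at (\<phi> u)) (frechet_derivative \<phi> (at u) x)) = (\<lambda>x. x)"
    by (rule has_derivative_at_transform_eq[OF c has_derivative_ident assms(1) u]) (rule inv)
  then show "inj (frechet_derivative \<phi> (at u))" by (metis injI)
next
  have "continuous_on (\<phi> ` V) \<psi>"
    using diff by (intro continuous_at_imp_continuous_on) (auto intro: differentiable_imp_continuous_within)
  then show "homeomorphism V (\<phi> ` V) \<phi> \<psi>"
    using smooth_on_imp_continuous_on[OF assms(2)] inv
    unfolding homeomorphism_def by (force simp: image_image)
qed

text \<open>The curve \<gamma>0 guarantees uniqueness: without any curve of velocity v the condition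
  in the definite description would hold for every w.\<close>

lemma surface_differentialI:
  assumes "curve_through M p v \<gamma>0"
    and "\<And>\<gamma>. curve_through M p v \<gamma> \<Longrightarrow> (f \<circ> \<gamma> has_vector_derivative w) (at 0)"
  shows "surface_differential M f p v = w"
  unfolding surface_differential_def
  using assms by (intro the_equality) (auto intro: vector_derivative_unique_at)

context minkowski_norm
begin

lemma tangent_space_sphere_orthogonal:
  assumes "curve_through (minkowski_sphere N 0 1 \<inter> U) p v \<gamma>"
  shows "G p \<bullet> v = 0"
proof -
  obtain e where e: "e > 0" "\<gamma> ` {-e<..<e} \<subseteq> minkowski_sphere N 0 1 \<inter> U"
    and p: "\<gamma> 0 = p" and v: "(\<gamma> has_vector_derivative v) (at 0)"
    using assms unfolding curve_through_def by blast
  have N1: "N (\<gamma> t) = 1" if "t \<in> {-e<..<e}" for t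
    using e(2) that unfolding minkowski_sphere_def by (auto simp: image_subset_iff)
  then have "p \<noteq> 0" using p e(1) N1[of 0] by auto
  then have "((\<lambda>t. N (\<gamma> t)) has_derivative (\<lambda>t. G (\<gamma> 0) \<bullet> (t *\<^sub>R v))) (at 0)"
    using v p unfolding has_vector_derivative_def by (intro has_derivative_compose[where g = N, OF _ dN]) auto
  then have "(\<lambda>t. G (\<gamma> 0) \<bullet> (t *\<^sub>R v)) = (\<lambda>t. 0)"
    by (rule has_derivative_at_transform_eq[where U = "{-e<..<e}" and g = "\<lambda>t. 1"])
       (use e N1 in \<open>auto intro: has_derivative_const\<close>)
  from fun_cong[OF this, of 1] p show ?thesis by simp
qed

text \<open>Central projection onto the unit sphere, with a real power as factor so that smoothness
  follows from \<open>smooth_on_powr\<close>.\<close>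

definition radial :: "real^3 \<Rightarrow> real^3" where "radial x = (N x powr -1) *\<^sub>R x"

lemma radial_eq: "x \<noteq> 0 \<Longrightarrow> radial x = x /\<^sub>R N x"
  using N_pos[of x] unfolding radial_def by (simp add: powr_minus)

lemma N_radial: "x \<noteq> 0 \<Longrightarrow> N (radial x) = 1"
  using N_pos[of x] by (simp add: radial_eq N_scale)

lemma smooth_radial: assumes "smooth_on (-{0}) N" shows "smooth_on (-{0}) radial"
  unfolding radial_def[abs_def]
  by (intro smooth_on_scaleR smooth_on_powr assms smooth_on_bounded_linear bounded_linear_ident)
     (auto simp: open_Compl intro: N_pos)

text \<open>The tangent plane at p supports the ball, so
  \<open>N (p + t *\<^sub>R v) \<ge> 1\<close> and the projection is defined along the whole line.
  As the derivative of this norm at t = 0 is 0, projecting does not change the velocity v.\<close>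

lemma radial_curve:
  assumes sm: "smooth_on (-{0}) N" and p: "N p = 1" "p \<in> U" "open U" and v: "G p \<bullet> v = 0"
  shows "curve_through (minkowski_sphere N 0 1 \<inter> U) p v (\<lambda>t. radial (p + t *\<^sub>R v))"
proof -
  have p0: "p \<noteq> 0" using p by auto
  have ge: "N (p + t *\<^sub>R v) \<ge> 1" for t
    using N_supporting[OF p0, of "p + t *\<^sub>R v"] p v by simp
  have nz: "p + t *\<^sub>R v \<noteq> 0" for t using ge[of t] by auto
  have sm\<gamma>: "smooth_on UNIV (\<lambda>t. radial (p + t *\<^sub>R v))"
  proof (rule smooth_on_compose[OF _ _ _ _ smooth_radial[OF sm]])
    show "smooth_on UNIV (\<lambda>t. p + t *\<^sub>R v)"
      by (intro smooth_on_add smooth_on_const smooth_on_bounded_linear bounded_linear_scaleR_left) auto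
  qed (use nz in \<open>auto simp: open_Compl\<close>)
  have "((\<lambda>t. N (p + t *\<^sub>R v)) has_derivative (\<lambda>t. G (p + 0 *\<^sub>R v) \<bullet> (t *\<^sub>R v))) (at 0)"
    by (rule has_derivative_compose[where g = N, OF _ dN])
       (use p0 in \<open>auto intro!: derivative_eq_intros\<close>)
  then have dN0: "((\<lambda>t. N (p + t *\<^sub>R v)) has_derivative (\<lambda>t. 0)) (at 0)" using v by simp
  have "((\<lambda>t. (p + t *\<^sub>R v) /\<^sub>R N (p + t *\<^sub>R v)) has_derivative (\<lambda>t. t *\<^sub>R v)) (at 0)"
    by (rule has_derivative_eq_rhs, rule has_derivative_scaleR, rule Deriv.has_derivative_inverse[OF _ dN0])
       (use p in \<open>auto intro!: derivative_eq_intros\<close>)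
  then have der: "((\<lambda>t. radial (p + t *\<^sub>R v)) has_vector_derivative v) (at 0)"
    using nz by (simp add: radial_eq has_vector_derivative_def)
  have r0: "radial (p + 0 *\<^sub>R v) = p" using p0 p by (simp add: radial_eq)
  have "continuous_on UNIV (\<lambda>t. radial (p + t *\<^sub>R v))" by (rule smooth_on_imp_continuous_on[OF sm\<gamma>])
  then have "open ((\<lambda>t. radial (p + t *\<^sub>R v)) -` U)" using p(3) by (simp add: open_vimage)
  moreover have "0 \<in> (\<lambda>t. radial (p + t *\<^sub>R v)) -` U" using r0 p by simp
  ultimately obtain e where e: "e > 0" "ball 0 e \<subseteq> (\<lambda>t. radial (p + t *\<^sub>R v)) -` U"
    using openE by blast
  have "(\<lambda>t. radial (p + t *\<^sub>R v)) ` {-e<..<e} \<subseteq> minkowski_sphere N 0 1 \<inter> U"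
    using e(2) nz by (auto simp: minkowski_sphere_def N_radial subset_iff dist_real_def)
  moreover have "smooth_on {-e<..<e} (\<lambda>t. radial (p + t *\<^sub>R v))" using sm\<gamma> smooth_on_subset by blast
  ultimately show ?thesis unfolding curve_through_def using e(1) r0 der by auto
qed

lemma tangent_space_sphere:
  assumes "smooth_on (-{0}) N" "N p = 1" "p \<in> U" "open U"
  shows "tangent_space (minkowski_sphere N 0 1 \<inter> U) p = {v. G p \<bullet> v = 0}"
  using tangent_space_sphere_orthogonal radial_curve[OF assms] unfolding tangent_space_def by blast

text \<open>The chart is the central projection of the affine tangent plane at w, with coordinates
  from a linear isometry of \<open>real^2\<close> onto the plane; the radius is small enough for the
  image to stay in U.\<close>

lemma sphere_parametrization:
  assumes sm: "smooth_on (-{0}) N" and w: "N w = 1" "w \<in> U" "open U"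
  obtains \<phi> \<rho> where "\<rho> > 0" "local_parametrization (minkowski_sphere N 0 1 \<inter> U) (ball 0 \<rho>) \<phi>" "\<phi> 0 = w"
proof -
  let ?S = "minkowski_sphere N 0 1 \<inter> U" and ?T = "{v. G w \<bullet> v = 0}"
  have w0: "w \<noteq> 0" using w by auto
  have Gw: "G w \<bullet> w = 1" using G_self[OF w0] w by simp
  then have G0: "G w \<noteq> 0" by auto
  have "dim (UNIV :: (real^2) set) = dim ?T" using dim_hyperplane[OF G0] by simp
  then obtain \<iota> g where \<iota>: "linear \<iota>" "\<iota> ` (UNIV::(real^2) set) = ?T" "linear g"
    and nrm: "\<And>u. norm (\<iota> u) = norm u" and g: "\<And>u. g (\<iota> u) = u"
    by (rule isometries_subspaces[OF subspace_UNIV subspace_hyperplane]) auto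
  have \<iota>T: "G w \<bullet> \<iota> u = 0" for u using \<iota>(2) by blast
  define \<phi> where "\<phi> = (\<lambda>u. radial (w + \<iota> u))"
  have ge: "N (w + \<iota> u) \<ge> 1" for u
    using N_supporting[OF w0, of "w + \<iota> u"] w \<iota>T by simp
  have nz: "w + \<iota> u \<noteq> 0" for u using ge[of u] by auto
  have blin: "bounded_linear \<iota>" "bounded_linear g" using \<iota> linear_conv_bounded_linear by auto
  have sm\<phi>: "smooth_on UNIV \<phi>" unfolding \<phi>_def
  proof (rule smooth_on_compose[OF _ _ _ _ smooth_radial[OF sm]])
    show "smooth_on UNIV (\<lambda>u. w + \<iota> u)"
      by (intro smooth_on_add smooth_on_const smooth_on_bounded_linear blin) auto
  qed (use nz in \<open>auto simp: open_Compl\<close>)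
  have \<phi>0: "\<phi> 0 = w" using w w0 linear_0[OF \<iota>(1)] by (simp add: \<phi>_def radial_eq)
  have "open (\<phi> -` U)" using smooth_on_imp_continuous_on[OF sm\<phi>] w(3) by (simp add: open_vimage)
  moreover have "0 \<in> \<phi> -` U" using \<phi>0 w by simp
  ultimately obtain \<rho> where \<rho>: "\<rho> > 0" "ball 0 \<rho> \<subseteq> \<phi> -` U" using openE by blast
  \<comment> \<open>The ray through x meets the affine tangent plane where \<open>G w\<close> takes
    the value 1. Dividing by \<open>G w \<bullet> x\<close> finds this point, and g undoes the
    isometry.\<close>
  define \<psi> where "\<psi> = (\<lambda>x. g (x /\<^sub>R (G w \<bullet> x) - w))"
  have G\<phi>: "G w \<bullet> \<phi> u = inverse (N (w + \<iota> u))" for u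
    using nz[of u] Gw \<iota>T[of u] by (simp add: \<phi>_def radial_eq inner_add_right)
  have pos: "G w \<bullet> \<phi> u > 0" for u using G\<phi>[of u] ge[of u] by (simp add: less_le_trans[OF zero_less_one])
  have scaled: "\<phi> u /\<^sub>R (G w \<bullet> \<phi> u) - w = \<iota> u" for u
    unfolding G\<phi> using N_pos[OF nz[of u]] by (simp add: \<phi>_def radial_eq[OF nz])
  have inv: "\<psi> (\<phi> u) = u" for u unfolding \<psi>_def scaled by (rule g)
  define O' where "O' = {x. G w \<bullet> x > 0} \<inter> (\<lambda>x. x /\<^sub>R (G w \<bullet> x) - w) -` ball 0 \<rho>"
  have openO: "open O'"
  proof -
    have "continuous_on {x. G w \<bullet> x > 0} (\<lambda>x. x /\<^sub>R (G w \<bullet> x) - w)"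
      by (intro continuous_intros) auto
    then show ?thesis unfolding O'_def
      by (intro continuous_open_preimage) (auto intro: open_halfspace_gt)
  qed
  have img: "\<phi> ` ball 0 \<rho> = ?S \<inter> O'"
  proof (intro equalityI subsetI)
    fix x assume "x \<in> \<phi> ` ball 0 \<rho>"
    then obtain u where u: "u \<in> ball 0 \<rho>" "x = \<phi> u" by blast
    then show "x \<in> ?S \<inter> O'"
      using \<rho>(2) N_radial[OF nz[of u]] pos[of u] scaled[of u] nrm[of u]
      unfolding O'_def minkowski_sphere_def by (auto simp: \<phi>_def[symmetric]) (simp add: \<phi>_def)
  next
    fix x assume x: "x \<in> ?S \<inter> O'"
    then have xp: "G w \<bullet> x > 0" and Nx: "N x = 1" and nx: "norm (x /\<^sub>R (G w \<bullet> x) - w) < \<rho>"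
      unfolding O'_def minkowski_sphere_def by auto
    have "G w \<bullet> (x /\<^sub>R (G w \<bullet> x) - w) = 0" using xp Gw by (simp add: inner_diff_right)
    then obtain u where u: "x /\<^sub>R (G w \<bullet> x) - w = \<iota> u" using \<iota>(2) by blast
    then have eq: "w + \<iota> u = x /\<^sub>R (G w \<bullet> x)" by (metis add_diff_cancel_left' diff_add_cancel add.commute)
    have "\<phi> u = x" unfolding \<phi>_def radial_eq[OF nz] eq using xp Nx by (simp add: N_scale)
    moreover have "u \<in> ball 0 \<rho>" using nx unfolding u nrm by simp
    ultimately show "x \<in> \<phi> ` ball 0 \<rho>" by blast
  qed
  have "local_parametrization ?S (ball 0 \<rho>) \<phi>"
  proof (rule local_parametrization_left_inverse[where \<psi> = \<psi>])
    show "openin (top_of_set ?S) (\<phi> ` ball 0 \<rho>)" unfolding img using openO by blast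
    show "smooth_on (ball 0 \<rho>) \<phi>" using sm\<phi> smooth_on_subset by blast
    fix u
    have "(\<lambda>x. x /\<^sub>R (G w \<bullet> x) - w) differentiable (at (\<phi> u))"
      using pos[of u] by (auto intro!: derivative_intros)
    moreover have "g differentiable (at y)" for y using blin(2) by (rule bounded_linear_imp_differentiable)
    ultimately show "\<psi> differentiable (at (\<phi> u))"
      unfolding \<psi>_def using differentiable_chain_at[of "\<lambda>x. x /\<^sub>R (G w \<bullet> x) - w" "\<phi> u" g]
      by (simp add: o_def)
  qed (use inv in auto)
  then show ?thesis using that \<rho>(1) \<phi>0 by blast
qed

text \<open>The Euclidean Gauss map of the level sets of N, given on an open set so that it can be
  differentiated in space. The power -1/2 of the squared length makes smoothness a case of the power
  rule.\<close>

definition sphere_normal :: "real^3 \<Rightarrow> real^3" where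
  "sphere_normal x = ((G x \<bullet> G x) powr (-1/2)) *\<^sub>R G x"

lemma G_nonzero: "x \<noteq> 0 \<Longrightarrow> G x \<noteq> 0"
  using G_self[of x] N_pos[of x] by auto

lemma sphere_normal_eq: "x \<noteq> 0 \<Longrightarrow> sphere_normal x = G x /\<^sub>R norm (G x)"
  using powr_minus[of "G x \<bullet> G x" "1/2"] powr_half_sqrt[of "G x \<bullet> G x"]
  by (simp add: sphere_normal_def norm_eq_sqrt_inner)

lemma sphere_normal_unit: "x \<noteq> 0 \<Longrightarrow> sphere_normal x \<bullet> sphere_normal x = 1"
  unfolding norm_eq_1[symmetric] by (simp add: sphere_normal_eq G_nonzero)

lemma smooth_sphere_normal: assumes "smooth_on (-{0}) G" shows "smooth_on (-{0}) sphere_normal"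
  unfolding sphere_normal_def[abs_def]
  by (intro smooth_on_scaleR smooth_on_powr smooth_on_inner assms) (auto simp: open_Compl G_nonzero)

lemma unit_normal_field_sphere:
  assumes "smooth_on (-{0}) G"
  shows "unit_normal_field (minkowski_sphere N 0 1) sphere_normal"
  unfolding unit_normal_field_def smooth_on_surface_def
proof (intro conjI allI impI ballI)
  fix V \<phi> assume lp: "local_parametrization (minkowski_sphere N 0 1) V \<phi>"
  then have "\<phi> ` V \<subseteq> minkowski_sphere N 0 1" "open V" "smooth_on V \<phi>"
    unfolding local_parametrization_def openin_subtopology by auto
  then show "smooth_on V (sphere_normal \<circ> \<phi>)"
    unfolding o_def
    by (intro smooth_on_compose[OF _ _ _ _ smooth_sphere_normal[OF assms]])
       (auto simp: open_Compl minkowski_sphere_def)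
next
  fix p assume "p \<in> minkowski_sphere N 0 1"
  then have p0: "p \<noteq> 0" by (auto simp: minkowski_sphere_def)
  show "norm (sphere_normal p) = 1" using G_nonzero[OF p0] by (simp add: sphere_normal_eq[OF p0])
  fix v assume "v \<in> tangent_space (minkowski_sphere N 0 1) p"
  then have "G p \<bullet> v = 0"
    using tangent_space_sphere_orthogonal[of UNIV p v] unfolding tangent_space_def by auto
  then show "sphere_normal p \<bullet> v = 0" by (simp add: sphere_normal_eq[OF p0])
qed

text \<open>At each point two unit normals differ by a sign. Along a parametrization by a disc the
  sign is a continuous function with two values on a connected set, hence constant.\<close>

lemma unit_normal_field_sphere_unique:
  assumes sm: "smooth_on (-{0}) N" "smooth_on (-{0}) G" and w: "N w = 1" "w \<in> U" "open U"
    and n: "unit_normal_field (minkowski_sphere N 0 1 \<inter> U) n"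
  obtains \<sigma> O' where "open O'" "w \<in> O'"
    "\<And>q. q \<in> minkowski_sphere N 0 1 \<inter> U \<inter> O' \<Longrightarrow> n q = \<sigma> *\<^sub>R sphere_normal q"
proof -
  let ?S = "minkowski_sphere N 0 1 \<inter> U"
  obtain \<phi> \<rho> where \<rho>: "\<rho> > 0" and lp: "local_parametrization ?S (ball 0 \<rho>) \<phi>" and \<phi>0: "\<phi> 0 = w"
    using sphere_parametrization[OF sm(1) w] by metis
  have \<phi>S: "\<phi> ` ball 0 \<rho> \<subseteq> ?S" and sm\<phi>: "smooth_on (ball 0 \<rho>) \<phi>"
    using lp unfolding local_parametrization_def openin_subtopology by auto
  obtain O' where O': "open O'" "\<phi> ` ball 0 \<rho> = ?S \<inter> O'"
    using lp unfolding local_parametrization_def openin_open by blast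
  have par: "n q = (n q \<bullet> sphere_normal q) *\<^sub>R sphere_normal q \<and> n q \<bullet> sphere_normal q \<in> {-1, 1}"
    if q: "q \<in> ?S" for q
  proof -
    have q': "N q = 1" "q \<in> U" "q \<noteq> 0" using q unfolding minkowski_sphere_def by auto
    have nn: "norm (n q) = 1" "\<And>v. G q \<bullet> v = 0 \<Longrightarrow> n q \<bullet> v = 0"
      using n q tangent_space_sphere[OF sm(1) q'(1,2) w(3)] unfolding unit_normal_field_def by auto
    let ?s = "sphere_normal q"
    have ns: "?s \<bullet> ?s = 1" by (rule sphere_normal_unit[OF q'(3)])
    \<comment> \<open>z is the part of \<open>n q\<close> orthogonal to the known normal. It is
      tangent, so \<open>n q\<close> is orthogonal to it, and then z is orthogonal to
      itself.\<close>
    define z where "z = n q - (n q \<bullet> ?s) *\<^sub>R ?s"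
    have "?s \<bullet> z = 0" unfolding z_def by (simp add: inner_diff_right ns inner_commute)
    then have "G q \<bullet> z = 0" using G_nonzero[OF q'(3)] unfolding sphere_normal_eq[OF q'(3)] by simp
    then have "n q \<bullet> z = 0" by (rule nn(2))
    then have "z \<bullet> z = 0" using \<open>?s \<bullet> z = 0\<close> unfolding z_def[of] by (simp add: inner_diff_left)
    then have eq: "n q = (n q \<bullet> ?s) *\<^sub>R ?s" unfolding z_def by simp
    have "n q \<bullet> n q = 1" using nn(1) by (simp add: norm_eq_1)
    then have "(n q \<bullet> ?s)\<^sup>2 = 1" using eq ns by (metis inner_scaleR_left inner_scaleR_right mult.right_neutral power2_eq_square)
    then show ?thesis using eq power2_eq_1_iff by auto
  qed
  define f where "f = (\<lambda>u. n (\<phi> u) \<bullet> sphere_normal (\<phi> u))"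
  have "smooth_on (ball 0 \<rho>) (n \<circ> \<phi>)"
    using n lp unfolding unit_normal_field_def smooth_on_surface_def by blast
  moreover have "smooth_on (ball 0 \<rho>) (\<lambda>u. sphere_normal (\<phi> u))"
    by (rule smooth_on_compose[OF _ _ _ sm\<phi> smooth_sphere_normal[OF sm(2)]])
       (use \<phi>S in \<open>auto simp: open_Compl minkowski_sphere_def\<close>)
  ultimately have cf: "continuous_on (ball 0 \<rho>) f"
    unfolding f_def o_def by (intro continuous_on_inner smooth_on_imp_continuous_on) auto
  have "f u \<in> {-1, 1}" if "u \<in> ball 0 \<rho>" for u unfolding f_def using par \<phi>S that by blast
  then have "finite (f ` ball 0 \<rho>)" by (meson finite.emptyI finite.insertI finite_subset image_subsetI)
  then have "f constant_on ball 0 \<rho>"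
    using continuous_finite_range_constant[OF connected_ball cf] by blast
  then obtain \<sigma> where \<sigma>: "\<And>u. u \<in> ball 0 \<rho> \<Longrightarrow> f u = \<sigma>" unfolding constant_on_def by blast
  show ?thesis
  proof
    show "open O'" by fact
    show "w \<in> O'" using \<phi>0 \<rho> O'(2) by (metis IntD2 centre_in_ball imageI)
    fix q assume "q \<in> ?S \<inter> O'"
    then obtain u where "u \<in> ball 0 \<rho>" "q = \<phi> u" using O'(2) by blast
    then show "n q = \<sigma> *\<^sub>R sphere_normal q" using par \<phi>S \<sigma> unfolding f_def by (metis image_subset_iff)
  qed
qed

text \<open>If \<open>H w *v v0 = 0\<close>, then G is stationary at w in direction v0, and so is
  its normalisation. Every admissible normal field is a constant multiple of
  \<open>sphere_normal\<close> near w, so each of them has v0 in the kernel of its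
  differential.\<close>

lemma gaussian_curvature_eq_0:
  assumes sm: "smooth_on (-{0}) N" "smooth_on (-{0}) G" and w: "N w = 1"
    and v0: "G w \<bullet> v0 = 0" "v0 \<noteq> 0" "H w *v v0 = 0"
  shows "gaussian_curvature (minkowski_sphere N 0 1) w = 0"
proof -
  let ?S = "minkowski_sphere N 0 1" and ?T = "{v. G w \<bullet> v = 0}"
  have w0: "w \<noteq> 0" using w by auto
  have T: "tangent_space ?S w = ?T" using tangent_space_sphere[OF sm(1) w, of UNIV] by simp
  have dimT: "dim ?T = 2" using dim_hyperplane[OF G_nonzero[OF w0]] by simp
  define D where "D = frechet_derivative sphere_normal (at w)"
  have dn: "(sphere_normal has_derivative D) (at w)"
    unfolding D_def using smooth_on_imp_has_derivative[OF smooth_sphere_normal[OF sm(2)]] w0 by blast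
  have linD: "linear D" using dn has_derivative_linear by blast
  \<comment> \<open>A field of unit vectors is orthogonal to its derivatives; hence D maps into the
    tangent plane, as \<open>det_on_eq_0\<close> requires.\<close>
  have DT: "G w \<bullet> D v = 0" for v
  proof -
    have "((\<lambda>x. sphere_normal x \<bullet> sphere_normal x) has_derivative
        (\<lambda>v. sphere_normal w \<bullet> D v + D v \<bullet> sphere_normal w)) (at w)"
      by (rule has_derivative_inner[OF dn dn])
    then have "(\<lambda>v. sphere_normal w \<bullet> D v + D v \<bullet> sphere_normal w) = (\<lambda>v. 0)"
    proof (rule has_derivative_at_transform_eq[where U = "-{0}" and g = "\<lambda>x. 1"])
      fix y :: "real^3" assume "y \<in> -{0}"
      then show "sphere_normal y \<bullet> sphere_normal y = 1"
        by (simp add: sphere_normal_unit)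
    qed (use w0 in \<open>auto simp: open_Compl\<close>)
    from fun_cong[OF this, of v] have "sphere_normal w \<bullet> D v = 0" by (simp add: inner_commute)
    then show ?thesis using G_nonzero[OF w0] by (simp add: sphere_normal_eq[OF w0])
  qed
  have Dv0: "D v0 = 0"
  proof -
    have 1: "((\<lambda>x. (G x \<bullet> G x) powr (-1/2)) has_derivative
       (\<lambda>v. (G w \<bullet> G w) powr (-1/2) * (0 * ln (G w \<bullet> G w) + (G w \<bullet> (H w *v v) + (H w *v v) \<bullet> G w) * (-1/2) / (G w \<bullet> G w)))) (at w)"
      by (rule has_derivative_powr[OF has_derivative_inner[OF dG[OF w0] dG[OF w0]] has_derivative_const])
         (use G_nonzero[OF w0] in auto)
    have "(sphere_normal has_derivative (\<lambda>v. ((G w \<bullet> G w) powr (-1/2)) *\<^sub>R (H w *v v) +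
      ((G w \<bullet> G w) powr (-1/2) * (0 * ln (G w \<bullet> G w) + (G w \<bullet> (H w *v v) + (H w *v v) \<bullet> G w) * (-1/2) / (G w \<bullet> G w))) *\<^sub>R G w)) (at w)"
      unfolding sphere_normal_def[abs_def] by (rule has_derivative_scaleR[OF 1 dG[OF w0]])
    from has_derivative_unique[OF dn this] show ?thesis by (simp add: v0)
  qed
  have zero: "det_on ?T (surface_differential (?S \<inter> U) n w) = 0"
    if U: "open U" "w \<in> U" and n: "unit_normal_field (?S \<inter> U) n" for U n
  proof -
    obtain \<sigma> O' where O': "open O'" "w \<in> O'"
      "\<And>q. q \<in> ?S \<inter> U \<inter> O' \<Longrightarrow> n q = \<sigma> *\<^sub>R sphere_normal q"
      using unit_normal_field_sphere_unique[OF sm w U(2,1) n] by metis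
    have sd: "surface_differential (?S \<inter> U) n w v = \<sigma> *\<^sub>R D v" if v: "v \<in> ?T" for v
    proof (rule surface_differentialI)
      show "curve_through (?S \<inter> U) w v (\<lambda>t. radial (w + t *\<^sub>R v))"
        using radial_curve[OF sm(1) w U(2,1)] v by blast
      fix \<gamma> assume "curve_through (?S \<inter> U) w v \<gamma>"
      then obtain e where e: "e > 0" "\<gamma> ` {-e<..<e} \<subseteq> ?S \<inter> U" "smooth_on {-e<..<e} \<gamma>"
        and \<gamma>0: "\<gamma> 0 = w" and \<gamma>': "(\<gamma> has_vector_derivative v) (at 0)"
        unfolding curve_through_def by blast
      define I where "I = {-e<..<e} \<inter> \<gamma> -` O'"
      have "open I" unfolding I_def
        by (rule continuous_open_preimage[OF smooth_on_imp_continuous_on[OF e(3)] _ O'(1)]) simp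
      have "0 \<in> I" unfolding I_def using e(1) \<gamma>0 O'(2) by simp
      have "((\<lambda>t. sphere_normal (\<gamma> t)) has_derivative (\<lambda>t. D (t *\<^sub>R v))) (at 0)"
        using \<gamma>' dn unfolding has_vector_derivative_def \<gamma>0[symmetric] by (rule has_derivative_compose)
      then have "((\<lambda>t. \<sigma> *\<^sub>R sphere_normal (\<gamma> t)) has_derivative (\<lambda>t. t *\<^sub>R (\<sigma> *\<^sub>R D v))) (at 0)"
        by (auto intro!: derivative_eq_intros simp: linear_scale[OF linD])
      then have "((n \<circ> \<gamma>) has_derivative (\<lambda>t. t *\<^sub>R (\<sigma> *\<^sub>R D v))) (at 0)"
      proof (rule has_derivative_transform_within_open[OF _ \<open>open I\<close> \<open>0 \<in> I\<close>])
        fix t assume "t \<in> I"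
        then have "\<gamma> t \<in> ?S \<inter> U \<inter> O'" unfolding I_def using e(2) by blast
        then show "\<sigma> *\<^sub>R sphere_normal (\<gamma> t) = (n \<circ> \<gamma>) t" using O'(3) by simp
      qed
      then show "(n \<circ> \<gamma> has_vector_derivative \<sigma> *\<^sub>R D v) (at 0)" unfolding has_vector_derivative_def .
    qed
    show ?thesis
    proof (rule det_on_eq_0[OF subspace_hyperplane dimT sd])
      show "linear (\<lambda>v. \<sigma> *\<^sub>R D v)" using linD linear_compose_scale_right by blast
    qed (use v0 DT Dv0 in auto)
  qed
  show ?thesis
    unfolding gaussian_curvature_def T
  proof (rule the_equality)
    \<comment> \<open>Uniqueness of the value needs one admissible normal field; the global one on U
      = UNIV provides it.\<close>
    fix k assume "\<forall>U n. open U \<and> w \<in> U \<and> unit_normal_field (?S \<inter> U) n \<longrightarrow>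
        k = det_on ?T (surface_differential (?S \<inter> U) n w)"
    from this[rule_format, of UNIV sphere_normal] show "k = 0"
      using unit_normal_field_sphere[OF sm(2)] zero[of UNIV sphere_normal] by simp
  qed (use zero in auto)
qed

text \<open>A tangent vector annihilated by the second derivative of N would be annihilated by the
  differential of the Euclidean Gauss map G / |G|.\<close>

lemma elliptic_of_gaussian_curvature:
  assumes sm: "smooth_on (-{0}) N" "smooth_on (-{0}) G"
    and "\<forall>x \<in> minkowski_sphere N 0 1. gaussian_curvature (minkowski_sphere N 0 1) x \<noteq> 0"
    and x: "N x = 1" "v \<noteq> 0" "G x \<bullet> v = 0"
  shows "(H x *v v) \<bullet> v > 0"
proof -
  have x0: "x \<noteq> 0" using x by auto
  have "(H x *v v) \<bullet> v \<noteq> 0"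
    using gaussian_curvature_eq_0[OF sm x(1,3,2)] H_kernel[OF x0] assms(3) x(1)
    by (auto simp: minkowski_sphere_def)
  then show ?thesis using H_nonneg[OF x0, of v] by linarith
qed

end

section \<open>Endomorphisms of a plane\<close>

text \<open>An endomorphism of the plane orthogonal to g is handled as a 3 by 3 matrix that
  annihilates a transversal vector e. In a basis a, b of the plane completed by e it becomes a
  \<open>block_matrix\<close>, and \<open>column_matrix a b e\<close> is the change of
  basis.\<close>

definition column_matrix :: "real^3 \<Rightarrow> real^3 \<Rightarrow> real^3 \<Rightarrow> real^3^3" where
  "column_matrix a b e = (\<chi> i j. if j = 1 then a $ i else if j = 2 then b $ i else e $ i)"

lemma column_matrix_mult: "column_matrix a b e *v x = x $ 1 *\<^sub>R a + x $ 2 *\<^sub>R b + x $ 3 *\<^sub>R e"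
  by (simp add: vec_eq_iff column_matrix_def matrix_vector_mult_def sum_3)

definition block_matrix :: "real \<Rightarrow> real \<Rightarrow> real \<Rightarrow> real \<Rightarrow> real^3^3" where
  "block_matrix a b c d = (\<chi> i j. if i = 1 then (if j = 1 then a else if j = 2 then b else 0)
     else if i = 2 then (if j = 1 then c else if j = 2 then d else 0) else 0)"

lemma block_matrix_mult:
  "(block_matrix a b c d *v x) $ 1 = a * x $ 1 + b * x $ 2"
  "(block_matrix a b c d *v x) $ 2 = c * x $ 1 + d * x $ 2"
  "(block_matrix a b c d *v x) $ 3 = 0"
  by (simp_all add: block_matrix_def matrix_vector_mult_def sum_3)

lemma trace_block_matrix: "trace (block_matrix a b c d) = a + d"
  by (simp add: trace_def sum_3 block_matrix_def)

lemma det_block_matrix: "det (mat 1 - r *\<^sub>R block_matrix a b c d) = (1 - r * a) * (1 - r * d) - r\<^sup>2 * (b * c)"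
  by (simp add: det_3 block_matrix_def mat_def power2_eq_square)

lemma column_matrix_invertible:
  assumes "g \<bullet> a = 0" "g \<bullet> b = 0" "g \<bullet> e \<noteq> 0"
    and ind: "\<And>x y. x *\<^sub>R a + y *\<^sub>R b = 0 \<Longrightarrow> x = 0 \<and> y = 0"
  shows "invertible (column_matrix a b e)"
  unfolding invertible_left_inverse matrix_left_invertible_ker
proof (intro allI impI)
  fix x assume 0: "column_matrix a b e *v x = 0"
  then have "g \<bullet> (x $ 1 *\<^sub>R a + x $ 2 *\<^sub>R b + x $ 3 *\<^sub>R e) = 0" unfolding column_matrix_mult by simp
  then have 3: "x $ 3 = 0" using assms(1-3) by (simp add: inner_add_right)
  then have "x $ 1 *\<^sub>R a + x $ 2 *\<^sub>R b = 0" using 0 unfolding column_matrix_mult by simp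
  then have "x $ 1 = 0 \<and> x $ 2 = 0" by (rule ind)
  then show "x = 0" using 3 by (simp add: vec_eq_iff forall_3)
qed

lemma similar_matrices:
  fixes A P M :: "real^'n^'n"
  assumes "invertible P" and AP: "\<And>x. A *v (P *v x) = P *v (M *v x)"
  shows "trace A = trace M" "det (mat 1 - r *\<^sub>R A) = det (mat 1 - r *\<^sub>R M)"
proof -
  obtain P' where P': "P ** P' = mat 1" "P' ** P = mat 1" using assms(1) unfolding invertible_def by blast
  have AP': "A ** P = P ** M"
    unfolding matrix_eq by (simp add: AP flip: matrix_vector_mul_assoc)
  have "A = (P ** M) ** P'"
    by (metis AP' P'(1) matrix_mul_assoc matrix_mul_rid)
  then have "trace A = trace (P' ** (P ** M))" by (metis trace_mul_sym)
  then show "trace A = trace M" by (simp add: matrix_mul_assoc P')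
  have "(mat 1 - r *\<^sub>R A) ** P = P ** (mat 1 - r *\<^sub>R M)"
    unfolding matrix_eq
    by (simp add: AP matrix_vector_mult_diff_rdistrib matrix_vector_mult_diff_distrib matrix_vector_mult_scaleR
        flip: matrix_vector_mul_assoc scaleR_matrix_vector_assoc)
  then have "det (mat 1 - r *\<^sub>R A) * det P = det P * det (mat 1 - r *\<^sub>R M)" by (metis det_mul)
  moreover have "det P \<noteq> 0" using assms(1) invertible_det_nz by blast
  ultimately show "det (mat 1 - r *\<^sub>R A) = det (mat 1 - r *\<^sub>R M)" by simp
qed

lemma independent_pair:
  assumes "independent {b1, b2}" "b1 \<noteq> b2" "x *\<^sub>R b1 + y *\<^sub>R b2 = 0"
  shows "x = 0 \<and> y = 0"
proof -
  have "(\<Sum>b\<in>{b1, b2}. (if b = b1 then x else y) *\<^sub>R b) = 0" using assms(2,3) by simp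
  then have "\<forall>b\<in>{b1, b2}. (if b = b1 then x else y) = 0"
    using independentD[OF assms(1), of "{b1, b2}" "\<lambda>b. if b = b1 then x else y"] by blast
  then show ?thesis using assms(2) by auto
qed

text \<open>A annihilates e and maps into the plane. In a basis of the plane completed by e, its
  third row and column therefore vanish and contribute nothing to the trace.\<close>

lemma trace_on_hyperplane:
  fixes A :: "real^3^3"
  assumes g: "g \<bullet> e \<noteq> 0" and A: "A *v e = 0" "\<And>v. g \<bullet> (A *v v) = 0"
    and L: "\<And>v. g \<bullet> v = 0 \<Longrightarrow> L v = A *v v"
  shows "trace_on {v. g \<bullet> v = 0} L = trace A"
proof -
  let ?T = "{v. g \<bullet> v = 0}"
  define B where "B = basis_of ?T"
  note B = basis_of[OF subspace_hyperplane[of g], folded B_def]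
  have "g \<noteq> 0" using g by auto
  then have "card B = 2" using B(5) dim_hyperplane[of g] by simp
  then obtain b1 b2 where b: "B = {b1, b2}" "b1 \<noteq> b2" using card_2_iff by metis
  define r where "r = representation B"
  have gb: "g \<bullet> b1 = 0" "g \<bullet> b2 = 0" using B(1) b by auto
  have rep: "v = r v b1 *\<^sub>R b1 + r v b2 *\<^sub>R b2" if "g \<bullet> v = 0" for v
    using sum_representation_eq[OF B(2), of v B] that B(3,4) b unfolding r_def by auto
  define P where "P = column_matrix b1 b2 e"
  define M where "M = block_matrix (r (A *v b1) b1) (r (A *v b2) b1) (r (A *v b1) b2) (r (A *v b2) b2)"
  have invP: "invertible P" unfolding P_def
    by (rule column_matrix_invertible[OF gb g]) (use independent_pair B(2) b in auto)
  have AP: "A *v (P *v x) = P *v (M *v x)" for x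
  proof -
    have "A *v (P *v x) = x $ 1 *\<^sub>R (A *v b1) + x $ 2 *\<^sub>R (A *v b2)"
      unfolding P_def column_matrix_mult
      by (simp add: matrix_vector_right_distrib matrix_vector_mult_scaleR A)
    also have "\<dots> = x $ 1 *\<^sub>R (r (A *v b1) b1 *\<^sub>R b1 + r (A *v b1) b2 *\<^sub>R b2)
        + x $ 2 *\<^sub>R (r (A *v b2) b1 *\<^sub>R b1 + r (A *v b2) b2 *\<^sub>R b2)"
      using rep[OF A(2), of b1] rep[OF A(2), of b2] by simp
    also have "\<dots> = P *v (M *v x)"
      unfolding P_def column_matrix_mult M_def block_matrix_mult by (simp add: algebra_simps)
    finally show ?thesis .
  qed
  have "trace A = trace M" by (rule similar_matrices(1)[OF invP AP])
  also have "\<dots> = r (A *v b1) b1 + r (A *v b2) b2" by (simp add: M_def trace_block_matrix)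
  also have "\<dots> = trace_on ?T L"
    unfolding trace_on_def B_def[symmetric] r_def using b gb L by simp
  finally show ?thesis by simp
qed

lemma psd_form_2:
  fixes p q s :: real
  assumes "\<And>x y. p * x\<^sup>2 - 2 * s * x * y + q * y\<^sup>2 \<ge> 0"
  shows "p \<ge> 0" "q \<ge> 0" "p * q \<ge> s\<^sup>2"
proof -
  show p: "p \<ge> 0" using assms[of 1 0] by simp
  show "q \<ge> 0" using assms[of 0 1] by simp
  show "p * q \<ge> s\<^sup>2"
  proof (cases "p = 0")
    case True
    have "s = 0"
    proof (rule ccontr)
      assume "s \<noteq> 0"
      \<comment> \<open>For p = 0 the form has the value -1 at this point.\<close>
      then show False using assms[of "(q + 1) / (2 * s)" 1] True by (simp add: field_simps)
    qed
    then show ?thesis using True by simp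
  next
    case False
    \<comment> \<open>The value of the form at the point (s, p).\<close>
    have "p * (p * q - s\<^sup>2) \<ge> 0" using assms[of s p] by (simp add: power2_eq_square algebra_simps)
    then show ?thesis using p False by (simp add: zero_le_mult_iff)
  qed
qed

text \<open>Orthonormalising with respect to Q turns A on the plane into a symmetric 2 by 2 matrix
  with eigenvalues c + \<open>sqrt k\<close> and c - \<open>sqrt k\<close>, which explains the
  determinant and the case k = 0. In the last clause the form of 1 - dA is semidefinite, with trace
  2(1 - dc) and determinant \<open>(1 - d * c)\<^sup>2 - d\<^sup>2 * k\<close>.\<close>

lemma self_adjoint_plane:
  fixes A Q :: "real^3^3"
  assumes g: "g \<bullet> e = 1" and A: "A *v e = 0" "\<And>v. g \<bullet> (A *v v) = 0"
    and sym: "\<And>u v. (Q *v u) \<bullet> v = (Q *v v) \<bullet> u"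
    and pos: "\<And>v. g \<bullet> v = 0 \<Longrightarrow> v \<noteq> 0 \<Longrightarrow> (Q *v v) \<bullet> v > 0"
    and adj: "\<And>u v. g \<bullet> u = 0 \<Longrightarrow> g \<bullet> v = 0 \<Longrightarrow> (Q *v (A *v u)) \<bullet> v = (Q *v (A *v v)) \<bullet> u"
    and tr: "trace A = 2 * c"
  obtains k where "k \<ge> 0" "\<And>r. det (mat 1 - r *\<^sub>R A) = (1 - r * c)\<^sup>2 - r\<^sup>2 * k"
    and "\<And>v. k = 0 \<Longrightarrow> g \<bullet> v = 0 \<Longrightarrow> A *v v = c *\<^sub>R v"
    and "\<And>d. (\<And>v. g \<bullet> v = 0 \<Longrightarrow> (Q *v (v - d *\<^sub>R (A *v v))) \<bullet> v \<ge> 0) \<Longrightarrow>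
           d * c \<le> 1 \<and> (1 - d * c)\<^sup>2 - d\<^sup>2 * k \<ge> 0"
proof -
  let ?T = "{v. g \<bullet> v = 0}"
  define R where "R = (\<lambda>u v. (Q *v u) \<bullet> v)"
  have R_lin: "R (u + u') v = R u v + R u' v" "R (t *\<^sub>R u) v = t * R u v" "R (u - u') v = R u v - R u' v"
    "R v (u + u') = R v u + R v u'" "R v (t *\<^sub>R u) = t * R v u" "R v (u - u') = R v u - R v u'" for u u' v t
    unfolding R_def
    by (simp_all add: matrix_vector_right_distrib matrix_vector_mult_scaleR matrix_vector_mult_diff_distrib
        inner_add_left inner_add_right inner_diff_left inner_diff_right)
  have R_sym: "R u v = R v u" for u v unfolding R_def by (rule sym)
  have "g \<noteq> 0" using g by auto
  define B where "B = basis_of ?T"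
  note B = basis_of[OF subspace_hyperplane[of g], folded B_def]
  have "card B = 2" using B(5) dim_hyperplane[OF \<open>g \<noteq> 0\<close>] by simp
  then obtain b1 b2 where b: "B = {b1, b2}" "b1 \<noteq> b2" using card_2_iff by metis
  have gb: "g \<bullet> b1 = 0" "g \<bullet> b2 = 0" using B(1) b by auto
  have indb: "x = 0 \<and> y = 0" if "x *\<^sub>R b1 + y *\<^sub>R b2 = 0" for x y
    using independent_pair[OF _ b(2) that] B(2) b(1) by simp
  have b1: "R b1 b1 > 0" using pos[OF gb(1)] indb[of 1 0] unfolding R_def by force
  define e1 where "e1 = b1 /\<^sub>R sqrt (R b1 b1)"
  have ge1: "g \<bullet> e1 = 0" and R11: "R e1 e1 = 1"
    using gb b1 unfolding e1_def by (auto simp: R_lin field_simps)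
  define b2' where "b2' = b2 - R b2 e1 *\<^sub>R e1"
  have gb2': "g \<bullet> b2' = 0" using gb ge1 unfolding b2'_def by (simp add: inner_diff_right)
  have "b2' \<noteq> 0"
  proof
    assume "b2' = 0"
    then have "(- R b2 e1 / sqrt (R b1 b1)) *\<^sub>R b1 + 1 *\<^sub>R b2 = 0"
      unfolding b2'_def e1_def by (simp add: divide_inverse)
    then show False using indb by fastforce
  qed
  then have b2': "R b2' b2' > 0" using pos[OF gb2'] unfolding R_def by simp
  have R12': "R e1 b2' = 0" unfolding b2'_def by (simp add: R_lin R11 R_sym)
  define e2 where "e2 = b2' /\<^sub>R sqrt (R b2' b2')"
  have ge2: "g \<bullet> e2 = 0" and R22: "R e2 e2 = 1" and R12: "R e1 e2 = 0"
    using gb2' b2' R12' unfolding e2_def by (auto simp: R_lin field_simps)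
  have expand: "v = R v e1 *\<^sub>R e1 + R v e2 *\<^sub>R e2" if v: "g \<bullet> v = 0" for v
  proof -
    \<comment> \<open>z is the remainder of the expansion. Being R-orthogonal to e1 and e2, it is
      R-orthogonal to b1 and b2, hence to itself, and definiteness on the plane makes it 0.\<close>
    define z where "z = v - (R v e1 *\<^sub>R e1 + R v e2 *\<^sub>R e2)"
    have gz: "g \<bullet> z = 0" using v ge1 ge2 unfolding z_def by (simp add: inner_diff_right inner_add_right)
    have Rz: "R z e1 = 0" "R z e2 = 0" unfolding z_def by (simp_all add: R_lin R11 R22 R12 R_sym[of e2 e1])
    have "z \<in> span B" using gz B(3) by simp
    then obtain x y where z: "z = x *\<^sub>R b1 + y *\<^sub>R b2"
      unfolding b(1) span_insert by (auto simp: span_singleton diff_eq_eq add.commute)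
    have b1e: "b1 = sqrt (R b1 b1) *\<^sub>R e1" unfolding e1_def using b1 by simp
    have b2e: "b2 = sqrt (R b2' b2') *\<^sub>R e2 + R b2 e1 *\<^sub>R e1"
      unfolding e2_def using b2' by (simp add: b2'_def)
    have "R z b1 = 0" using Rz by (subst b1e) (simp add: R_lin)
    moreover have "R z b2 = 0" using Rz by (subst b2e) (simp add: R_lin)
    ultimately have "R z z = 0" by (subst (2) z) (simp add: R_lin)
    then have "z = 0" using pos[OF gz] unfolding R_def by force
    then show ?thesis unfolding z_def by simp
  qed
  define a where "a = R (A *v e1) e1"
  define s where "s = R (A *v e1) e2"
  define k where "k = R (A *v e2) e2"
  have s': "R (A *v e2) e1 = s" unfolding s_def R_def by (rule adj[OF ge2 ge1])
  have Ae1: "A *v e1 = a *\<^sub>R e1 + s *\<^sub>R e2" unfolding a_def s_def by (rule expand[OF A(2)])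
  have Ae2: "A *v e2 = s *\<^sub>R e1 + k *\<^sub>R e2" unfolding k_def s'[symmetric] by (rule expand[OF A(2)])
  define P where "P = column_matrix e1 e2 e"
  define M where "M = block_matrix a s s k"
  have invP: "invertible P" unfolding P_def
  proof (rule column_matrix_invertible[OF ge1 ge2])
    fix x y assume 0: "x *\<^sub>R e1 + y *\<^sub>R e2 = 0"
    have "R (x *\<^sub>R e1 + y *\<^sub>R e2) e1 = x" "R (x *\<^sub>R e1 + y *\<^sub>R e2) e2 = y"
      by (simp_all add: R_lin R11 R22 R12 R_sym[of e2 e1])
    then show "x = 0 \<and> y = 0" unfolding 0 unfolding R_def by simp
  qed (use g in simp)
  have AP: "A *v (P *v x) = P *v (M *v x)" for x
  proof -
    have "A *v (P *v x) = x $ 1 *\<^sub>R (A *v e1) + x $ 2 *\<^sub>R (A *v e2)"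
      unfolding P_def column_matrix_mult
      by (simp add: matrix_vector_right_distrib matrix_vector_mult_scaleR A)
    also have "\<dots> = P *v (M *v x)"
      unfolding P_def column_matrix_mult M_def block_matrix_mult Ae1 Ae2 by (simp add: algebra_simps)
    finally show ?thesis .
  qed
  have "trace A = a + k" using similar_matrices(1)[OF invP AP] by (simp add: M_def trace_block_matrix)
  then have c: "c = (a + k) / 2" using tr by simp
  \<comment> \<open>Minus the determinant of the trace-free part of the matrix with rows (a, s) and
    (s, k), that is, the square of half the difference of its eigenvalues.\<close>
  define \<kappa> where "\<kappa> = ((a - k) / 2)\<^sup>2 + s\<^sup>2"
  have det: "det (mat 1 - r *\<^sub>R A) = (1 - r * c)\<^sup>2 - r\<^sup>2 * \<kappa>" for r
  proof -
    have "det (mat 1 - r *\<^sub>R A) = det (mat 1 - r *\<^sub>R M)" by (rule similar_matrices(2)[OF invP AP])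
    also have "\<dots> = (1 - r * a) * (1 - r * k) - r\<^sup>2 * s\<^sup>2"
      by (simp add: M_def det_block_matrix power2_eq_square)
    also have "\<dots> = (1 - r * c)\<^sup>2 - r\<^sup>2 * \<kappa>" unfolding c \<kappa>_def by (simp add: power2_eq_square field_simps)
    finally show ?thesis .
  qed
  show ?thesis
  proof (rule that[of \<kappa>])
    show "\<kappa> \<ge> 0" unfolding \<kappa>_def by simp
    show "det (mat 1 - r *\<^sub>R A) = (1 - r * c)\<^sup>2 - r\<^sup>2 * \<kappa>" for r by (rule det)
  next
    fix v assume "\<kappa> = 0" and v: "g \<bullet> v = 0"
    then have ks: "a = k" "s = 0" unfolding \<kappa>_def by (auto simp: add_nonneg_eq_0_iff)
    have "A *v v = A *v (R v e1 *\<^sub>R e1 + R v e2 *\<^sub>R e2)" using expand[OF v] by simp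
    also have "\<dots> = c *\<^sub>R (R v e1 *\<^sub>R e1 + R v e2 *\<^sub>R e2)"
      unfolding c using ks
      by (simp add: matrix_vector_right_distrib matrix_vector_mult_scaleR Ae1 Ae2 scaleR_add_right mult.commute)
    also have "\<dots> = c *\<^sub>R v" using expand[OF v] by simp
    finally show "A *v v = c *\<^sub>R v" .
  next
    fix d assume d: "\<And>v. g \<bullet> v = 0 \<Longrightarrow> (Q *v (v - d *\<^sub>R (A *v v))) \<bullet> v \<ge> 0"
    have "(1 - d * a) * x\<^sup>2 - 2 * (d * s) * x * y + (1 - d * k) * y\<^sup>2 \<ge> 0" for x y
    proof -
      let ?v = "x *\<^sub>R e1 + y *\<^sub>R e2"
      have "g \<bullet> ?v = 0" using ge1 ge2 by (simp add: inner_add_right)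
      then have "0 \<le> R (?v - d *\<^sub>R (A *v ?v)) ?v" unfolding R_def by (rule d)
      also have "\<dots> = (1 - d * a) * x\<^sup>2 - 2 * (d * s) * x * y + (1 - d * k) * y\<^sup>2"
        by (simp add: matrix_vector_right_distrib matrix_vector_mult_scaleR Ae1 Ae2 R_lin R11 R22 R12
            R_sym[of e2 e1] power2_eq_square algebra_simps)
      finally show ?thesis .
    qed
    note psd = psd_form_2[OF this]
    have "d * c \<le> 1" using psd(1,2) unfolding c by (simp add: field_simps)
    moreover have "(1 - d * c)\<^sup>2 - d\<^sup>2 * \<kappa> = (1 - d * a) * (1 - d * k) - (d * s)\<^sup>2"
      unfolding c \<kappa>_def by (simp add: power2_eq_square field_simps)
    ultimately show "d * c \<le> 1 \<and> (1 - d * c)\<^sup>2 - d\<^sup>2 * \<kappa> \<ge> 0" using psd(3) by simp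
  qed
qed

section \<open>Tubular neighbourhoods\<close>

lemma continuous_on_det3:
  fixes A :: "'a::topological_space \<Rightarrow> real^3^3"
  assumes "continuous_on S A" shows "continuous_on S (\<lambda>x. det (A x))"
  unfolding det_3 using assms by (intro continuous_intros)

lemma continuous_on_matrixI:
  fixes A :: "'a::topological_space \<Rightarrow> real^3^3"
  assumes "\<And>v. continuous_on S (\<lambda>x. A x *v v)" shows "continuous_on S A"
proof -
  have "continuous_on S (\<lambda>x. \<chi> i j. (A x *v axis j 1) $ i)"
    by (intro continuous_on_vec_lambda continuous_on_component assms)
  then show ?thesis by (simp add: matrix_vector_mult_basis column_def)
qed

lemma continuous_on_matrix_vector_mult:
  fixes A :: "'a::topological_space \<Rightarrow> real^'n^'m"
  assumes "continuous_on S A" "continuous_on S f" shows "continuous_on S (\<lambda>x. A x *v f x)"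
  unfolding matrix_vector_mult_def using assms by (intro continuous_on_vec_lambda continuous_intros)

lemma continuous_on_linear_solution:
  fixes A :: "'a::topological_space \<Rightarrow> real^3^3"
  assumes "continuous_on S A" "\<And>x. x \<in> S \<Longrightarrow> det (A x) \<noteq> 0" "\<And>x. x \<in> S \<Longrightarrow> A x *v X x = b"
  shows "continuous_on S X"
proof -
  have "continuous_on S (\<lambda>x. \<chi> k. det (\<chi> i j. if j = k then b $ i else A x $ i $ j) / det (A x))"
  proof (intro continuous_on_vec_lambda continuous_on_divide continuous_on_det3 assms(1))
    fix i j k :: 3
    show "continuous_on S (\<lambda>x. if j = k then b $ i else A x $ i $ j)"
      by (cases "j = k") (auto intro!: continuous_intros assms(1))
  qed (use assms(2) in auto)
  moreover have "X x = (\<chi> k. det (\<chi> i j. if j = k then b $ i else A x $ i $ j) / det (A x))" if "x \<in> S" for x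
    using cramer[OF assms(2)[OF that], of "X x" b] assms(3)[OF that] by simp
  ultimately show ?thesis by (simp cong: continuous_on_cong)
qed

text \<open>The inverse function theorem describes the derivative of g only as an inverse map. Its
  continuity in y is recovered from the linear system that it solves, through Cramer's rule.\<close>

lemma smooth_local_inverse:
  fixes f :: "real^3 \<Rightarrow> real^3"
  assumes U: "open U" "x0 \<in> U" and f: "smooth_on U f" and inj: "inj (frechet_derivative f (at x0))"
  obtains U' V' g g' where "open U'" "U' \<subseteq> U" "x0 \<in> U'" "open V'" "homeomorphism U' V' f g"
    "\<forall>y\<in>V'. (g has_derivative g' y) (at y)"
    "\<forall>w. continuous_on V' (\<lambda>y. g' y w)"
    "\<forall>y\<in>V'. \<forall>w. frechet_derivative f (at (g y)) (g' y w) = w"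
proof -
  let ?J = "jacobian_matrix f"
  have der: "(f has_derivative (*v) (?J x)) (at x)" if "x \<in> U" for x
    using has_derivative_jacobian_matrix[OF f that] by simp
  have fd: "frechet_derivative f (at x) = (*v) (?J x)" if "x \<in> U" for x
    using frechet_derivative_at[OF der[OF that]] by simp
  define F where "F = (\<lambda>x. Blinfun ((*v) (?J x)))"
  have F: "blinfun_apply (F x) = (*v) (?J x)" for x
    unfolding F_def by (rule bounded_linear_Blinfun_apply) simp
  have "invertible (?J x0)"
    unfolding invertible_left_inverse matrix_left_invertible_injective using inj unfolding fd[OF U(2)] .
  then obtain B where "B ** ?J x0 = mat 1" unfolding invertible_def by blast
  then have inv: "Blinfun ((*v) B) o\<^sub>L F x0 = id_blinfun"
    by (intro blinfun_eqI) (simp add: F bounded_linear_Blinfun_apply matrix_vector_mul_assoc)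
  have contF: "continuous_on U F"
    by (intro continuous_on_blinfun_componentwise)
       (auto simp: F intro!: continuous_on_matrix_vector_mult continuous_on_const continuous_on_jacobian_matrix[OF f])
  have derF: "(f has_derivative blinfun_apply (F x)) (at x)" if "x \<in> U" for x unfolding F by (rule der[OF that])
  obtain U' V' g g' where *: "open U'" "U' \<subseteq> U" "x0 \<in> U'" "open V'" "f x0 \<in> V'" "homeomorphism U' V' f g"
    "\<And>y. y \<in> V' \<Longrightarrow> (g has_derivative (g' y)) (at y)"
    "\<And>y. y \<in> V' \<Longrightarrow> g' y = inv (blinfun_apply (F (g y)))"
    "\<And>y. y \<in> V' \<Longrightarrow> bij (blinfun_apply (F (g y)))"
    by (rule inverse_function_theorem[OF U(1) derF contF U(2) inv]) auto
  have gU: "g y \<in> U" if "y \<in> V'" for y using *(2,6) that unfolding homeomorphism_def by blast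
  have sol: "?J (g y) *v g' y w = w" if "y \<in> V'" for y w
    using *(8,9)[OF that] unfolding F by (simp add: bij_is_surj surj_f_inv_f)
  have cont: "continuous_on V' (\<lambda>y. g' y w)" for w
  proof (rule continuous_on_linear_solution)
    have "continuous_on V' g" using *(6) unfolding homeomorphism_def by blast
    then show "continuous_on V' (\<lambda>y. ?J (g y))"
      by (rule continuous_on_compose2[OF continuous_on_jacobian_matrix[OF f]]) (use gU in blast)
    show "det (?J (g y)) \<noteq> 0" if "y \<in> V'" for y
      using *(9)[OF that] unfolding F
      by (metis bij_is_inj invertible_det_nz invertible_left_inverse matrix_left_invertible_injective)
  qed (use sol in auto)
  show ?thesis by (rule that[OF *(1-4,6), of g']) (use *(7) cont sol fd gU in auto)
qed

text \<open>With \<open>lift3\<close>, this codes a plane parameter and a height as one vector of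
  \<open>real^3\<close>, so that the map to space has a square Jacobian matrix and the inverse
  function theorem applies.\<close>

definition proj12 :: "real^3 \<Rightarrow> real^2" where "proj12 x = (\<chi> i. if i = 1 then x $ 1 else x $ 2)"

definition lift3 :: "real^2 \<Rightarrow> real \<Rightarrow> real^3" where
  "lift3 u t = (\<chi> i. if i = 1 then u $ 1 else if i = 2 then u $ 2 else t)"

lemma proj12_lift3 [simp]: "proj12 (lift3 u t) = u" "lift3 u t $ 3 = t"
  by (simp_all add: proj12_def lift3_def vec_eq_iff forall_2)

lemma bounded_linear_proj12: "bounded_linear proj12"
  by (rule linear_conv_bounded_linear[THEN iffD1], rule linearI) (simp_all add: proj12_def vec_eq_iff)

lemma proj12_eq_0: "proj12 x = 0 \<Longrightarrow> x $ 3 = 0 \<Longrightarrow> x = 0"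
  by (simp add: proj12_def vec_eq_iff forall_2 forall_3)

locale surface_in_norm = minkowski_norm +
  fixes M :: "(real^3) set" and \<eta> :: "real^3 \<Rightarrow> real^3"
  assumes compact_M: "compact M" and M_nonempty: "M \<noteq> {}"
    and surface: "smooth_surface M" and gauss_map: "birkhoff_gauss_map N M \<eta>"
begin

lemma N_\<eta>: "p \<in> M \<Longrightarrow> N (\<eta> p) = 1"
  using gauss_map unfolding birkhoff_gauss_map_def minkowski_sphere_def by auto

lemma \<eta>_nonzero: "p \<in> M \<Longrightarrow> \<eta> p \<noteq> 0"
  using N_\<eta> by force

lemma G_\<eta>_\<eta>: "p \<in> M \<Longrightarrow> G (\<eta> p) \<bullet> \<eta> p = 1"
  using G_self[OF \<eta>_nonzero] N_\<eta> by simp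

lemma G_tangent: "p \<in> M \<Longrightarrow> v \<in> tangent_space M p \<Longrightarrow> G (\<eta> p) \<bullet> v = 0"
  using gauss_map birkhoff_orthogonal_imp \<eta>_nonzero unfolding birkhoff_gauss_map_def by blast

definition adapted_parametrization :: "(real^2) set \<Rightarrow> (real^2 \<Rightarrow> real^3) \<Rightarrow> bool" where
  "adapted_parametrization V \<phi> \<longleftrightarrow> open V \<and> smooth_on V \<phi> \<and> smooth_on V (\<lambda>u. \<eta> (\<phi> u)) \<and>
     (\<forall>u\<in>V. inj (frechet_derivative \<phi> (at u))) \<and> openin (top_of_set M) (\<phi> ` V) \<and> \<phi> ` V \<subseteq> M \<and>
     (\<exists>\<psi>. homeomorphism V (\<phi> ` V) \<phi> \<psi>) \<and>
     (\<forall>u\<in>V. \<forall>a. frechet_derivative \<phi> (at u) a \<in> tangent_space M (\<phi> u))"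

lemma parametrization:
  assumes "p \<in> M"
  obtains V u0 \<phi> where "adapted_parametrization V \<phi>" "u0 \<in> V" "\<phi> u0 = p"
proof -
  obtain V \<phi> where lp: "local_parametrization M V \<phi>" and p: "p \<in> \<phi> ` V"
    using surface assms unfolding smooth_surface_def by blast
  obtain u0 where u0: "u0 \<in> V" "\<phi> u0 = p" using p by blast
  obtain \<psi> where hom: "homeomorphism V (\<phi> ` V) \<phi> \<psi>" using lp unfolding local_parametrization_def by blast
  have "openin (top_of_set M) (\<phi> ` V)" using lp unfolding local_parametrization_def by blast
  then have sub: "\<phi> ` V \<subseteq> M" using openin_imp_subset by blast
  have V: "open V" and sm: "smooth_on V \<phi>" using lp unfolding local_parametrization_def by auto
  have sm\<eta>: "smooth_on V (\<lambda>u. \<eta> (\<phi> u))"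
    using gauss_map lp unfolding birkhoff_gauss_map_def smooth_on_surface_def o_def by blast
  have tan: "frechet_derivative \<phi> (at u) a \<in> tangent_space M (\<phi> u)" if u: "u \<in> V" for u a
  proof -
    have blin: "bounded_linear (\<lambda>t. t *\<^sub>R a)" by (rule bounded_linear_scaleR_left)
    have smL: "smooth_on UNIV (\<lambda>t. u + t *\<^sub>R a)"
      by (intro smooth_on_add smooth_on_const smooth_on_bounded_linear blin) auto
    have "open ((\<lambda>t. u + t *\<^sub>R a) -` V)" using smooth_on_imp_continuous_on[OF smL] V by (simp add: open_vimage)
    moreover have "0 \<in> (\<lambda>t. u + t *\<^sub>R a) -` V" using u by simp
    ultimately obtain e where e: "e > 0" "ball 0 e \<subseteq> (\<lambda>t. u + t *\<^sub>R a) -` V" using openE by blast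
    have inV: "u + t *\<^sub>R a \<in> V" if "t \<in> {-e<..<e}" for t
      using e(2) that by (auto simp: subset_iff dist_real_def)
    have "smooth_on {-e<..<e} (\<lambda>t. \<phi> (u + t *\<^sub>R a))"
      by (rule smooth_on_compose[OF _ V _ smooth_on_subset[OF smL] sm]) (use inV in auto)
    moreover have "((\<lambda>t. \<phi> (u + t *\<^sub>R a)) has_derivative (\<lambda>t. frechet_derivative \<phi> (at u) (t *\<^sub>R a))) (at 0)"
    proof (rule has_derivative_compose[where g = \<phi>])
      show "((\<lambda>t. u + t *\<^sub>R a) has_derivative (\<lambda>t. t *\<^sub>R a)) (at 0)" by (auto intro!: derivative_eq_intros)
      show "(\<phi> has_derivative frechet_derivative \<phi> (at u)) (at (u + 0 *\<^sub>R a))"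
        using smooth_on_imp_has_derivative[OF sm u] by simp
    qed
    moreover have "linear (frechet_derivative \<phi> (at u))"
      using smooth_on_imp_has_derivative[OF sm u] has_derivative_linear by blast
    ultimately have "curve_through M (\<phi> u) (frechet_derivative \<phi> (at u) a) (\<lambda>t. \<phi> (u + t *\<^sub>R a))"
      unfolding curve_through_def has_vector_derivative_def
      using e(1) inV sub by (auto simp: linear_scale intro!: exI[of _ e])
    then show ?thesis unfolding tangent_space_def by blast
  qed
  show ?thesis
    by (rule that[of V \<phi> u0])
      (use lp V u0 sm sm\<eta> sub hom tan in \<open>auto simp: local_parametrization_def adapted_parametrization_def\<close>)
qed

text \<open>Velocities of curves do not form a subspace by definition. They are squeezed between the
  range of the derivative of a parametrization and the kernel of \<open>G (\<eta> p)\<close>, both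
  of dimension 2.\<close>

lemma tangent_space_eq:
  assumes p: "p \<in> M" shows "tangent_space M p = {v. G (\<eta> p) \<bullet> v = 0}"
proof
  show "tangent_space M p \<subseteq> {v. G (\<eta> p) \<bullet> v = 0}" using G_tangent[OF p] by blast
  obtain V u0 \<phi> where "adapted_parametrization V \<phi>" and u0: "u0 \<in> V" "\<phi> u0 = p"
    by (rule parametrization[OF p])
  then have sm: "smooth_on V \<phi>" and inj: "\<And>u. u \<in> V \<Longrightarrow> inj (frechet_derivative \<phi> (at u))"
    and tan: "\<And>u a. u \<in> V \<Longrightarrow> frechet_derivative \<phi> (at u) a \<in> tangent_space M (\<phi> u)"
    unfolding adapted_parametrization_def by blast+
  let ?D = "frechet_derivative \<phi> (at u0)" and ?T = "{v. G (\<eta> p) \<bullet> v = 0}"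
  have lin: "linear ?D" using smooth_on_imp_has_derivative[OF sm u0(1)] has_derivative_linear by blast
  have sub: "range ?D \<subseteq> tangent_space M p" using tan[OF u0(1)] u0(2) by auto
  have "G (\<eta> p) \<noteq> 0" using G_\<eta>_\<eta>[OF p] by auto
  then have "dim ?T = 2" using dim_hyperplane[of "G (\<eta> p)"] by simp
  moreover have "dim (range ?D) = 2"
    using dim_image_eq[OF lin, of UNIV] inj[OF u0(1)] by simp
  ultimately have "range ?D = ?T"
    using sub \<open>tangent_space M p \<subseteq> ?T\<close> linear_subspace_image[OF lin subspace_UNIV] subspace_hyperplane
    by (intro subspace_dim_equal) auto
  then show "?T \<subseteq> tangent_space M p" using sub by blast
qed

text \<open>Near \<open>M \<inter> A\<close>, s is the height along \<eta>, E the extension of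
  \<eta> that is constant on the lines q + t \<eta>(q), and D its Jacobian matrix. The gradient of s
  is \<open>G (E y)\<close> because the level sets of s are parallel surfaces, with the same tangent
  planes at corresponding points.\<close>

definition tube_chart :: "real \<Rightarrow> (real^3) set \<Rightarrow> (real^3) set \<Rightarrow> (real^3 \<Rightarrow> real) \<Rightarrow> (real^3 \<Rightarrow> real^3) \<Rightarrow>
    (real^3 \<Rightarrow> real^3^3) \<Rightarrow> bool" where
  "tube_chart e A O' s E D \<longleftrightarrow> e > 0 \<and> open A \<and> open O' \<and>
    (\<forall>q t. q \<in> M \<inter> A \<longrightarrow> \<bar>t\<bar> < e \<longrightarrow> q + t *\<^sub>R \<eta> q \<in> O' \<and> s (q + t *\<^sub>R \<eta> q) = t \<and> E (q + t *\<^sub>R \<eta> q) = \<eta> q) \<and>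
    (\<forall>y\<in>O'. (E has_derivative (\<lambda>v. D y *v v)) (at y) \<and> (s has_derivative (\<lambda>v. G (E y) \<bullet> v)) (at y) \<and>
       (\<exists>q\<in>M \<inter> A. \<exists>t. \<bar>t\<bar> < e \<and> y = q + t *\<^sub>R \<eta> q)) \<and> continuous_on O' D"

text \<open>The map sending (u, t) to \<phi>(u) + t \<eta>(\<phi>(u)) is a local diffeomorphism at t
  = 0, as \<eta> is transversal to the surface. The third coordinate of its inverse is s, the first
  two lead to E.\<close>

lemma tube_chart_exists:
  assumes p0: "p0 \<in> M"
  obtains e A O' s E D where "tube_chart e A O' s E D" "p0 \<in> A"
proof -
  obtain V u0 \<phi> where ap: "adapted_parametrization V \<phi>" and u0: "u0 \<in> V" "\<phi> u0 = p0"
    by (rule parametrization[OF p0])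
  have V: "open V" and sm: "smooth_on V \<phi>" "smooth_on V (\<lambda>u. \<eta> (\<phi> u))"
    and inj: "\<And>u. u \<in> V \<Longrightarrow> inj (frechet_derivative \<phi> (at u))" and opn: "openin (top_of_set M) (\<phi> ` V)"
    and sub: "\<phi> ` V \<subseteq> M"
    and tan: "\<And>u a. u \<in> V \<Longrightarrow> frechet_derivative \<phi> (at u) a \<in> tangent_space M (\<phi> u)"
    using ap unfolding adapted_parametrization_def by blast+
  obtain \<psi> where hom: "homeomorphism V (\<phi> ` V) \<phi> \<psi>"
    using ap unfolding adapted_parametrization_def by blast
  define \<theta> where "\<theta> = (\<lambda>u. \<eta> (\<phi> u))"
  let ?d\<phi> = "\<lambda>u. frechet_derivative \<phi> (at u)" and ?d\<theta> = "\<lambda>u. frechet_derivative \<theta> (at u)"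
  have sm\<theta>: "smooth_on V \<theta>" using sm(2) unfolding \<theta>_def .
  have \<phi>M: "\<phi> u \<in> M" if "u \<in> V" for u using sub that by blast
  have lin\<phi>: "linear (?d\<phi> u)" and lin\<theta>: "linear (?d\<theta> u)" if "u \<in> V" for u
    using smooth_on_imp_has_derivative[OF sm(1) that] smooth_on_imp_has_derivative[OF sm\<theta> that] has_derivative_linear by blast+
  have G\<phi>: "G (\<theta> u) \<bullet> ?d\<phi> u a = 0" if "u \<in> V" for u a
    unfolding \<theta>_def using G_tangent[OF \<phi>M[OF that] tan[OF that]] .
  have G1: "G (\<theta> u) \<bullet> \<theta> u = 1" if "u \<in> V" for u
    unfolding \<theta>_def using G_\<eta>_\<eta>[OF \<phi>M[OF that]] .
  have G\<theta>: "G (\<theta> u) \<bullet> ?d\<theta> u a = 0" if u: "u \<in> V" for u a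
  proof -
    have "\<theta> u \<noteq> 0" unfolding \<theta>_def using \<eta>_nonzero[OF \<phi>M[OF u]] .
    then have "((\<lambda>u. N (\<theta> u)) has_derivative (\<lambda>a. G (\<theta> u) \<bullet> ?d\<theta> u a)) (at u)"
      by (intro has_derivative_compose[where g = N, OF smooth_on_imp_has_derivative[OF sm\<theta> u] dN])
    moreover have "((\<lambda>u. 1) has_derivative (\<lambda>a. 0)) (at u)" by (rule has_derivative_const)
    ultimately have "(\<lambda>a. G (\<theta> u) \<bullet> ?d\<theta> u a) = (\<lambda>a. 0)"
      by (rule has_derivative_at_transform_eq[OF _ _ V u]) (use N_\<eta> \<phi>M in \<open>auto simp: \<theta>_def\<close>)
    then show ?thesis by meson
  qed
  define U where "U = proj12 -` V"
  have cp: "continuous_on S proj12" for S by (intro linear_continuous_on bounded_linear_proj12)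
  have openU: "open U" unfolding U_def by (rule open_vimage[OF V cp])
  define \<Phi> where "\<Phi> = (\<lambda>x. \<phi> (proj12 x) + (x $ 3) *\<^sub>R \<theta> (proj12 x))"
  have prU: "proj12 ` U \<subseteq> V" unfolding U_def by blast
  have smpr: "smooth_on U proj12" by (rule smooth_on_bounded_linear[OF openU bounded_linear_proj12])
  have sm\<Phi>: "smooth_on U \<Phi>" unfolding \<Phi>_def
    by (rule smooth_on_add[OF openU smooth_on_compose[OF openU V prU smpr sm(1)]
          smooth_on_scaleR[OF openU smooth_on_bounded_linear[OF openU bounded_linear_vec_nth]
            smooth_on_compose[OF openU V prU smpr sm\<theta>]]])
  have d\<Phi>: "frechet_derivative \<Phi> (at x) = (\<lambda>w. ?d\<phi> (proj12 x) (proj12 w) +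
      (x $ 3 *\<^sub>R ?d\<theta> (proj12 x) (proj12 w) + w $ 3 *\<^sub>R \<theta> (proj12 x)))" if "x \<in> U" for x
  proof -
    have x: "proj12 x \<in> V" using that unfolding U_def by simp
    have pr: "(proj12 has_derivative proj12) (at x)" by (rule bounded_linear_imp_has_derivative[OF bounded_linear_proj12])
    have "(\<Phi> has_derivative (\<lambda>w. ?d\<phi> (proj12 x) (proj12 w) +
      (x $ 3 *\<^sub>R ?d\<theta> (proj12 x) (proj12 w) + w $ 3 *\<^sub>R \<theta> (proj12 x)))) (at x)"
      unfolding \<Phi>_def
      by (intro has_derivative_add has_derivative_scaleR
          has_derivative_compose[where g = \<phi>, OF pr smooth_on_imp_has_derivative[OF sm(1) x]]
          has_derivative_compose[where g = \<theta>, OF pr smooth_on_imp_has_derivative[OF sm\<theta> x]]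
          bounded_linear_imp_has_derivative bounded_linear_vec_nth)
    then show ?thesis by (rule frechet_derivative_at[symmetric])
  qed
  \<comment> \<open>The derivatives of \<phi> and of \<theta> are both tangent, so the conormal sees
    the height component alone. This yields injectivity at x0 and later the gradient of s.\<close>
  have Gd\<Phi>: "G (\<theta> (proj12 x)) \<bullet> frechet_derivative \<Phi> (at x) w = w $ 3" if "x \<in> U" for x w
    using that G\<phi> G\<theta> G1 unfolding d\<Phi>[OF that] by (simp add: inner_add_right U_def)
  define x0 where "x0 = lift3 u0 0"
  have x0: "x0 \<in> U" unfolding x0_def U_def using u0 by simp
  have "inj (frechet_derivative \<Phi> (at x0))"
  proof (rule linear_injective_0[THEN iffD2, rule_format])
    show "linear (frechet_derivative \<Phi> (at x0))"
      using smooth_on_imp_has_derivative[OF sm\<Phi> x0] has_derivative_linear by blast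
    fix w assume 0: "frechet_derivative \<Phi> (at x0) w = 0"
    then have 3: "w $ 3 = 0" using Gd\<Phi>[OF x0, of w] by simp
    then have "?d\<phi> u0 (proj12 w) = 0" using 0 unfolding d\<Phi>[OF x0] by (simp add: x0_def)
    then have "proj12 w = 0"
      using inj[OF u0(1)] linear_injective_0[OF lin\<phi>[OF u0(1)]] by blast
    then show "w = 0" using 3 by (rule proj12_eq_0)
  qed
  then obtain U' V' g g' where U': "open U'" "U' \<subseteq> U" "x0 \<in> U'" and V': "open V'" and homg: "homeomorphism U' V' \<Phi> g"
    and g': "\<forall>y\<in>V'. (g has_derivative g' y) (at y)" "\<forall>w. continuous_on V' (\<lambda>y. g' y w)"
      "\<forall>y\<in>V'. \<forall>w. frechet_derivative \<Phi> (at (g y)) (g' y w) = w"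
    by (rule smooth_local_inverse[OF openU x0 sm\<Phi>])
  have dg: "\<And>y. y \<in> V' \<Longrightarrow> (g has_derivative g' y) (at y)"
    and contg: "\<And>w. continuous_on V' (\<lambda>y. g' y w)"
    and invg: "\<And>y w. y \<in> V' \<Longrightarrow> frechet_derivative \<Phi> (at (g y)) (g' y w) = w"
    using g' by blast+
  have gU: "g y \<in> U'" and \<Phi>g: "\<Phi> (g y) = y" if "y \<in> V'" for y
    using homg that unfolding homeomorphism_def by blast+
  have \<Phi>V: "\<Phi> x \<in> V'" and g\<Phi>: "g (\<Phi> x) = x" if "x \<in> U'" for x
    using homg that unfolding homeomorphism_def by blast+
  have contg0: "continuous_on V' g" using homg unfolding homeomorphism_def by blast
  have clift: "continuous_on UNIV (\<lambda>z. lift3 (fst z) (snd z))" unfolding lift3_def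
  proof (intro continuous_on_vec_lambda)
    fix i :: 3
    show "continuous_on UNIV (\<lambda>z. if i = 1 then fst z $ 1 else if i = 2 then fst z $ 2 else snd z)"
      by (cases "i = 1"; cases "i = 2") (auto intro!: continuous_intros)
  qed
  have "open ((\<lambda>z. lift3 (fst z) (snd z)) -` U')" using clift U'(1) by (rule open_vimage[rotated])
  moreover have "(u0, 0) \<in> (\<lambda>z. lift3 (fst z) (snd z)) -` U'" using U'(3) unfolding x0_def by simp
  \<comment> \<open>A product box inside U' is needed, as a chart must contain, over each of its
    surface points, all heights below the same e.\<close>
  ultimately obtain A0 B0 where AB: "open A0" "open B0" "(u0, 0::real) \<in> A0 \<times> B0"
    "A0 \<times> B0 \<subseteq> (\<lambda>z. lift3 (fst z) (snd z)) -` U'" by (rule open_prod_elim)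
  obtain e where e: "e > 0" "ball 0 e \<subseteq> B0" using AB(2,3) openE by blast
  have inU': "lift3 u t \<in> U'" if "u \<in> A0" "\<bar>t\<bar> < e" for u t
    using AB(4) e(2) that by (auto simp: subset_iff)
  have "openin (top_of_set (\<phi> ` V)) (\<phi> ` (V \<inter> A0))"
    using homeomorphism_imp_open_map[OF hom, of "V \<inter> A0"] AB(1) by (simp add: openin_open_Int)
  then have "openin (top_of_set M) (\<phi> ` (V \<inter> A0))" using opn openin_trans by blast
  then obtain A where A: "open A" "\<phi> ` (V \<inter> A0) = M \<inter> A" unfolding openin_open by blast
  define O' where "O' = V' \<inter> g -` (proj12 -` A0 \<inter> {x. \<bar>x $ 3\<bar> < e})"
  have openW: "open (proj12 -` A0 \<inter> {x::real^3. \<bar>x $ 3\<bar> < e})"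
    by (intro open_Int open_vimage AB(1) cp open_Collect_less continuous_intros)
  have openO: "open O'" unfolding O'_def by (rule continuous_open_preimage[OF contg0 V' openW])
  define s where "s = (\<lambda>y. g y $ 3)"
  define E where "E = (\<lambda>y. \<theta> (proj12 (g y)))"
  define D where "D = (\<lambda>y. matrix (\<lambda>w. ?d\<theta> (proj12 (g y)) (proj12 (g' y w))))"
  have OV: "y \<in> V'" "g y \<in> U" "proj12 (g y) \<in> V" if "y \<in> O'" for y
    using that U'(2) gU unfolding O'_def U_def by blast+
  have dE: "(E has_derivative (\<lambda>w. ?d\<theta> (proj12 (g y)) (proj12 (g' y w)))) (at y)" if y: "y \<in> O'" for y
    unfolding E_def
    by (rule has_derivative_compose[where g = \<theta>, OF has_derivative_compose[where g = proj12, OF dg[OF OV(1)[OF y]]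
          bounded_linear_imp_has_derivative[OF bounded_linear_proj12]] smooth_on_imp_has_derivative[OF sm\<theta> OV(3)[OF y]]])
  have Dv: "D y *v w = ?d\<theta> (proj12 (g y)) (proj12 (g' y w))" if "y \<in> O'" for y w
    unfolding D_def using matrix_vector_mul(2)[OF has_derivative_linear[OF dE[OF that]]] by meson
  have p0A: "p0 \<in> A" using A(2) u0 AB(3) by blast
  have c1: "q + t *\<^sub>R \<eta> q \<in> O' \<and> s (q + t *\<^sub>R \<eta> q) = t \<and> E (q + t *\<^sub>R \<eta> q) = \<eta> q"
    if q: "q \<in> M \<inter> A" and t: "\<bar>t\<bar> < e" for q t
  proof -
    obtain u where u: "u \<in> V" "u \<in> A0" "q = \<phi> u" using q A(2) by blast
    have l: "lift3 u t \<in> U'" using inU' u t by blast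
    have \<Phi>l: "\<Phi> (lift3 u t) = q + t *\<^sub>R \<eta> q" unfolding \<Phi>_def \<theta>_def u(3) by simp
    have g: "g (q + t *\<^sub>R \<eta> q) = lift3 u t" using g\<Phi>[OF l] unfolding \<Phi>l .
    show "q + t *\<^sub>R \<eta> q \<in> O' \<and> s (q + t *\<^sub>R \<eta> q) = t \<and> E (q + t *\<^sub>R \<eta> q) = \<eta> q"
      using \<Phi>V[OF l] u(1,2) t unfolding \<Phi>l O'_def s_def E_def by (simp add: g \<theta>_def u(3)[symmetric])
  qed
  have c2: "\<exists>q\<in>M \<inter> A. \<exists>t. \<bar>t\<bar> < e \<and> y = q + t *\<^sub>R \<eta> q" if y: "y \<in> O'" for y
  proof -
    define q where "q = \<phi> (proj12 (g y))"
    have "q \<in> M \<inter> A" using OV(3)[OF y] y unfolding A(2)[symmetric] q_def O'_def by blast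
    moreover have "y = q + (g y $ 3) *\<^sub>R \<eta> q" using \<Phi>g[OF OV(1)[OF y]] unfolding \<Phi>_def q_def \<theta>_def by simp
    moreover have "\<bar>g y $ 3\<bar> < e" using y unfolding O'_def by simp
    ultimately show "\<exists>q\<in>M \<inter> A. \<exists>t. \<bar>t\<bar> < e \<and> y = q + t *\<^sub>R \<eta> q" by blast
  qed
  have c3: "(E has_derivative (\<lambda>v. D y *v v)) (at y)" if y: "y \<in> O'" for y
    using dE[OF y] unfolding Dv[OF y] .
  have c4: "(s has_derivative (\<lambda>v. G (E y) \<bullet> v)) (at y)" if y: "y \<in> O'" for y
  proof -
    have "(s has_derivative (\<lambda>w. g' y w $ 3)) (at y)"
      unfolding s_def
      by (rule has_derivative_compose[where g = "\<lambda>x. x $ 3", OF dg[OF OV(1)[OF y]]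
            bounded_linear_imp_has_derivative[OF bounded_linear_vec_nth]])
    moreover have "g' y w $ 3 = G (E y) \<bullet> w" for w
      using Gd\<Phi>[OF OV(2)[OF y], of "g' y w"] invg[OF OV(1)[OF y]] unfolding E_def by simp
    ultimately show "(s has_derivative (\<lambda>v. G (E y) \<bullet> v)) (at y)" by simp
  qed
  have c5: "continuous_on O' D"
  proof -
    have sub': "O' \<subseteq> V'" unfolding O'_def by blast
    \<comment> \<open>As in the chain rule for \<open>Ck_on\<close>, the moving direction is
      expanded in the basis, so that \<theta> is differentiated in fixed directions only.\<close>
    have "continuous_on O' (\<lambda>y. \<Sum>b\<in>Basis. (proj12 (g' y w) \<bullet> b) *\<^sub>R ?d\<theta> (proj12 (g y)) b)" for w
    proof (intro continuous_on_sum continuous_on_scaleR continuous_on_inner continuous_on_const)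
      show "continuous_on O' (\<lambda>y. proj12 (g' y w))"
        using continuous_on_compose2[OF cp[of UNIV], of O' "\<lambda>y. g' y w"] continuous_on_subset[OF contg sub'] by blast
      have "continuous_on O' (\<lambda>y. proj12 (g y))"
        using continuous_on_compose2[OF cp[of UNIV], of O' g] continuous_on_subset[OF contg0 sub'] by blast
      then show "continuous_on O' (\<lambda>y. ?d\<theta> (proj12 (g y)) b)" for b
        by (rule continuous_on_compose2[OF smooth_on_imp_continuous_on[OF smooth_on_derivative[OF sm\<theta>]]])
          (use OV(3) in blast)
    qed
    moreover have "D y *v w = (\<Sum>b\<in>Basis. (proj12 (g' y w) \<bullet> b) *\<^sub>R ?d\<theta> (proj12 (g y)) b)" if y: "y \<in> O'" for y w
    proof -
      note lin = lin\<theta>[OF OV(3)[OF y]]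
      have "D y *v w = ?d\<theta> (proj12 (g y)) (\<Sum>b\<in>Basis. (proj12 (g' y w) \<bullet> b) *\<^sub>R b)"
        unfolding Dv[OF y] by (simp add: euclidean_representation)
      then show ?thesis by (simp add: linear_sum[OF lin] linear_scale[OF lin])
    qed
    ultimately have "continuous_on O' (\<lambda>y. D y *v w)" for w by (simp cong: continuous_on_cong)
    then show "continuous_on O' D" by (rule continuous_on_matrixI)
  qed
  have "tube_chart e A O' s E D"
    unfolding tube_chart_def using e(1) A(1) openO c1 c2 c3 c4 c5 by auto
  then show ?thesis using p0A by (rule that)
qed

lemma \<eta>_bounded: obtains C where "C > 0" "\<forall>p\<in>M. norm (\<eta> p) \<le> C"
proof -
  have "compact (N ` sphere 0 1)" using continuous_on_N compact_sphere by (rule compact_continuous_image)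
  moreover have "N ` sphere 0 1 \<noteq> {}" by simp
  ultimately obtain x where x: "norm x = 1" "\<And>y. norm y = 1 \<Longrightarrow> N x \<le> N y"
    using compact_attains_inf[of "N ` sphere 0 1"] by auto
  have Nx: "N x > 0" using x(1) by (intro N_pos) auto
  have "norm y \<le> 1 / N x" if "N y = 1" for y
  proof -
    have y0: "y \<noteq> 0" using that by auto
    have "N x \<le> N (y /\<^sub>R norm y)" using y0 by (intro x(2)) simp
    also have "\<dots> = 1 / norm y" using that y0 by (simp add: N_scale divide_inverse)
    finally show ?thesis using Nx y0 by (simp add: field_simps)
  qed
  then show ?thesis using that[of "1 / N x"] Nx N_\<eta> by simp
qed

text \<open>A Lebesgue number \<epsilon> of the cover by charts makes the tube uniform. Two short
  normal segments that meet have feet less than \<epsilon> apart, so both lie in one chart, where s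
  and E tell them apart; hence the local functions glue.\<close>

lemma tube_exists:
  obtains \<delta> s E and D :: "real^3 \<Rightarrow> real^3^3" where "\<delta> > 0"
    "open {p + t *\<^sub>R \<eta> p |p t. p \<in> M \<and> \<bar>t\<bar> < \<delta>}"
    "\<forall>p t. p \<in> M \<longrightarrow> \<bar>t\<bar> < \<delta> \<longrightarrow> s (p + t *\<^sub>R \<eta> p) = t"
    "\<forall>p t. p \<in> M \<longrightarrow> \<bar>t\<bar> < \<delta> \<longrightarrow> E (p + t *\<^sub>R \<eta> p) = \<eta> p"
    "\<forall>p t y. p \<in> M \<longrightarrow> \<bar>t\<bar> < \<delta> \<longrightarrow> y = p + t *\<^sub>R \<eta> p \<longrightarrow> (E has_derivative (\<lambda>v. D y *v v)) (at y)"
    "\<forall>p t y. p \<in> M \<longrightarrow> \<bar>t\<bar> < \<delta> \<longrightarrow> y = p + t *\<^sub>R \<eta> p \<longrightarrow> (s has_derivative (\<lambda>v. G (E y) \<bullet> v)) (at y)"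
    "continuous_on {p + t *\<^sub>R \<eta> p |p t. p \<in> M \<and> \<bar>t\<bar> < \<delta>} D"
proof -
  define chartable where "chartable = (\<lambda>e A. \<exists>O' s E D. tube_chart e A O' s E D)"
  have chartable: "e > 0 \<and> open A" if "chartable e A" for e A
    using that unfolding chartable_def tube_chart_def by (elim exE conjE) simp
  have ex: "\<exists>e A. chartable e A \<and> p \<in> A" if p: "p \<in> M" for p
  proof -
    obtain e A O' s E D where "tube_chart e A O' s E D" "p \<in> A" by (rule tube_chart_exists[OF p])
    then have "chartable e A \<and> p \<in> A" unfolding chartable_def by (intro conjI exI)
    then show ?thesis by blast
  qed
  \<comment> \<open>Intersecting with a ball of radius e ties size to height: a ball of radius
    \<epsilon> inside such a set forces \<epsilon> \<le> e, so the chart reaches at least to height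
    \<epsilon>.\<close>
  define \<G> where "\<G> = {A \<inter> ball p e |p e A. chartable e A}"
  have cover: "M \<subseteq> \<Union>\<G>"
  proof
    fix p assume "p \<in> M"
    then obtain e A where c: "chartable e A" "p \<in> A" using ex by blast
    then have "p \<in> A \<inter> ball p e" using chartable by auto
    moreover have "A \<inter> ball p e \<in> \<G>" unfolding \<G>_def using c(1) by blast
    ultimately show "p \<in> \<Union>\<G>" by blast
  qed
  have opn: "open X" if "X \<in> \<G>" for X
  proof -
    obtain p e A where "X = A \<inter> ball p e" "chartable e A" using \<open>X \<in> \<G>\<close> unfolding \<G>_def by blast
    then show ?thesis using chartable by auto
  qed
  have "\<exists>\<epsilon>>0. \<forall>p\<in>M. \<exists>X\<in>\<G>. ball p \<epsilon> \<subseteq> X"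
  proof (rule Heine_Borel_lemma[OF compact_M cover])
    show "open X" if "X \<in> \<G>" for X by (rule opn[OF that])
    fix e :: real assume "0 < e" "\<And>x. x \<in> M \<Longrightarrow> \<exists>G\<in>\<G>. ball x e \<subseteq> G"
    then show ?thesis by blast
  qed
  then obtain \<epsilon> where \<epsilon>: "\<epsilon> > 0" "\<And>p. p \<in> M \<Longrightarrow> \<exists>X\<in>\<G>. ball p \<epsilon> \<subseteq> X" by blast
  obtain C where "C > 0" "\<forall>p\<in>M. norm (\<eta> p) \<le> C" by (rule \<eta>_bounded)
  then have C: "C > 0" "\<And>p. p \<in> M \<Longrightarrow> norm (\<eta> p) \<le> C" by blast+
  have good: "\<exists>e A. chartable e A \<and> \<epsilon> \<le> e \<and> ball p \<epsilon> \<subseteq> A" if p: "p \<in> M" for p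
  proof -
    obtain X where X: "X \<in> \<G>" "ball p \<epsilon> \<subseteq> X" using \<epsilon>(2)[OF p] by blast
    then obtain c e A where "X = A \<inter> ball c e" and ch: "chartable e A" unfolding \<G>_def by blast
    then have "ball p \<epsilon> \<subseteq> ball c e" "ball p \<epsilon> \<subseteq> A" using X by auto
    moreover from this(1) have "\<epsilon> \<le> e" using \<epsilon>(1) by (simp add: ball_subset_ball_iff) (smt (verit) zero_le_dist)
    ultimately show ?thesis using ch by blast
  qed
  \<comment> \<open>The bound \<epsilon> keeps the heights within the charts; the bound \<epsilon> /
    (2C) brings the feet of two meeting segments within 2\<delta>C \<le> \<epsilon>.\<close>
  define \<delta> where "\<delta> = min \<epsilon> (\<epsilon> / (2 * C))"
  have \<delta>: "\<delta> > 0" "\<delta> \<le> \<epsilon>" "2 * \<delta> * C \<le> \<epsilon>" unfolding \<delta>_def using \<epsilon>(1) C(1) by (auto simp: min_def field_simps)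
  have close: "q \<in> ball p \<epsilon>" if pq: "p \<in> M" "q \<in> M" "\<bar>t\<bar> < \<delta>" "\<bar>t'\<bar> < \<delta>" "p + t *\<^sub>R \<eta> p = q + t' *\<^sub>R \<eta> q" for p q t t'
  proof -
    have "p - q = t' *\<^sub>R \<eta> q - t *\<^sub>R \<eta> p" using pq(5) by (simp add: algebra_simps)
    then have "norm (p - q) \<le> \<bar>t'\<bar> * norm (\<eta> q) + \<bar>t\<bar> * norm (\<eta> p)"
      using norm_triangle_ineq4[of "t' *\<^sub>R \<eta> q" "t *\<^sub>R \<eta> p"] by simp
    also have "\<dots> \<le> \<bar>t'\<bar> * C + \<bar>t\<bar> * C" using C(2) pq by (intro add_mono mult_left_mono) auto
    also have "\<dots> < \<delta> * C + \<delta> * C" using pq C(1) by (intro add_strict_mono mult_strict_right_mono) auto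
    finally show ?thesis using \<delta>(3) by (simp add: dist_norm algebra_simps)
  qed
  have inj: "q = p \<and> t' = t" if pq: "p \<in> M" "q \<in> M" "\<bar>t\<bar> < \<delta>" "\<bar>t'\<bar> < \<delta>" "p + t *\<^sub>R \<eta> p = q + t' *\<^sub>R \<eta> q" for p q t t'
  proof -
    obtain e A where eA: "chartable e A" "\<epsilon> \<le> e" "ball p \<epsilon> \<subseteq> A" using good[OF pq(1)] by blast
    then obtain O' s E D where "tube_chart e A O' s E D" unfolding chartable_def by blast
    note ch = this eA(2,3)
    have "q \<in> M \<inter> A" "p \<in> M \<inter> A" using close[OF pq] ch(3) pq \<epsilon>(1) by auto
    moreover have "\<bar>t\<bar> < e" "\<bar>t'\<bar> < e" using pq \<delta> ch(2) by auto
    ultimately have "s (p + t *\<^sub>R \<eta> p) = t \<and> E (p + t *\<^sub>R \<eta> p) = \<eta> p" "s (q + t' *\<^sub>R \<eta> q) = t' \<and> E (q + t' *\<^sub>R \<eta> q) = \<eta> q"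
      using ch(1) unfolding tube_chart_def by blast+
    then have "t = t'" "\<eta> p = \<eta> q" unfolding pq(5) by auto
    then show ?thesis using pq(5) by simp
  qed
  let ?T = "{p + t *\<^sub>R \<eta> p |p t. p \<in> M \<and> \<bar>t\<bar> < \<delta>}"
  define foot where "foot = (\<lambda>y. THE p. p \<in> M \<and> (\<exists>t. \<bar>t\<bar> < \<delta> \<and> y = p + t *\<^sub>R \<eta> p))"
  have foot: "foot (p + t *\<^sub>R \<eta> p) = p" if "p \<in> M" "\<bar>t\<bar> < \<delta>" for p t
    unfolding foot_def using that inj by (intro the_equality) blast+
  define s where "s = (\<lambda>y. THE t. \<bar>t\<bar> < \<delta> \<and> y = foot y + t *\<^sub>R \<eta> (foot y))"
  define E where "E = (\<lambda>y. \<eta> (foot y))"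
  define D where "D = jacobian_matrix E"
  have s: "s (p + t *\<^sub>R \<eta> p) = t" if "p \<in> M" "\<bar>t\<bar> < \<delta>" for p t
    unfolding s_def foot[OF that] using that inj by (intro the_equality) blast+
  have E: "E (p + t *\<^sub>R \<eta> p) = \<eta> p" if "p \<in> M" "\<bar>t\<bar> < \<delta>" for p t
    unfolding E_def foot[OF that] ..
  have local: "\<exists>W. open W \<and> p + t *\<^sub>R \<eta> p \<in> W \<and> W \<subseteq> ?T \<and>
      (\<forall>y\<in>W. (E has_derivative (\<lambda>v. D y *v v)) (at y) \<and> (s has_derivative (\<lambda>v. G (E y) \<bullet> v)) (at y)) \<and> continuous_on W D"
    if p: "p \<in> M" "\<bar>t\<bar> < \<delta>" for p t
  proof -
    obtain e A where eA: "chartable e A" "\<epsilon> \<le> e" "ball p \<epsilon> \<subseteq> A" using good[OF p(1)] by blast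
    then obtain O' s' E' D' where "tube_chart e A O' s' E' D'" unfolding chartable_def by blast
    note ch = this eA(2,3)
    have pA: "p \<in> M \<inter> A" using ch(3) p \<epsilon>(1) by auto
    have chD: "open O'" "continuous_on O' D'" using ch(1) unfolding tube_chart_def by blast+
    have cht: "q + t *\<^sub>R \<eta> q \<in> O' \<and> s' (q + t *\<^sub>R \<eta> q) = t \<and> E' (q + t *\<^sub>R \<eta> q) = \<eta> q" if "q \<in> M \<inter> A" "\<bar>t\<bar> < e" for q t
      using ch(1) that unfolding tube_chart_def by blast
    have chy: "(E' has_derivative (\<lambda>v. D' y *v v)) (at y)" "(s' has_derivative (\<lambda>v. G (E' y) \<bullet> v)) (at y)"
       "\<exists>q\<in>M \<inter> A. \<exists>t. \<bar>t\<bar> < e \<and> y = q + t *\<^sub>R \<eta> q" if "y \<in> O'" for y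
      using ch(1) that unfolding tube_chart_def by blast+
    \<comment> \<open>Restricting the chart to heights below \<delta> makes its functions agree with
      the global ones.\<close>
    define W where "W = O' \<inter> s' -` {-\<delta><..<\<delta>}"
    have "continuous_on O' s'"
      by (rule has_derivative_continuous_on) (use chy(2) has_derivative_at_withinI in blast)
    then have W: "open W" unfolding W_def by (rule continuous_open_preimage[OF _ chD(1)]) simp
    have Wy: "y \<in> ?T \<and> E y = E' y \<and> s y = s' y" if y: "y \<in> W" for y
    proof -
      obtain q t where q: "q \<in> M \<inter> A" "\<bar>t\<bar> < e" "y = q + t *\<^sub>R \<eta> q" using chy(3) y unfolding W_def by blast
      have t: "s' y = t" "E' y = \<eta> q" using cht[OF q(1,2)] q(3) by auto
      then have "\<bar>t\<bar> < \<delta>" using y unfolding W_def by auto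
      then show ?thesis using q t s[of q t] E[of q t] by auto
    qed
    have pW: "p + t *\<^sub>R \<eta> p \<in> W" unfolding W_def using cht[OF pA, of t] p \<delta>(2) ch(2) by auto
    have dE: "(E has_derivative (\<lambda>v. D' y *v v)) (at y)" if y: "y \<in> W" for y
      by (rule has_derivative_transform_within_open[OF chy(1) W y]) (use Wy y in \<open>auto simp: W_def\<close>)
    have ds: "(s has_derivative (\<lambda>v. G (E y) \<bullet> v)) (at y)" if y: "y \<in> W" for y
      by (rule has_derivative_transform_within_open[OF _ W y, of s'])
        (use Wy y chy(2)[of y] in \<open>auto simp: W_def\<close>)
    have D: "D y = D' y" if "y \<in> W" for y
      unfolding D_def jacobian_matrix_def using frechet_derivative_at[OF dE[OF that]] matrix_of_matrix_vector_mul[of "D' y"] by simp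
    have "continuous_on W D'" using chD(2) continuous_on_subset unfolding W_def by blast
    then have "continuous_on W D" using D by (simp cong: continuous_on_cong)
    then show ?thesis using W pW Wy dE ds D by (intro exI[of _ W]) auto
  qed
  have openT: "open ?T"
    unfolding open_subopen[of ?T]
  proof
    fix y assume "y \<in> ?T"
    then obtain p t where pt: "p \<in> M" "\<bar>t\<bar> < \<delta>" "y = p + t *\<^sub>R \<eta> p" by blast
    obtain W where "open W" "y \<in> W" "W \<subseteq> ?T" using local[OF pt(1,2)] unfolding pt(3)[symmetric] by auto
    then show "\<exists>T. open T \<and> y \<in> T \<and> T \<subseteq> ?T" by blast
  qed
  have dED: "(E has_derivative (\<lambda>v. D y *v v)) (at y)" "(s has_derivative (\<lambda>v. G (E y) \<bullet> v)) (at y)"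
    if y: "p \<in> M" "\<bar>t\<bar> < \<delta>" "y = p + t *\<^sub>R \<eta> p" for p t y
  proof -
    obtain W where "y \<in> W" "\<forall>y\<in>W. (E has_derivative (\<lambda>v. D y *v v)) (at y) \<and> (s has_derivative (\<lambda>v. G (E y) \<bullet> v)) (at y)"
      using local[OF y(1,2)] unfolding y(3)[symmetric] by auto
    then show "(E has_derivative (\<lambda>v. D y *v v)) (at y)" "(s has_derivative (\<lambda>v. G (E y) \<bullet> v)) (at y)" by blast+
  qed
  show ?thesis
  proof (rule that[of \<delta> s E D, OF \<delta>(1) openT])
    show "continuous_on ?T D"
      unfolding continuous_on_eq_continuous_at[OF openT]
    proof
      fix y assume "y \<in> ?T"
      then obtain p t where pt: "p \<in> M" "\<bar>t\<bar> < \<delta>" "y = p + t *\<^sub>R \<eta> p" by blast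
      obtain W where "open W" "y \<in> W" "continuous_on W D"
        using local[OF pt(1,2)] unfolding pt(3)[symmetric] by auto
      then show "isCont D y" using continuous_on_eq_continuous_at by blast
    qed
    show "\<forall>p t. p \<in> M \<longrightarrow> \<bar>t\<bar> < \<delta> \<longrightarrow> s (p + t *\<^sub>R \<eta> p) = t"
      "\<forall>p t. p \<in> M \<longrightarrow> \<bar>t\<bar> < \<delta> \<longrightarrow> E (p + t *\<^sub>R \<eta> p) = \<eta> p"
      by (intro allI impI s E; assumption)+
    show "\<forall>p t y. p \<in> M \<longrightarrow> \<bar>t\<bar> < \<delta> \<longrightarrow> y = p + t *\<^sub>R \<eta> p \<longrightarrow> (E has_derivative (\<lambda>v. D y *v v)) (at y)"
      "\<forall>p t y. p \<in> M \<longrightarrow> \<bar>t\<bar> < \<delta> \<longrightarrow> y = p + t *\<^sub>R \<eta> p \<longrightarrow> (s has_derivative (\<lambda>v. G (E y) \<bullet> v)) (at y)"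
      by (intro allI impI dED; assumption)+
  qed
qed

end

section \<open>Compactly supported vector fields have vanishing total divergence\<close>

lemma continuous_compact_support_integrable:
  fixes f :: "'a::euclidean_space \<Rightarrow> real"
  assumes "compact K" "continuous_on UNIV f" "\<And>x. x \<notin> K \<Longrightarrow> f x = 0"
  shows "integrable lborel f"
proof -
  have "integrable lborel (\<lambda>x. indicator K x *\<^sub>R f x)"
    by (rule borel_integrable_compact[OF assms(1) continuous_on_subset[OF assms(2)]]) simp
  moreover have "(\<lambda>x. indicator K x *\<^sub>R f x) = f" using assms(3) by (auto simp: fun_eq_iff indicator_def)
  ultimately show ?thesis by simp
qed

text \<open>Translation invariance of Lebesgue measure gives every difference quotient the integral
  0. The quotients are bounded by the mean value theorem and supported in one compact set, so
  dominated convergence passes to the derivative.\<close>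

lemma integral_directional_derivative_eq_0:
  fixes f :: "'a::euclidean_space \<Rightarrow> real"
  assumes K: "compact K" and f': "\<And>x. (f has_derivative f' x) (at x)"
    and cont: "continuous_on UNIV (\<lambda>x. f' x e)" and supp: "\<And>x. x \<notin> K \<Longrightarrow> f x = 0"
  shows "integrable lborel (\<lambda>x. f' x e) \<and> (\<integral>x. f' x e \<partial>lborel) = 0"
proof -
  have contf: "continuous_on UNIV f"
    using f' by (intro has_derivative_continuous_on[where f' = f']) (auto intro: has_derivative_at_withinI)
  have supp': "f' x e = 0" if x: "x \<notin> K" for x
  proof -
    have "f' x = (\<lambda>v. 0)"
      by (rule has_derivative_at_transform_eq[OF f' has_derivative_const, where U = "-K"])
        (use K x supp compact_imp_closed in \<open>auto intro: open_Compl\<close>)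
    then show ?thesis by simp
  qed
  have intf: "integrable lborel f" by (rule continuous_compact_support_integrable[OF K contf supp])
  have intf': "integrable lborel (\<lambda>x. f' x e)"
    by (rule continuous_compact_support_integrable[OF K cont supp'])
  have "bounded ((\<lambda>x. f' x e) ` K)"
    by (intro compact_imp_bounded compact_continuous_image[OF continuous_on_subset[OF cont] K]) simp
  then obtain B where B: "B > 0" "\<forall>x\<in>K. norm (f' x e) \<le> B" unfolding bounded_pos by auto
  then have bnd: "\<bar>f' x e\<bar> \<le> B" for x using supp'[of x] by (cases "x \<in> K") auto
  \<comment> \<open>All points from which a step \<open>t *\<^sub>R e\<close> with t in [0, 1]
    reaches K. As \<open>h n \<le> 1\<close>, this contains the support of every difference
    quotient.\<close>
  define K' where "K' = (\<lambda>(x, t). x - t *\<^sub>R e) ` (K \<times> {0..1::real})"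
  have K': "compact K'" unfolding K'_def
    by (intro compact_continuous_image compact_Times K compact_Icc)
       (auto intro!: continuous_intros simp: case_prod_unfold)
  define h where "h = (\<lambda>n. 1 / (real n + 1))"
  have h: "0 < h n" "h n \<le> 1" for n unfolding h_def by (auto simp: field_simps)
  define F where "F = (\<lambda>n x. (f (h n *\<^sub>R e + x) - f x) / h n)"
  have F_bound: "\<bar>F n x\<bar> \<le> B * indicator K' x" for n x
  proof (cases "x \<in> K'")
    case True
    have der: "((\<lambda>t. f (t *\<^sub>R e + x)) has_real_derivative f' (t *\<^sub>R e + x) e) (at t)" for t
    proof -
      have "((\<lambda>t. f (t *\<^sub>R e + x)) has_derivative (\<lambda>r. f' (t *\<^sub>R e + x) (r *\<^sub>R e))) (at t)"
        by (rule has_derivative_compose[where g = f, OF _ f']) (auto intro!: derivative_eq_intros)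
      then show ?thesis
        unfolding has_field_derivative_def
        by (rule has_derivative_eq_rhs)
           (simp add: fun_eq_iff linear_scale[OF has_derivative_linear[OF f']] mult.commute)
    qed
    obtain t where "f (h n *\<^sub>R e + x) - f (0 *\<^sub>R e + x) = (h n - 0) * f' (t *\<^sub>R e + x) e"
      using MVT2[OF h(1)[of n], of "\<lambda>t. f (t *\<^sub>R e + x)" "\<lambda>t. f' (t *\<^sub>R e + x) e"] der by blast
    then have "F n x = f' (t *\<^sub>R e + x) e" unfolding F_def using h(1)[of n] by (simp add: field_simps)
    then show ?thesis using bnd True by simp
  next
    case False
    have "t *\<^sub>R e + x \<notin> K" if "0 \<le> t" "t \<le> 1" for t
    proof
      assume "t *\<^sub>R e + x \<in> K"
      then have "(\<lambda>(x, t). x - t *\<^sub>R e) (t *\<^sub>R e + x, t) \<in> K'" unfolding K'_def using that by (intro imageI) simp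
      then show False using False by simp
    qed
    from this[of "h n"] this[of 0] have "F n x = 0" unfolding F_def using h[of n] supp by simp
    then show ?thesis using False by simp
  qed
  have "continuous_on UNIV (\<lambda>x. f (c + x))" for c
    by (rule continuous_on_compose2[OF contf]) (auto intro!: continuous_intros)
  then have meas: "(\<lambda>x. f (c + x)) \<in> borel_measurable lborel" "f \<in> borel_measurable borel" for c
    using contf by (auto intro!: borel_measurable_continuous_onI)
  have shift: "integrable lborel (\<lambda>x. f (c + x)) \<and> (\<integral>x. f (c + x) \<partial>lborel) = (\<integral>x. f x \<partial>lborel)" for c
  proof -
    have "integrable (distr lborel borel ((+) c)) f" using intf unfolding lborel_distr_plus .
    then have "integrable lborel (\<lambda>x. f (c + x))"
      by (subst (asm) integrable_distr_eq) (auto simp: meas)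
    moreover have "(\<integral>x. f x \<partial>(distr lborel borel ((+) c))) = (\<integral>x. f (c + x) \<partial>lborel)"
      by (subst integral_distr) (auto simp: meas)
    ultimately show ?thesis unfolding lborel_distr_plus by simp
  qed
  have intF: "(\<integral>x. F n x \<partial>lborel) = 0" for n
    unfolding F_def using shift intf by simp
  have "(\<lambda>n. \<integral>x. F n x \<partial>lborel) \<longlonglongrightarrow> (\<integral>x. f' x e \<partial>lborel)"
  proof (rule integral_dominated_convergence[where w = "\<lambda>x. B * indicator K' x"])
    show "(\<lambda>x. f' x e) \<in> borel_measurable lborel" using intf' by simp
    show "F n \<in> borel_measurable lborel" for n unfolding F_def using meas by measurable
    have "emeasure lborel K' < \<infinity>" using emeasure_compact_finite[OF K'] by simp
    then show "integrable lborel (\<lambda>x. B * indicator K' x)"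
      using borel_compact[OF K'] by (intro integrable_mult_right integrable_real_indicator) auto
    show "AE x in lborel. (\<lambda>n. F n x) \<longlonglongrightarrow> f' x e"
    proof (rule AE_I2)
      fix x
      have "((\<lambda>t. f (t *\<^sub>R e + x)) has_derivative (\<lambda>r. f' (0 *\<^sub>R e + x) (r *\<^sub>R e))) (at 0)"
        by (rule has_derivative_compose[where g = f, OF _ f']) (auto intro!: derivative_eq_intros)
      then have "DERIV (\<lambda>t. f (t *\<^sub>R e + x)) 0 :> f' x e"
        unfolding has_field_derivative_def
        by (rule has_derivative_eq_rhs)
           (simp add: fun_eq_iff linear_scale[OF has_derivative_linear[OF f']] mult.commute)
      then have lim: "((\<lambda>t. (f (t *\<^sub>R e + x) - f x) / t) \<longlongrightarrow> f' x e) (at 0)"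
        unfolding DERIV_def by simp
      have "h \<longlonglongrightarrow> 0" unfolding h_def using LIMSEQ_inverse_real_of_nat by (simp add: inverse_eq_divide add.commute)
      then have "filterlim h (at 0) sequentially"
        using less_imp_neq[OF h(1)] by (intro filterlim_atI) (auto intro!: always_eventually)
      from filterlim_compose[OF lim this] show "(\<lambda>n. F n x) \<longlonglongrightarrow> f' x e" unfolding F_def .
    qed
    show "AE x in lborel. norm (F n x) \<le> B * indicator K' x" for n using F_bound by (auto intro: AE_I2)
  qed
  then have "(\<integral>x. f' x e \<partial>lborel) = 0" unfolding intF using LIMSEQ_unique tendsto_const by blast
  then show ?thesis using intf' by simp
qed

lemma continuous_on_extend_zero:
  fixes f :: "'a::metric_space \<Rightarrow> 'b::real_normed_vector"
  assumes "open T" "closed K" "K \<subseteq> T" "continuous_on T f" "\<And>x. x \<in> T - K \<Longrightarrow> f x = 0"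
  shows "continuous_on UNIV (\<lambda>x. if x \<in> T then f x else 0)"
proof -
  let ?f = "\<lambda>x. if x \<in> T then f x else 0"
  have "continuous_on T ?f" using assms(4) by (simp cong: continuous_on_cong)
  moreover have "continuous_on (-K) ?f"
  proof (rule continuous_on_eq[of _ "\<lambda>x. 0"])
    fix x assume "x \<in> - K" then show "0 = ?f x" using assms(5) by auto
  qed simp
  moreover have "open (-K)" using assms(2) by auto
  ultimately have "continuous_on (T \<union> (-K)) ?f" using assms(1) by (intro continuous_on_open_Un)
  moreover have "T \<union> (-K) = UNIV" using assms(3) by blast
  ultimately show ?thesis by simp
qed

lemma integral_divergence_eq_0:
  fixes X :: "real^3 \<Rightarrow> real^3" and DX :: "real^3 \<Rightarrow> real^3^3"
  assumes T: "open T" and K: "compact K" "K \<subseteq> T"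
    and X: "\<And>x. x \<in> T \<Longrightarrow> (X has_derivative (\<lambda>v. DX x *v v)) (at x)"
    and DX: "continuous_on T DX" and supp: "\<And>x. x \<in> T - K \<Longrightarrow> X x = 0"
  shows "integrable lborel (\<lambda>x. if x \<in> T then trace (DX x) else 0)"
    "(\<integral>x. (if x \<in> T then trace (DX x) else 0) \<partial>lborel) = 0"
proof -
  have clK: "closed K" using K(1) compact_imp_closed by blast
  have opK: "open (T - K)" using T clK by blast
  have DX0: "DX x = 0" if x: "x \<in> T - K" for x
  proof -
    have "(\<lambda>v. DX x *v v) = (\<lambda>v. 0)"
      by (rule has_derivative_at_transform_eq[OF X has_derivative_const opK x]) (use x supp in auto)
    then show ?thesis unfolding matrix_eq by (simp add: fun_eq_iff)
  qed
  have comp: "integrable lborel (\<lambda>x. if x \<in> T then DX x $ i $ i else 0) \<and>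
      (\<integral>x. (if x \<in> T then DX x $ i $ i else 0) \<partial>lborel) = 0" for i
  proof -
    define f where "f = (\<lambda>x. if x \<in> T then X x $ i else 0)"
    define f' where "f' = (\<lambda>x v. if x \<in> T then (DX x *v v) $ i else 0)"
    have der: "(f has_derivative f' x) (at x)" for x
    proof (cases "x \<in> T")
      case True
      have "((\<lambda>x. X x $ i) has_derivative (\<lambda>v. (DX x *v v) $ i)) (at x)"
        by (rule has_derivative_compose[where g = "\<lambda>x. x $ i", OF X[OF True]
              bounded_linear_imp_has_derivative[OF bounded_linear_vec_nth]])
      then have "(f has_derivative (\<lambda>v. (DX x *v v) $ i)) (at x)"
        by (rule has_derivative_transform_within_open[OF _ T True]) (simp add: f_def)
      then show ?thesis using True unfolding f'_def by simp
    next
      case False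
      have "(f has_derivative (\<lambda>v. 0)) (at x)"
        by (rule has_derivative_transform_within_open[of "\<lambda>x. 0" _ _ _ "-K"])
          (use clK False K(2) supp in \<open>auto simp: f_def\<close>)
      then show ?thesis using False unfolding f'_def by simp
    qed
    have "continuous_on T (\<lambda>x. (DX x *v axis i 1) $ i)"
      by (intro continuous_on_component continuous_on_matrix_vector_mult DX continuous_on_const)
    then have "continuous_on UNIV (\<lambda>x. if x \<in> T then (DX x *v axis i 1) $ i else 0)"
      by (rule continuous_on_extend_zero[OF T clK K(2)]) (simp add: DX0)
    then have "continuous_on UNIV (\<lambda>x. f' x (axis i 1))" unfolding f'_def .
    then have "integrable lborel (\<lambda>x. f' x (axis i 1)) \<and> (\<integral>x. f' x (axis i 1) \<partial>lborel) = 0"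
      by (rule integral_directional_derivative_eq_0[OF K(1) der]) (use supp in \<open>auto simp: f_def\<close>)
    moreover have "(\<lambda>x. f' x (axis i 1)) = (\<lambda>x. if x \<in> T then DX x $ i $ i else 0)"
      unfolding f'_def by (auto simp: fun_eq_iff matrix_vector_mult_basis column_def)
    ultimately show ?thesis by (simp only:)
  qed
  have eq: "(\<lambda>x. if x \<in> T then trace (DX x) else 0) = (\<lambda>x. \<Sum>i\<in>UNIV. if x \<in> T then DX x $ i $ i else 0)"
    by (auto simp: fun_eq_iff trace_def)
  show "integrable lborel (\<lambda>x. if x \<in> T then trace (DX x) else 0)"
    unfolding eq using comp by (intro Bochner_Integration.integrable_sum) blast
  show "(\<integral>x. (if x \<in> T then trace (DX x) else 0) \<partial>lborel) = 0"
    unfolding eq using comp by (subst Bochner_Integration.integral_sum) auto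
qed

section \<open>Geometry of the tube\<close>

locale tube = surface_in_norm +
  fixes \<delta>0 :: real and s :: "real^3 \<Rightarrow> real" and E :: "real^3 \<Rightarrow> real^3" and D :: "real^3 \<Rightarrow> real^3^3"
  assumes \<delta>0: "\<delta>0 > 0"
    and open_tube: "open {p + t *\<^sub>R \<eta> p |p t. p \<in> M \<and> \<bar>t\<bar> < \<delta>0}"
    and s_tube: "p \<in> M \<Longrightarrow> \<bar>t\<bar> < \<delta>0 \<Longrightarrow> s (p + t *\<^sub>R \<eta> p) = t"
    and E_tube: "p \<in> M \<Longrightarrow> \<bar>t\<bar> < \<delta>0 \<Longrightarrow> E (p + t *\<^sub>R \<eta> p) = \<eta> p"
    and dE_tube: "p \<in> M \<Longrightarrow> \<bar>t\<bar> < \<delta>0 \<Longrightarrow> y = p + t *\<^sub>R \<eta> p \<Longrightarrow> (E has_derivative (\<lambda>v. D y *v v)) (at y)"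
    and ds_tube: "p \<in> M \<Longrightarrow> \<bar>t\<bar> < \<delta>0 \<Longrightarrow> y = p + t *\<^sub>R \<eta> p \<Longrightarrow> (s has_derivative (\<lambda>v. G (E y) \<bullet> v)) (at y)"
    and contD: "continuous_on {p + t *\<^sub>R \<eta> p |p t. p \<in> M \<and> \<bar>t\<bar> < \<delta>0} D"
    and outward: "outward_pointing M \<eta>"
begin

definition slab :: "real set \<Rightarrow> (real^3) set" where
  "slab I = {p + t *\<^sub>R \<eta> p |p t. p \<in> M \<and> t \<in> I}"

definition T where "T = slab {-\<delta>0<..<\<delta>0}"

lemma T_eq: "T = {p + t *\<^sub>R \<eta> p |p t. p \<in> M \<and> \<bar>t\<bar> < \<delta>0}"
proof -
  have "t \<in> {-\<delta>0<..<\<delta>0} \<longleftrightarrow> \<bar>t\<bar> < \<delta>0" for t by auto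
  then show ?thesis unfolding T_def slab_def by simp
qed

lemma open_T: "open T" using open_tube unfolding T_eq .

lemma contD_T: "continuous_on T D" using contD unfolding T_eq .

lemma T_cases:
  assumes "y \<in> T"
  obtains p t where "p \<in> M" "\<bar>t\<bar> < \<delta>0" "y = p + t *\<^sub>R \<eta> p" "s y = t" "E y = \<eta> p"
  using assms s_tube E_tube unfolding T_eq by blast

lemma in_T: "p \<in> M \<Longrightarrow> \<bar>t\<bar> < \<delta>0 \<Longrightarrow> p + t *\<^sub>R \<eta> p \<in> T"
  unfolding T_eq by blast

lemma M_in_T: "M \<subseteq> T" using in_T[of _ 0] \<delta>0 by auto

lemma on_M: "p \<in> M \<Longrightarrow> s p = 0 \<and> E p = \<eta> p"
  using s_tube[of p 0] E_tube[of p 0] \<delta>0 by simp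

lemma s_bound: "y \<in> T \<Longrightarrow> \<bar>s y\<bar> < \<delta>0" by (auto elim: T_cases)

lemma dE: "y \<in> T \<Longrightarrow> (E has_derivative (\<lambda>v. D y *v v)) (at y)"
  using dE_tube unfolding T_eq by blast

lemma ds: "y \<in> T \<Longrightarrow> (s has_derivative (\<lambda>v. G (E y) \<bullet> v)) (at y)"
  using ds_tube unfolding T_eq by blast

lemma continuous_on_E: "continuous_on T E"
  by (rule has_derivative_continuous_on) (use dE has_derivative_at_withinI in blast)

lemma continuous_on_s: "continuous_on T s"
  by (rule has_derivative_continuous_on) (use ds has_derivative_at_withinI in blast)

lemma slab_iff: "I \<subseteq> {-\<delta>0<..<\<delta>0} \<Longrightarrow> y \<in> slab I \<longleftrightarrow> y \<in> T \<and> s y \<in> I"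
  by (auto simp: slab_def T_eq s_tube abs_less_iff subset_iff)
     (metis abs_less_iff minus_less_iff s_tube)+

lemma slab_mono: "I \<subseteq> J \<Longrightarrow> slab I \<subseteq> slab J"
  unfolding slab_def by blast

lemma slab_subset_T: "I \<subseteq> {-\<delta>0<..<\<delta>0} \<Longrightarrow> slab I \<subseteq> T"
  unfolding T_def by (rule slab_mono)

lemma continuous_on_\<eta>: "continuous_on M \<eta>"
  by (rule continuous_on_eq[OF continuous_on_subset[OF continuous_on_E M_in_T]]) (use on_M in auto)

lemma compact_slab: "compact I \<Longrightarrow> compact (slab I)"
proof -
  assume "compact I"
  then have "compact ((\<lambda>z. fst z + snd z *\<^sub>R \<eta> (fst z)) ` (M \<times> I))"
    by (intro compact_continuous_image compact_Times compact_M continuous_intros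
        continuous_on_compose2[OF continuous_on_\<eta>]) auto
  moreover have "(\<lambda>z. fst z + snd z *\<^sub>R \<eta> (fst z)) ` (M \<times> I) = slab I" unfolding slab_def by force
  ultimately show ?thesis by simp
qed

lemma open_slab: "open I \<Longrightarrow> I \<subseteq> {-\<delta>0<..<\<delta>0} \<Longrightarrow> open (slab I)"
proof -
  assume I: "open I" "I \<subseteq> {-\<delta>0<..<\<delta>0}"
  have "slab I = T \<inter> s -` I" using slab_iff[OF I(2)] by blast
  then show ?thesis using continuous_open_preimage[OF continuous_on_s open_T I(1)] by simp
qed

lemma foot: "y \<in> T \<Longrightarrow> y - s y *\<^sub>R E y \<in> M \<and> \<eta> (y - s y *\<^sub>R E y) = E y"
  by (auto elim!: T_cases)

lemma N_E: "y \<in> T \<Longrightarrow> N (E y) = 1"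
  by (auto elim!: T_cases simp: N_\<eta>)

lemma E_nonzero: "y \<in> T \<Longrightarrow> E y \<noteq> 0"
  using N_E by force

lemma G_E_E: "y \<in> T \<Longrightarrow> G (E y) \<bullet> E y = 1"
  using G_self[OF E_nonzero] N_E by simp

lemma dGE: assumes "y \<in> T" shows "((\<lambda>y. G (E y)) has_derivative (\<lambda>v. H (E y) *v (D y *v v))) (at y)"
  by (rule has_derivative_compose[where g = G, OF dE[OF assms] dG[OF E_nonzero[OF assms]]])

lemma G_D: assumes y: "y \<in> T" shows "G (E y) \<bullet> (D y *v v) = 0"
proof -
  have "((\<lambda>y. N (E y)) has_derivative (\<lambda>v. G (E y) \<bullet> (D y *v v))) (at y)"
    by (rule has_derivative_compose[where g = N, OF dE[OF y] dN[OF E_nonzero[OF y]]])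
  then have "(\<lambda>v. G (E y) \<bullet> (D y *v v)) = (\<lambda>v. 0)"
    by (rule has_derivative_at_transform_eq[OF _ has_derivative_const open_T y]) (rule N_E)
  then show ?thesis by meson
qed

lemma D_E: assumes y: "y \<in> T" shows "D y *v E y = 0"
proof -
  obtain p t where p: "p \<in> M" "\<bar>t\<bar> < \<delta>0" "y = p + t *\<^sub>R \<eta> p" "E y = \<eta> p" using y by (rule T_cases)
  have "((\<lambda>r. E (p + r *\<^sub>R \<eta> p)) has_derivative (\<lambda>r. D (p + t *\<^sub>R \<eta> p) *v (r *\<^sub>R \<eta> p))) (at t)"
    by (rule has_derivative_compose[where g = E])
      (use dE[OF y] p in \<open>auto intro!: derivative_eq_intros\<close>)
  then have "(\<lambda>r. D (p + t *\<^sub>R \<eta> p) *v (r *\<^sub>R \<eta> p)) = (\<lambda>r. 0)"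
  proof (rule has_derivative_at_transform_eq[OF _ has_derivative_const])
    show "open {-\<delta>0<..<\<delta>0}" "t \<in> {-\<delta>0<..<\<delta>0}" using p(2) by auto
    show "E (p + r *\<^sub>R \<eta> p) = \<eta> p" if "r \<in> {-\<delta>0<..<\<delta>0}" for r using E_tube[OF p(1)] that by auto
  qed
  from fun_cong[OF this, of 1] show ?thesis using p by simp
qed

text \<open>By \<open>ds\<close> the field \<open>G (E y)\<close> is the gradient of s, so
  \<open>H (E y)\<close> composed with \<open>D y\<close> is the Hessian of s.\<close>

lemma HD_symmetric: assumes y: "y \<in> T" shows "(H (E y) *v (D y *v u)) \<bullet> v = (H (E y) *v (D y *v v)) \<bullet> u"
  by (rule second_derivative_symmetric[OF open_T y ds dGE[OF y]])

text \<open>The hypothesis allows the range of t to depend on p. Since s is nonzero on the open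
  segment over p, the segment avoids M and lies in one component of the complement, which gives the
  uniform range.\<close>

lemma plus_side: assumes p: "p \<in> M" and t: "0 < t" "t < \<delta>0" shows "p + t *\<^sub>R \<eta> p \<in> outside M"
proof -
  have "\<forall>\<^sub>F t in at_right 0. p + t *\<^sub>R \<eta> p \<in> outside M" using outward p unfolding outward_pointing_def by blast
  then obtain b where b: "b > 0" "\<And>t. 0 < t \<Longrightarrow> t < b \<Longrightarrow> p + t *\<^sub>R \<eta> p \<in> outside M"
    unfolding eventually_at_right_field by auto
  define t0 where "t0 = min (b / 2) (\<delta>0 / 2)"
  have t0: "0 < t0" "t0 < b" "t0 < \<delta>0" unfolding t0_def using b(1) \<delta>0 by auto
  let ?C = "(\<lambda>t. p + t *\<^sub>R \<eta> p) ` {0<..<\<delta>0}"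
  have "connected ?C" by (intro connected_continuous_image continuous_intros) auto
  moreover have "?C \<subseteq> - M"
  proof
    fix y assume "y \<in> ?C"
    then obtain r where r: "0 < r" "r < \<delta>0" "y = p + r *\<^sub>R \<eta> p" by auto
    then show "y \<in> - M" using s_tube[OF p, of r] on_M[of y] by auto
  qed
  moreover have "p + t0 *\<^sub>R \<eta> p \<in> ?C" "p + t *\<^sub>R \<eta> p \<in> ?C" using t t0 by auto
  ultimately have "connected_component (-M) (p + t0 *\<^sub>R \<eta> p) (p + t *\<^sub>R \<eta> p)"
    unfolding connected_component_def by blast
  then show ?thesis using b(2)[OF t0(1,2)] outside_same_component by blast
qed

lemma notin_M: "p \<in> M \<Longrightarrow> \<bar>t\<bar> < \<delta>0 \<Longrightarrow> t \<noteq> 0 \<Longrightarrow> p + t *\<^sub>R \<eta> p \<notin> M"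
  using s_tube[of p t] on_M[of "p + t *\<^sub>R \<eta> p"] by auto

text \<open>The circle-valued function that winds once around the circle while crossing the tube has a
  logarithm on the whole space. If both sides of the tube belonged to the same connected open set,
  the logarithm would contradict the jump of the winding across M.\<close>

lemma minus_side: assumes p: "p \<in> M" and t: "0 < t" "t < \<delta>0" shows "p - t *\<^sub>R \<eta> p \<in> inside M"
proof (rule ccontr)
  assume notin: "p - t *\<^sub>R \<eta> p \<notin> inside M"
  have "p - t *\<^sub>R \<eta> p \<notin> M" using notin_M[OF p, of "-t"] t by simp
  then have out: "p - t *\<^sub>R \<eta> p \<in> outside M" using notin inside_Un_outside[of M] by blast
  have out_all: "p - r *\<^sub>R \<eta> p \<in> outside M" if r: "0 < r" "r < \<delta>0" for r
  proof -
    let ?C = "(\<lambda>t. p - t *\<^sub>R \<eta> p) ` {0<..<\<delta>0}"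
    have "connected ?C" by (intro connected_continuous_image continuous_intros) auto
    moreover have "?C \<subseteq> - M"
    proof
      fix y assume "y \<in> ?C"
      then obtain r where r: "0 < r" "r < \<delta>0" "y = p + (-r) *\<^sub>R \<eta> p" by auto
      then show "y \<in> - M" using notin_M[OF p, of "-r"] by auto
    qed
    moreover have "p - t *\<^sub>R \<eta> p \<in> ?C" "p - r *\<^sub>R \<eta> p \<in> ?C" using t r by auto
    ultimately have "connected_component (-M) (p - t *\<^sub>R \<eta> p) (p - r *\<^sub>R \<eta> p)"
      unfolding connected_component_def by blast
    then show ?thesis using out outside_same_component by blast
  qed
  \<comment> \<open>The height rescaled by \<delta>0 and clamped to [-1/2, 1/2]; it is constant on
    each side for heights beyond \<delta>0 / 2.\<close>
  define cl where "cl = (\<lambda>t. max (-1/2) (min (1/2) (t / \<delta>0)))"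
  have cl_cont: "continuous_on S cl" for S unfolding cl_def using \<delta>0 by (intro continuous_intros) auto
  have clp: "cl r = 1/2" if "r \<ge> \<delta>0 / 2" for r using that \<delta>0 unfolding cl_def by (auto simp: field_simps)
  have clm: "cl r = -1/2" if "r \<le> - \<delta>0 / 2" for r using that \<delta>0 unfolding cl_def by (auto simp: field_simps)
  let ?K = "slab {-\<delta>0/2..\<delta>0/2}"
  have sub: "{-\<delta>0/2..\<delta>0/2} \<subseteq> {-\<delta>0<..<\<delta>0}" using \<delta>0 by (auto simp: field_simps)
  have KT: "?K \<subseteq> T" by (rule slab_subset_T[OF sub])
  have clK: "closed ?K" by (intro compact_imp_closed compact_slab) simp
  have s_out: "s x \<ge> \<delta>0/2 \<or> s x \<le> -\<delta>0/2" if "x \<in> T - ?K" for x using that slab_iff[OF sub, of x] by auto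
  \<comment> \<open>A loop with value 1 at both ends of [-1/2, 1/2], so \<open>w (cl (s x))\<close>
    extends by 1 to the whole space.\<close>
  define w where "w = (\<lambda>c. - exp (complex_of_real (- 2 * pi * c) * \<i>))"
  have w_half: "w (1/2) = 1" "w (-1/2) = 1"
    unfolding w_def by (simp_all add: exp_minus)
  define F where "F = (\<lambda>x. if x \<in> T then w (cl (s x)) - 1 else 0)"
  have "continuous_on UNIV F" unfolding F_def
  proof (rule continuous_on_extend_zero[OF open_T clK KT])
    show "continuous_on T (\<lambda>x. w (cl (s x)) - 1)"
      unfolding w_def using continuous_on_compose2[OF cl_cont continuous_on_s]
      by (intro continuous_intros) auto
    show "w (cl (s x)) - 1 = 0" if "x \<in> T - ?K" for x
      using s_out[OF that] clp[of "s x"] clm[of "s x"] w_half by (metis diff_self)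
  qed
  then have "continuous_on UNIV (\<lambda>x. F x + 1)" by (intro continuous_intros)
  moreover have "F x + 1 \<noteq> 0" for x unfolding F_def w_def by simp
  ultimately obtain g where g: "continuous_on UNIV g" "\<And>x. x \<in> UNIV \<Longrightarrow> F x + 1 = exp (g x)"
    using continuous_logarithm_on_contractible[OF _ contractible_UNIV, of "\<lambda>x. F x + 1"] by metis
  \<comment> \<open>2\<pi>h is an argument of the same circle-valued function off M. It vanishes for
    large heights and jumps from -1/2 to 1/2 across M.\<close>
  define h where "h = (\<lambda>x. if x \<in> T then (if s x > 0 then 1/2 - cl (s x) else -1/2 - cl (s x)) else 0)"
  have h_zero: "h x = 0" if "x \<in> T - ?K" for x
    using s_out[OF that]
  proof
    assume "s x \<ge> \<delta>0/2"
    then show ?thesis using clp[of "s x"] \<delta>0 unfolding h_def by simp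
  next
    assume "s x \<le> -\<delta>0/2"
    then show ?thesis using clm[of "s x"] \<delta>0 unfolding h_def by simp
  qed
  have "continuous_on (T - M) h"
  proof -
    have eq: "T - M = (T \<inter> s -` {0<..}) \<union> (T \<inter> s -` {..<0})"
    proof -
      have "s x \<noteq> 0" if "x \<in> T - M" for x using foot[of x] that by auto
      moreover have "x \<notin> M" if "s x \<noteq> 0" for x using on_M that by auto
      ultimately show ?thesis by (auto simp: not_less) (metis order_le_less)
    qed
    have o: "open (T \<inter> s -` {0<..})" "open (T \<inter> s -` {..<0})"
      by (auto intro: continuous_open_preimage[OF continuous_on_s open_T])
    have c: "continuous_on (T \<inter> A) (\<lambda>x. c - cl (s x))" for A c
      by (intro continuous_intros continuous_on_compose2[OF cl_cont continuous_on_subset[OF continuous_on_s]]) auto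
    have "continuous_on (T \<inter> s -` {0<..}) h"
      by (rule continuous_on_eq[OF c[of _ "1/2"]]) (auto simp: h_def)
    moreover have "continuous_on (T \<inter> s -` {..<0}) h"
      by (rule continuous_on_eq[OF c[of _ "-1/2"]]) (auto simp: h_def)
    ultimately show ?thesis unfolding eq using o by (intro continuous_on_open_Un)
  qed
  moreover have "continuous_on (-?K) h"
    by (rule continuous_on_eq[of _ "\<lambda>x. 0"]) (use h_zero in \<open>auto simp: h_def\<close>)
  moreover have "open (T - M)" "open (-?K)" using open_T compact_imp_closed[OF compact_M] clK by auto
  ultimately have "continuous_on ((T - M) \<union> - ?K) h" by (intro continuous_on_open_Un)
  moreover have "outside M \<subseteq> (T - M) \<union> - ?K" using KT outside_no_overlap[of M] by blast
  ultimately have conth: "continuous_on (outside M) h" by (rule continuous_on_subset)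
  \<comment> \<open>Two logarithms of one function differ by k, whose values are integer multiples
    of 2\<pi>i; by continuity k is constant on the connected set \<open>outside M\<close>.\<close>
  define k where "k = (\<lambda>x. g x - complex_of_real (2 * pi * h x) * \<i>)"
  have contk: "continuous_on (outside M) k"
    unfolding k_def using continuous_on_subset[OF g(1)] conth by (intro continuous_intros) auto
  have wc: "exp (complex_of_real (2 * pi * (1/2 - c)) * \<i>) = w c"
    "exp (complex_of_real (2 * pi * (-1/2 - c)) * \<i>) = w c" for c
  proof -
    have eq: "complex_of_real (2 * pi * (1/2 - c)) * \<i> = pi * \<i> + complex_of_real (- 2 * pi * c) * \<i>"
      "complex_of_real (2 * pi * (-1/2 - c)) * \<i> = - (pi * \<i>) + complex_of_real (- 2 * pi * c) * \<i>"
      by (simp_all add: algebra_simps)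
    show "exp (complex_of_real (2 * pi * (1/2 - c)) * \<i>) = w c"
      unfolding w_def eq exp_add by (simp add: exp_pi_i)
    show "exp (complex_of_real (2 * pi * (-1/2 - c)) * \<i>) = w c"
      unfolding w_def eq exp_add by (simp add: exp_minus exp_pi_i)
  qed
  have expk: "exp (k x) = 1" for x
  proof -
    have "exp (complex_of_real (2 * pi * h x) * \<i>) = F x + 1"
      using wc[of "cl (s x)"] unfolding h_def F_def by auto
    then show ?thesis unfolding k_def using g(2)[of x] by (simp add: exp_diff)
  qed
  have "k constant_on outside M"
  proof (rule continuous_discrete_range_constant[OF _ contk])
    show "connected (outside M)" by (rule connected_outside) (use compact_M compact_imp_bounded in auto)
    fix x
    have "2 * pi \<le> norm (k y - k x)" if "k y \<noteq> k x" for y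
    proof -
      have "exp (k y) = exp (k x)" unfolding expk ..
      then obtain n where n: "k y = k x + of_int (2 * n) * pi * \<i>" unfolding exp_eq by auto
      then have "n \<noteq> 0" using that by auto
      then have "1 \<le> \<bar>real_of_int n\<bar>" by (metis of_int_abs of_int_1_le_iff zero_less_abs_iff zless_imp_add1_zle add_0)
      moreover have "norm (k y - k x) = \<bar>real_of_int n\<bar> * (2 * pi)" unfolding n by (simp add: norm_mult)
      ultimately show ?thesis using pi_gt_zero by (simp add: mult_le_cancel_right)
    qed
    then show "\<exists>e>0. \<forall>y. y \<in> outside M \<and> k y \<noteq> k x \<longrightarrow> e \<le> norm (k y - k x)"
      by (intro exI[of _ "2 * pi"]) auto
  qed
  then obtain c where c: "\<And>x. x \<in> outside M \<Longrightarrow> k x = c" unfolding constant_on_def by blast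
  \<comment> \<open>Both points lie in \<open>outside M\<close> and share the value of k, so g must
    absorb the difference of h. As r tends to 0 this difference tends to 1, contrary to continuity
    of g at p.\<close>
  have jump: "g (p + r *\<^sub>R \<eta> p) - g (p - r *\<^sub>R \<eta> p) = complex_of_real (2 * pi * (1 - 2 * (r / \<delta>0))) * \<i>"
    if r: "0 < r" "r < \<delta>0 / 2" for r
  proof -
    have r': "r < \<delta>0" using r by auto
    have "s (p + r *\<^sub>R \<eta> p) = r" "s (p + (-r) *\<^sub>R \<eta> p) = - r" using s_tube[OF p, of r] s_tube[OF p, of "-r"] r by auto
    moreover have "p + r *\<^sub>R \<eta> p \<in> T" "p + (-r) *\<^sub>R \<eta> p \<in> T" using in_T[OF p, of r] in_T[OF p, of "-r"] r by auto
    moreover have "cl r = r / \<delta>0" "cl (-r) = - (r / \<delta>0)" using r \<delta>0 unfolding cl_def by (auto simp: field_simps)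
    ultimately have h: "h (p + r *\<^sub>R \<eta> p) = 1/2 - r / \<delta>0" "h (p - r *\<^sub>R \<eta> p) = -1/2 + r / \<delta>0"
      using r unfolding h_def by auto
    have "k (p + r *\<^sub>R \<eta> p) = k (p - r *\<^sub>R \<eta> p)"
      using c plus_side[OF p r(1) r'] out_all[OF r(1) r'] by simp
    then show ?thesis unfolding k_def h by (simp add: algebra_simps)
  qed
  have cg: "isCont g x" for x using g(1) by (simp add: continuous_on_eq_continuous_at)
  have "((\<lambda>r. g (p + r *\<^sub>R \<eta> p) - g (p - r *\<^sub>R \<eta> p)) \<longlongrightarrow> g (p + 0 *\<^sub>R \<eta> p) - g (p - 0 *\<^sub>R \<eta> p)) (at_right 0)"
    by (intro tendsto_diff isCont_tendsto_compose[OF cg] tendsto_intros)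
  moreover have "\<forall>\<^sub>F r in at_right 0. g (p + r *\<^sub>R \<eta> p) - g (p - r *\<^sub>R \<eta> p) = complex_of_real (2 * pi * (1 - 2 * (r / \<delta>0))) * \<i>"
    unfolding eventually_at_right_field using jump \<delta>0 by (intro exI[of _ "\<delta>0 / 2"]) auto
  ultimately have "((\<lambda>r. complex_of_real (2 * pi * (1 - 2 * (r / \<delta>0))) * \<i>) \<longlongrightarrow> 0) (at_right 0)"
    using tendsto_cong[of "\<lambda>r. g (p + r *\<^sub>R \<eta> p) - g (p - r *\<^sub>R \<eta> p)"] by simp
  moreover have "((\<lambda>r. complex_of_real (2 * pi * (1 - 2 * (r / \<delta>0))) * \<i>) \<longlongrightarrow> complex_of_real (2 * pi * (1 - 2 * (0 / \<delta>0))) * \<i>) (at_right 0)"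
    using \<delta>0 by (intro tendsto_intros) auto
  ultimately have "complex_of_real (2 * pi * (1 - 2 * (0 / \<delta>0))) * \<i> = 0"
    using tendsto_unique[OF trivial_limit_at_right_real] by blast
  then show False by simp
qed

end

section \<open>Cut-off functions\<close>

lemma has_real_derivative_max_square: "((\<lambda>t. (max 0 t)\<^sup>2) has_real_derivative 2 * max 0 t) (at (t::real))"
proof -
  consider "t < 0" | "t > 0" | "t = 0" by linarith
  then show ?thesis
  proof cases
    case 1
    have "((\<lambda>t. 0) has_real_derivative 2 * max 0 t) (at t)" using 1 by simp
    then show ?thesis by (rule DERIV_cong_ev[THEN iffD1, rotated 3])
      (use 1 eventually_nhds_in_open[of "{..<0}" t] in \<open>auto elim!: eventually_mono\<close>)
  next
    case 2
    have "((\<lambda>t. t\<^sup>2) has_real_derivative 2 * max 0 t) (at t)" using 2 by (auto intro!: derivative_eq_intros)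
    then show ?thesis by (rule DERIV_cong_ev[THEN iffD1, rotated 3])
      (use 2 eventually_nhds_in_open[of "{0<..}" t] in \<open>auto elim!: eventually_mono\<close>)
  next
    case 3
    have "((\<lambda>h. max 0 h) \<longlongrightarrow> max 0 0) (at (0::real))" by (intro tendsto_intros)
    then have "((\<lambda>h. max 0 h) \<longlongrightarrow> 0) (at (0::real))" by simp
    then have "((\<lambda>h. ((max 0 (0 + h))\<^sup>2 - (max 0 0)\<^sup>2) / h) \<longlongrightarrow> 0) (at (0::real))"
      by (rule Lim_transform_eventually) (auto simp: eventually_at_filter power2_eq_square max_def)
    then show ?thesis unfolding 3 DERIV_def by simp
  qed
qed

text \<open>Squares of positive parts make this step continuously differentiable at 0 and at 1, the
  regularity that the divergence argument asks of a cut-off.\<close>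

definition smoothstep :: "real \<Rightarrow> real" where "smoothstep t = 1 - (max 0 (1 - (max 0 t)\<^sup>2))\<^sup>2"

lemma smoothstep_eq_0: "t \<le> 0 \<Longrightarrow> smoothstep t = 0" by (simp add: smoothstep_def)

lemma smoothstep_eq_1: assumes "t \<ge> 1" shows "smoothstep t = 1"
proof -
  have "(max 0 t)\<^sup>2 \<ge> 1" using assms by (simp add: one_le_power)
  then show ?thesis by (simp add: smoothstep_def)
qed

lemma smoothstep_range: "0 \<le> smoothstep t" "smoothstep t \<le> 1"
proof -
  have "max 0 (1 - (max 0 t)\<^sup>2) \<le> 1" by simp
  then have "(max 0 (1 - (max 0 t)\<^sup>2))\<^sup>2 \<le> 1" by (intro power_le_one) auto
  then show "0 \<le> smoothstep t" by (simp add: smoothstep_def)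
  show "smoothstep t \<le> 1" by (simp add: smoothstep_def)
qed

lemma smoothstep_derivative:
  "(smoothstep has_real_derivative 4 * max 0 (1 - (max 0 t)\<^sup>2) * max 0 t) (at t)"
proof -
  have "((\<lambda>t. 1 - (max 0 t)\<^sup>2) has_real_derivative 0 - 2 * max 0 t) (at t)"
    by (intro DERIV_diff DERIV_const has_real_derivative_max_square)
  from DERIV_chain2[OF has_real_derivative_max_square this]
  have "((\<lambda>t. (max 0 (1 - (max 0 t)\<^sup>2))\<^sup>2) has_real_derivative
      2 * max 0 (1 - (max 0 t)\<^sup>2) * (0 - 2 * max 0 t)) (at t)" .
  from DERIV_diff[OF DERIV_const[of 1] this] show ?thesis
    unfolding smoothstep_def[abs_def] by (simp add: algebra_simps)
qed

text \<open>A plateau of length h between two ramps of width a. The support lies in t \<le> 0, so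
  the fields built from g live on the inner side of M.\<close>

lemma cutoff_exists:
  assumes "a > 0" "h > (0::real)"
  obtains g g' where "\<forall>t. (g has_real_derivative g' t) (at t)" "continuous_on UNIV g'"
    "\<forall>t. 0 \<le> g t \<and> g t \<le> 1" "\<forall>t\<in>{-h-a..-a}. g t = 1" "\<forall>t. t \<le> -(h + 2*a) \<or> t \<ge> 0 \<longrightarrow> g t = 0"
proof -
  define s' where "s' = (\<lambda>t::real. 4 * max 0 (1 - (max 0 t)\<^sup>2) * max 0 t)"
  define g where "g = (\<lambda>t. smoothstep ((t + h + 2*a) / a) * smoothstep (- t / a))"
  define g' where "g' = (\<lambda>t. smoothstep ((t + h + 2*a) / a) * (s' (- t / a) * (- 1 / a)) +
      (s' ((t + h + 2*a) / a) * (1 / a)) * smoothstep (- t / a))"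
  have d: "(smoothstep has_real_derivative s' t) (at t)" for t unfolding s'_def by (rule smoothstep_derivative)
  have c1: "continuous_on UNIV smoothstep"
    using d by (meson DERIV_continuous continuous_at_imp_continuous_on)
  have c2: "continuous_on UNIV s'" unfolding s'_def by (intro continuous_intros)
  have "(g has_real_derivative g' t) (at t)" for t
  proof -
    have 1: "((\<lambda>t. (t + h + 2*a) / a) has_real_derivative 1 / a) (at t)"
      and 2: "((\<lambda>t. - t / a) has_real_derivative - 1 / a) (at t)"
      using assms by (auto intro!: derivative_eq_intros)
    show ?thesis
      using DERIV_mult'[OF DERIV_chain2[OF d 1] DERIV_chain2[OF d 2]] unfolding g_def g'_def .
  qed
  moreover have "continuous_on UNIV g'"
    unfolding g'_def using assms
    by (intro continuous_intros continuous_on_compose2[OF c1] continuous_on_compose2[OF c2]) auto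
  moreover have "\<forall>t. 0 \<le> g t \<and> g t \<le> 1" unfolding g_def using smoothstep_range
    by (simp add: mult_le_one)
  moreover have "\<forall>t\<in>{-h-a..-a}. g t = 1"
    unfolding g_def using assms by (auto simp: smoothstep_eq_1 field_simps)
  moreover have "g t = 0" if t: "t \<le> -(h + 2*a) \<or> t \<ge> 0" for t
    using t
  proof
    assume "t \<le> -(h + 2*a)"
    then have "(t + h + 2*a) / a \<le> 0" using assms by (intro divide_nonpos_nonneg) auto
    then show ?thesis unfolding g_def by (simp add: smoothstep_eq_0)
  next
    assume "t \<ge> 0"
    then have "- t / a \<le> 0" using assms by (intro divide_nonpos_nonneg) auto
    then show ?thesis unfolding g_def by (simp add: smoothstep_eq_0)
  qed
  ultimately show ?thesis using that by blast
qed

section \<open>Traces as sums over the standard basis\<close>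

lemma trace_matrix: "trace (matrix f) = (\<Sum>b\<in>Basis. f b \<bullet> (b :: real^'n))"
proof -
  have B: "(Basis :: (real^'n) set) = (\<lambda>i. axis i 1) ` UNIV" by (auto simp: Basis_vec_def)
  have "inj (\<lambda>i. axis i 1 :: real^'n)" by (auto simp: inj_on_def axis_eq_axis)
  then show ?thesis unfolding B by (simp add: sum.reindex trace_def matrix_def inner_axis)
qed

lemma trace_rank_one:
  fixes l :: "'a::euclidean_space \<Rightarrow> real"
  assumes "linear l" shows "(\<Sum>b\<in>Basis. (l b *\<^sub>R w) \<bullet> b) = l w"
proof -
  have "l w = l (\<Sum>b\<in>Basis. (w \<bullet> b) *\<^sub>R b)" by (simp add: euclidean_representation)
  then show ?thesis by (simp add: linear_sum[OF assms] linear_scale[OF assms] mult.commute)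
qed

section \<open>The Minkowski formula\<close>

context tube
begin

lemma continuous_on_GE: "continuous_on T (\<lambda>x. G (E x))"
  by (rule continuous_on_compose2[OF continuous_on_G continuous_on_E]) (use E_nonzero in auto)

lemma continuous_on_HE: "continuous_on T (\<lambda>x. H (E x))"
  by (rule continuous_on_compose2[OF contH continuous_on_E]) (use E_nonzero in auto)

lemma continuous_on_trace_D: "continuous_on T (\<lambda>x. trace (D x))"
  unfolding trace_def by (intro continuous_intros contD_T)

lemma continuous_on_profile: "continuous_on UNIV (g :: real \<Rightarrow> real) \<Longrightarrow> continuous_on T (\<lambda>x. g (s x))"
  by (rule continuous_on_compose2[OF _ continuous_on_s]) auto

text \<open>The integrand is the divergence of \<open>g(s) (x - (x \<bullet> G(E)) E)\<close>.\<close>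

lemma integral_tangential_field:
  assumes b: "0 < b" "b < \<delta>0" and g': "\<And>t. (g has_real_derivative g' t) (at t)"
    and contg': "continuous_on UNIV g'" and supp: "\<And>t. t \<le> -b \<or> t \<ge> 0 \<Longrightarrow> g t = 0"
  shows "(\<integral>x. (if x \<in> T then g (s x) * (2 - (x \<bullet> G (E x)) * trace (D x)) else 0) \<partial>lborel) = 0"
proof -
  have contg: "continuous_on UNIV g" using g' by (meson DERIV_continuous continuous_at_imp_continuous_on)
  let ?\<nu> = "\<lambda>x. G (E x)"
  define X where "X = (\<lambda>x. g (s x) *\<^sub>R (x - (x \<bullet> ?\<nu> x) *\<^sub>R E x))"
  define L where "L = (\<lambda>x v. g (s x) *\<^sub>R (v - ((x \<bullet> ?\<nu> x) *\<^sub>R (D x *v v) + (x \<bullet> (H (E x) *v (D x *v v)) + v \<bullet> ?\<nu> x) *\<^sub>R E x))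
      + ((?\<nu> x \<bullet> v) * g' (s x)) *\<^sub>R (x - (x \<bullet> ?\<nu> x) *\<^sub>R E x))"
  define DX where "DX = (\<lambda>x. matrix (L x))"
  have derX: "(X has_derivative L x) (at x)" if x: "x \<in> T" for x
  proof -
    have gs: "((\<lambda>x. g (s x)) has_derivative (\<lambda>v. (?\<nu> x \<bullet> v) * g' (s x))) (at x)"
      using has_derivative_compose[OF ds[OF x] g'[unfolded has_field_derivative_def]] by (simp add: mult.commute)
    show ?thesis unfolding X_def L_def
      by (rule has_derivative_scaleR[OF gs has_derivative_diff[OF has_derivative_ident
            has_derivative_scaleR[OF has_derivative_inner[OF has_derivative_ident dGE[OF x]] dE[OF x]]]])
  qed
  have DXL: "DX x *v v = L x v" if "x \<in> T" for x v
    using fun_cong[OF matrix_vector_mul(2)[OF has_derivative_linear[OF derX[OF that]]], of v] unfolding DX_def .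
  have "continuous_on T (\<lambda>x. L x v)" for v
    unfolding L_def
    by (intro continuous_intros continuous_on_profile contg contg' continuous_on_GE continuous_on_E
        continuous_on_matrix_vector_mult continuous_on_HE contD_T)
  then have contDX: "continuous_on T DX" by (intro continuous_on_matrixI) (simp add: DXL cong: continuous_on_cong)
  have sub: "{-b..0} \<subseteq> {-\<delta>0<..<\<delta>0}" using b by auto
  have tr: "trace (DX x) = g (s x) * (2 - (x \<bullet> G (E x)) * trace (D x))" if x: "x \<in> T" for x
  proof -
    have lin: "linear (\<lambda>v. x \<bullet> (H (E x) *v (D x *v v)) + v \<bullet> ?\<nu> x)"
      by (intro linearI) (simp_all add: matrix_vector_right_distrib matrix_vector_mult_scaleR inner_add_right inner_add_left algebra_simps)
    have lin2: "linear (\<lambda>v. (?\<nu> x \<bullet> v) * g' (s x))"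
      by (intro linearI) (simp_all add: inner_add_right algebra_simps)
    have trD: "(\<Sum>b\<in>Basis. (D x *v b) \<bullet> b) = trace (D x)"
      using trace_matrix[of "(*v) (D x)"] by simp
    have "trace (DX x) = (\<Sum>b\<in>Basis. L x b \<bullet> b)" unfolding DX_def by (rule trace_matrix)
    also have "\<dots> = g (s x) * ((\<Sum>b::real^3\<in>Basis. b \<bullet> b) - ((x \<bullet> ?\<nu> x) * (\<Sum>b\<in>Basis. (D x *v b) \<bullet> b) +
        (\<Sum>b\<in>Basis. ((x \<bullet> (H (E x) *v (D x *v b)) + b \<bullet> ?\<nu> x) *\<^sub>R E x) \<bullet> b)))
        + (\<Sum>b\<in>Basis. (((?\<nu> x \<bullet> b) * g' (s x)) *\<^sub>R (x - (x \<bullet> ?\<nu> x) *\<^sub>R E x)) \<bullet> b)"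
      unfolding L_def
      by (simp only: inner_add_left inner_diff_left inner_scaleR_left sum.distrib sum_subtractf sum_distrib_left[symmetric])
    also have "\<dots> = g (s x) * (3 - ((x \<bullet> ?\<nu> x) * trace (D x) + (x \<bullet> (H (E x) *v (D x *v E x)) + E x \<bullet> ?\<nu> x)))
        + (?\<nu> x \<bullet> (x - (x \<bullet> ?\<nu> x) *\<^sub>R E x)) * g' (s x)"
      unfolding trace_rank_one[OF lin] trace_rank_one[OF lin2] trD by simp
    \<comment> \<open>E annihilates under D and has \<open>G (E x)\<close>-value 1, so the
      derivative of the coefficient of E contributes exactly 1. The term with g' drops out because
      the field is tangent to the level sets of s.\<close>
    also have "\<dots> = g (s x) * (2 - (x \<bullet> G (E x)) * trace (D x))"
      using G_E_E[OF x] D_E[OF x] by (simp add: inner_diff_right inner_commute algebra_simps)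
    finally show ?thesis .
  qed
  have "(\<integral>x. (if x \<in> T then trace (DX x) else 0) \<partial>lborel) = 0"
  proof (rule integral_divergence_eq_0(2)[OF open_T compact_slab[of "{-b..0}"] slab_subset_T[OF sub] _ contDX])
    show "(X has_derivative (\<lambda>v. DX x *v v)) (at x)" if "x \<in> T" for x using derX[OF that] DXL[OF that] by simp
    show "X x = 0" if "x \<in> T - slab {-b..0}" for x
      using that slab_iff[OF sub, of x] supp[of "s x"] unfolding X_def by auto
  qed simp
  then show ?thesis using tr by (simp cong: if_cong)
qed

section \<open>The enclosed region and the position field\<close>

lemma inside_T: assumes "x \<in> T" shows "x \<in> inside M \<longleftrightarrow> s x < 0"
proof -
  obtain p t where p: "p \<in> M" "\<bar>t\<bar> < \<delta>0" "x = p + t *\<^sub>R \<eta> p" "s x = t" using assms by (rule T_cases)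
  consider "t < 0" | "t = 0" | "t > 0" by linarith
  then show ?thesis
  proof cases
    case 1 then show ?thesis using minus_side[OF p(1), of "-t"] p by simp
  next
    case 2
    then have "x \<in> M" "s x = 0" using p by simp_all
    then show ?thesis using inside_no_overlap[of M] by (metis IntI empty_iff less_irrefl)
  next
    case 3
    then have "x \<in> outside M" "\<not> s x < 0" using plus_side[OF p(1), of t] p by auto
    then show ?thesis using inside_Int_outside[of M] by (metis IntI empty_iff)
  qed
qed

lemma compact_inside_Un: "compact (inside M \<union> M)"
proof -
  have cl: "closed M" and bd: "bounded M" using compact_M compact_imp_closed compact_imp_bounded by auto
  have "inside M \<union> M = - outside M" by (simp add: inside_outside Un_commute) (use outside_no_overlap[of M] in blast)
  then have "closed (inside M \<union> M)" using closed_Compl[OF open_outside[OF cl]] by simp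
  then show ?thesis using bounded_inside[OF bd] bd by (simp add: compact_eq_bounded_closed)
qed

text \<open>The integral I is that of the function equal to \<open>\<Gamma>(s)\<close> on the tube and to K deeper inside M; the
  formula says that the divergence of its product with the position field has integral 0.\<close>

lemma integral_position_field:
  assumes b: "0 < b" "b < \<delta>0" and \<Gamma>': "\<And>t. \<bar>t\<bar> < \<delta>0 \<Longrightarrow> (\<Gamma> has_real_derivative - g t) (at t)"
    and contg: "continuous_on UNIV g"
    and \<Gamma>_deep: "\<And>t. -\<delta>0 < t \<Longrightarrow> t \<le> -b \<Longrightarrow> \<Gamma> t = K" and \<Gamma>_out: "\<And>t. 0 \<le> t \<Longrightarrow> t < \<delta>0 \<Longrightarrow> \<Gamma> t = 0"
    and supp: "\<And>t. t \<le> -b \<or> t \<ge> 0 \<Longrightarrow> g t = 0"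
    and \<Gamma>_range: "\<And>t. \<bar>t\<bar> < \<delta>0 \<Longrightarrow> 0 \<le> \<Gamma> t \<and> \<Gamma> t \<le> K"
  shows "\<exists>I. 0 \<le> I \<and> I \<le> K * measure lborel (inside M) \<and>
     (\<integral>x. (if x \<in> T then g (s x) * (x \<bullet> G (E x)) else 0) \<partial>lborel) = 3 * I"
proof -
  let ?\<nu> = "\<lambda>x. G (E x)"
  have clM: "closed M" and bdM: "bounded M" using compact_M compact_imp_closed compact_imp_bounded by auto
  \<comment> \<open>An open set on which the field is differentiable and which contains its compact
    support \<open>inside M \<union> M\<close>; the tube supplies the neighbourhood of M.\<close>
  define T2 where "T2 = T \<union> inside M"
  have openT2: "open T2" unfolding T2_def using open_T open_inside[OF clM] by blast
  have sub: "{-b..0} \<subseteq> {-\<delta>0<..<\<delta>0}" using b by auto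
  let ?S = "slab {-b..0}"
  have clS: "closed ?S" and ST: "?S \<subseteq> T" using compact_slab compact_imp_closed slab_subset_T[OF sub] by auto
  define \<phi> where "\<phi> = (\<lambda>x. if x \<in> T then \<Gamma> (s x) else if x \<in> inside M then K else 0)"
  define l where "l = (\<lambda>x. if x \<in> T then - g (s x) *\<^sub>R ?\<nu> x else 0)"
  have \<phi>_in: "\<phi> x = K" if "x \<in> inside M - ?S" for x
  proof (cases "x \<in> T")
    case True
    then have "s x < 0" "s x < -b \<or> s x > 0" "\<bar>s x\<bar> < \<delta>0"
      using that inside_T[OF True] slab_iff[OF sub, of x] s_bound[OF True] by auto
    then show ?thesis using \<Gamma>_deep[of "s x"] True unfolding \<phi>_def by auto
  qed (use that in \<open>simp add: \<phi>_def\<close>)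
  have l_zero: "l x = 0" if "x \<notin> ?S" for x
    using that slab_iff[OF sub, of x] supp[of "s x"] unfolding l_def by auto
  have d\<phi>: "(\<phi> has_derivative (\<lambda>v. l x \<bullet> v)) (at x)" if x: "x \<in> T2" for x
  proof (cases "x \<in> T")
    case True
    have "((\<lambda>x. \<Gamma> (s x)) has_derivative (\<lambda>v. (?\<nu> x \<bullet> v) * - g (s x))) (at x)"
      using has_derivative_compose[OF ds[OF True] \<Gamma>'[OF s_bound[OF True], unfolded has_field_derivative_def]] by (simp add: mult.commute)
    then have "(\<phi> has_derivative (\<lambda>v. (?\<nu> x \<bullet> v) * - g (s x))) (at x)"
      by (rule has_derivative_transform_within_open[OF _ open_T True]) (simp add: \<phi>_def)
    then show ?thesis using True unfolding l_def by (simp add: mult.commute)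
  next
    case False
    then have xin: "x \<in> inside M - ?S" using x ST unfolding T2_def by blast
    have "(\<phi> has_derivative (\<lambda>v. 0)) (at x)"
      by (rule has_derivative_transform_within_open[OF has_derivative_const _ xin])
        (use \<phi>_in open_inside[OF clM] clS in auto)
    then show ?thesis using l_zero xin by simp
  qed
  have contl: "continuous_on T2 l"
  proof -
    have "continuous_on UNIV (\<lambda>x. if x \<in> T then - g (s x) *\<^sub>R ?\<nu> x else 0)"
    proof (rule continuous_on_extend_zero[OF open_T clS ST])
      show "continuous_on T (\<lambda>x. - g (s x) *\<^sub>R ?\<nu> x)"
        by (intro continuous_intros continuous_on_profile contg continuous_on_GE)
      show "- g (s x) *\<^sub>R ?\<nu> x = 0" if "x \<in> T - ?S" for x using l_zero[of x] that unfolding l_def by auto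
    qed
    then show ?thesis unfolding l_def using continuous_on_subset by blast
  qed
  have cont\<phi>: "continuous_on T2 \<phi>"
    by (rule has_derivative_continuous_on) (use d\<phi> has_derivative_at_withinI in blast)
  define X where "X = (\<lambda>x. \<phi> x *\<^sub>R x)"
  define L where "L = (\<lambda>x v. \<phi> x *\<^sub>R v + (l x \<bullet> v) *\<^sub>R x)"
  define DX where "DX = (\<lambda>x. matrix (L x))"
  have derX: "(X has_derivative L x) (at x)" if x: "x \<in> T2" for x
    unfolding X_def L_def by (rule has_derivative_scaleR[OF d\<phi>[OF x] has_derivative_ident])
  have DXL: "DX x *v v = L x v" if "x \<in> T2" for x v
    using fun_cong[OF matrix_vector_mul(2)[OF has_derivative_linear[OF derX[OF that]]], of v] unfolding DX_def .
  have "continuous_on T2 (\<lambda>x. L x v)" for v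
    unfolding L_def by (intro continuous_intros cont\<phi> contl)
  then have contDX: "continuous_on T2 DX" by (intro continuous_on_matrixI) (simp add: DXL cong: continuous_on_cong)
  have tr: "trace (DX x) = 3 * \<phi> x + l x \<bullet> x" for x
  proof -
    have "trace (DX x) = (\<Sum>b\<in>Basis. L x b \<bullet> b)" unfolding DX_def by (rule trace_matrix)
    also have "\<dots> = \<phi> x * (\<Sum>b::real^3\<in>Basis. b \<bullet> b) + (\<Sum>b\<in>Basis. ((l x \<bullet> b) *\<^sub>R x) \<bullet> b)"
      unfolding L_def by (simp only: inner_add_left inner_scaleR_left sum.distrib sum_distrib_left)
    also have "(\<Sum>b\<in>Basis. ((l x \<bullet> b) *\<^sub>R x) \<bullet> b) = l x \<bullet> x"
      by (rule trace_rank_one) (intro linearI; simp add: inner_add_right)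
    finally show ?thesis by simp
  qed
  have \<phi>_supp: "\<phi> x = 0" if "x \<notin> inside M \<union> M" for x
  proof (cases "x \<in> T")
    case True
    then have "s x \<ge> 0" "\<bar>s x\<bar> < \<delta>0" using that inside_T[OF True] s_bound[OF True] by auto
    then show ?thesis using \<Gamma>_out[of "s x"] True unfolding \<phi>_def by auto
  qed (use that in \<open>simp add: \<phi>_def\<close>)
  have sub2: "inside M \<union> M \<subseteq> T2" unfolding T2_def using M_in_T by blast
  have dX: "(X has_derivative (\<lambda>v. DX x *v v)) (at x)" if "x \<in> T2" for x using derX[OF that] DXL[OF that] by simp
  have supX: "X x = 0" if "x \<in> T2 - (inside M \<union> M)" for x using \<phi>_supp[of x] that unfolding X_def by auto
  have zero: "(\<integral>x. (if x \<in> T2 then trace (DX x) else 0) \<partial>lborel) = 0"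
    by (rule integral_divergence_eq_0(2)[OF openT2 compact_inside_Un sub2 dX contDX supX])
  have \<phi>_zero: "\<phi> x = 0" if "x \<notin> T2" for x using that \<phi>_supp[of x] sub2 by blast
  have "l x = 0" if "x \<notin> T2" for x using that unfolding l_def T2_def by auto
  then have eq: "(\<lambda>x. if x \<in> T2 then trace (DX x) else 0) = (\<lambda>x. 3 * \<phi> x + l x \<bullet> x)"
    using \<phi>_zero unfolding tr by (auto simp: fun_eq_iff)
  have "continuous_on UNIV (\<lambda>x. if x \<in> T2 then \<phi> x else 0)"
    by (rule continuous_on_extend_zero[OF openT2 compact_imp_closed[OF compact_inside_Un] sub2 cont\<phi>]) (use \<phi>_supp in blast)
  moreover have "(\<lambda>x. if x \<in> T2 then \<phi> x else 0) = \<phi>" using \<phi>_zero by auto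
  ultimately have "continuous_on UNIV \<phi>" by (simp only:)
  then have int\<phi>: "integrable lborel \<phi>"
    by (rule continuous_compact_support_integrable[OF compact_inside_Un]) (rule \<phi>_supp)
  have intl: "integrable lborel (\<lambda>x. l x \<bullet> x)"
  proof (rule continuous_compact_support_integrable[OF compact_slab[of "{-b..0}"]])
    have "continuous_on UNIV (\<lambda>x. if x \<in> T then l x \<bullet> x else 0)"
      by (rule continuous_on_extend_zero[OF open_T clS ST])
        (use l_zero in \<open>auto intro!: continuous_intros continuous_on_subset[OF contl] simp: T2_def\<close>)
    moreover have "(\<lambda>x. if x \<in> T then l x \<bullet> x else 0) = (\<lambda>x. l x \<bullet> x)" unfolding l_def by auto
    ultimately show "continuous_on UNIV (\<lambda>x. l x \<bullet> x)" by (simp only:)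
  qed (use l_zero in auto)
  have "3 * (\<integral>x. \<phi> x \<partial>lborel) + (\<integral>x. l x \<bullet> x \<partial>lborel) = 0"
    using zero int\<phi> intl unfolding eq by simp
  moreover have "(\<lambda>x. l x \<bullet> x) = (\<lambda>x. - (if x \<in> T then g (s x) * (x \<bullet> G (E x)) else 0))"
    unfolding l_def by (auto simp: fun_eq_iff inner_commute)
  ultimately have "(\<integral>x. (if x \<in> T then g (s x) * (x \<bullet> G (E x)) else 0) \<partial>lborel) = 3 * (\<integral>x. \<phi> x \<partial>lborel)" by simp
  moreover have "0 \<le> K" using \<Gamma>_range[of 0] \<delta>0 by simp
  then have "0 \<le> \<phi> x" for x using \<Gamma>_range s_bound unfolding \<phi>_def by simp
  then have "0 \<le> (\<integral>x. \<phi> x \<partial>lborel)" by simp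
  moreover have "(\<integral>x. \<phi> x \<partial>lborel) \<le> (\<integral>x. K * indicator (inside M) x \<partial>lborel)"
  proof (rule integral_mono[OF int\<phi>])
    have "emeasure lborel (inside M) < \<infinity>" using bounded_inside[OF bdM] by (rule emeasure_bounded_finite)
    then show "integrable lborel (\<lambda>x. K * indicator (inside M) x)"
      using open_inside[OF clM] by (intro integrable_mult_right integrable_real_indicator) auto
    fix x
    show "\<phi> x \<le> K * indicator (inside M) x"
    proof (cases "x \<in> inside M")
      case True
      then show ?thesis using \<Gamma>_range s_bound unfolding \<phi>_def by simp
    next
      case False
      have "\<phi> x = 0"
      proof (cases "x \<in> M")
        case True
        then have "\<phi> x = \<Gamma> 0" using M_in_T on_M unfolding \<phi>_def by auto
        then show ?thesis using \<Gamma>_out[of 0] \<delta>0 by simp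
      qed (use \<phi>_supp False in blast)
      then show ?thesis using False by simp
    qed
  qed
  moreover have "(\<integral>x. K * indicator (inside M) x \<partial>lborel) = K * measure lborel (inside M)"
    using open_inside[OF clM] by simp
  ultimately show ?thesis by (intro exI[of _ "\<integral>x. \<phi> x \<partial>lborel"]) simp
qed

text \<open>The limit form of the last inequality, after division by h, is A \<le> 3cV.\<close>

lemma slab_volume_bound:
  assumes a: "0 < a" "0 < h" "h + 2 * a < \<delta>0"
    and \<omega>: "\<And>x. x \<in> slab {-(h + 2 * a)..0} \<Longrightarrow> \<bar>trace (D x) - 2 * c\<bar> \<le> \<omega>"
    and R: "\<And>x. x \<in> slab {-(h + 2 * a)..0} \<Longrightarrow> \<bar>x \<bullet> G (E x)\<bar> \<le> R" and \<omega>R: "\<omega> * R \<le> 1"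
  shows "measure lborel (slab {-h-a..-a}) > 0" "c > 0"
    "(2 - \<omega> * R) * measure lborel (slab {-h-a..-a}) \<le> 6 * c * (h + 2 * a) * measure lborel (inside M)"
proof -
  define b where "b = h + 2 * a"
  have b: "0 < b" "b < \<delta>0" unfolding b_def using a by auto
  obtain g g' where g0: "\<forall>t. (g has_real_derivative g' t) (at t)" "continuous_on UNIV g'"
    "\<forall>t. 0 \<le> g t \<and> g t \<le> 1" "\<forall>t\<in>{-h-a..-a}. g t = 1" "\<forall>t. t \<le> -(h + 2*a) \<or> t \<ge> 0 \<longrightarrow> g t = 0"
    by (rule cutoff_exists[OF a(1,2)])
  have g: "\<And>t. (g has_real_derivative g' t) (at t)" "\<And>t. 0 \<le> g t" "\<And>t. g t \<le> 1"
    and supp: "\<And>t. t \<le> -b \<or> t \<ge> 0 \<Longrightarrow> g t = 0"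
    using g0 unfolding b_def by blast+
  have contg: "continuous_on UNIV g" using g(1) by (meson DERIV_continuous continuous_at_imp_continuous_on)
  obtain \<Gamma>0 where \<Gamma>0: "\<And>t. t \<in> {-\<delta>0..\<delta>0} \<Longrightarrow> (\<Gamma>0 has_vector_derivative g t) (at t within {-\<delta>0..\<delta>0})"
    using antiderivative_continuous[of "-\<delta>0" \<delta>0 g] contg continuous_on_subset by (metis subset_UNIV)
  \<comment> \<open>Minus an antiderivative of g, normalised at 0: it vanishes on the outer side,
    and below the support of g it equals the total integral of g, which is at most b.\<close>
  define \<Gamma> where "\<Gamma> = (\<lambda>t. \<Gamma>0 0 - \<Gamma>0 t)"
  have \<Gamma>': "(\<Gamma> has_real_derivative - g t) (at t)" if t: "\<bar>t\<bar> < \<delta>0" for t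
  proof -
    have "t \<in> interior {-\<delta>0..\<delta>0}" using t by auto
    then have "(\<Gamma>0 has_vector_derivative g t) (at t)" using \<Gamma>0[of t] t at_within_interior by fastforce
    then have "(\<Gamma>0 has_real_derivative g t) (at t)" by (simp add: has_real_derivative_iff_has_vector_derivative)
    from DERIV_diff[OF DERIV_const this] show ?thesis unfolding \<Gamma>_def by simp
  qed
  have mvt: "\<exists>\<xi>. u < \<xi> \<and> \<xi> < v \<and> \<Gamma> v - \<Gamma> u = (v - u) * - g \<xi>" if "u < v" "-\<delta>0 < u" "v < \<delta>0" for u v
    by (rule MVT2[OF that(1)]) (use that in \<open>auto intro!: \<Gamma>'\<close>)
  define K where "K = \<Gamma> (-b)"
  have \<Gamma>00: "\<Gamma> 0 = 0" unfolding \<Gamma>_def by simp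
  have K: "K \<le> b"
  proof -
    obtain \<xi> where "\<Gamma> 0 - \<Gamma> (-b) = (0 - - b) * - g \<xi>" using mvt[of "-b" 0] b by auto
    then have "K = b * g \<xi>" unfolding K_def \<Gamma>00 by simp
    then show ?thesis using g(3)[of \<xi>] b by (simp add: mult_left_le)
  qed
  have deep: "\<Gamma> t = K" if t0: "-\<delta>0 < t" "t \<le> -b" for t
  proof (cases "t = -b")
    case False
    then obtain \<xi> where "\<xi> < -b" "\<Gamma> (-b) - \<Gamma> t = (-b - t) * - g \<xi>" using mvt[of t "-b"] t0 b by auto
    then show ?thesis using supp[of \<xi>] unfolding K_def by simp
  qed (simp add: K_def)
  have out: "\<Gamma> t = 0" if t0: "0 \<le> t" "t < \<delta>0" for t
  proof (cases "t = 0")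
    case False
    then obtain \<xi> where "\<xi> > 0" "\<Gamma> t - \<Gamma> 0 = (t - 0) * - g \<xi>" using mvt[of 0 t] t0 \<delta>0 by auto
    then show ?thesis using supp[of \<xi>] \<Gamma>00 by simp
  qed (simp add: \<Gamma>00)
  have decr: "\<Gamma> v \<le> \<Gamma> u" if t0: "u \<le> v" "-\<delta>0 < u" "v < \<delta>0" for u v
  proof (cases "u = v")
    case False
    then obtain \<xi> where "\<Gamma> v - \<Gamma> u = (v - u) * - g \<xi>" using mvt[of u v] t0 by auto
    moreover have "(v - u) * g \<xi> \<ge> 0" using t0 g(2) by (intro mult_nonneg_nonneg) auto
    ultimately show ?thesis by simp
  qed simp
  have range: "0 \<le> \<Gamma> t \<and> \<Gamma> t \<le> K" if t: "\<bar>t\<bar> < \<delta>0" for t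
  proof
    have t': "-\<delta>0 < t" "t < \<delta>0" using t by auto
    show "0 \<le> \<Gamma> t" using decr[of t 0] out[of t] t' \<Gamma>00 \<delta>0 by (cases "t \<le> 0") auto
    show "\<Gamma> t \<le> K"
    proof (cases "t \<le> -b")
      case True
      then show ?thesis using deep[OF t'(1) True] by (simp only: order_refl)
    next
      case False
      then have "\<Gamma> t \<le> \<Gamma> (-b)" by (intro decr) (use t' b in auto)
      then show ?thesis unfolding K_def .
    qed
  qed
  have "\<exists>I. 0 \<le> I \<and> I \<le> K * measure lborel (inside M) \<and>
     (\<integral>x. (if x \<in> T then g (s x) * (x \<bullet> G (E x)) else 0) \<partial>lborel) = 3 * I"
    by (rule integral_position_field[OF b \<Gamma>' contg deep out supp range])
  then obtain I where I: "0 \<le> I" "I \<le> K * measure lborel (inside M)"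
     "(\<integral>x. (if x \<in> T then g (s x) * (x \<bullet> G (E x)) else 0) \<partial>lborel) = 3 * I"
    by blast
  have sub: "{-b..0} \<subseteq> {-\<delta>0<..<\<delta>0}" using b by auto
  let ?S = "slab {-b..0}"
  have clS: "closed ?S" and ST: "?S \<subseteq> T" using compact_slab compact_imp_closed slab_subset_T[OF sub] by auto
  have intg: "integrable lborel (\<lambda>x. if x \<in> T then g (s x) * f x else 0)" if f: "continuous_on T f" for f
  proof (rule continuous_compact_support_integrable[OF compact_slab[of "{-b..0}"]])
    show "continuous_on UNIV (\<lambda>x. if x \<in> T then g (s x) * f x else 0)"
      by (rule continuous_on_extend_zero[OF open_T clS ST])
        (use supp slab_iff[OF sub] in \<open>auto intro!: continuous_intros continuous_on_profile contg f\<close>)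
    show "(if x \<in> T then g (s x) * f x else 0) = 0" if "x \<notin> ?S" for x
      using that supp[of "s x"] slab_iff[OF sub, of x] by auto
  qed simp
  have cx: "continuous_on T (\<lambda>x. x \<bullet> G (E x))" by (intro continuous_intros continuous_on_GE)
  define A where "A = (\<integral>x. (if x \<in> T then g (s x) * 1 else 0) \<partial>lborel)"
  note i1 = intg[OF continuous_on_const[of _ 1]] and i2 = intg[OF cx]
    and i3 = intg[OF continuous_on_mult[OF cx continuous_on_diff[OF continuous_on_trace_D continuous_on_const[of _ "2 * c"]]]]
  define Err where "Err = (\<integral>x. (if x \<in> T then g (s x) * ((x \<bullet> G (E x)) * (trace (D x) - 2 * c)) else 0) \<partial>lborel)"
  have comb: "(\<integral>x. k * f1 x - k' * f2 x - f3 x \<partial>lborel) =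
      k * (\<integral>x. f1 x \<partial>lborel) - k' * (\<integral>x. f2 x \<partial>lborel) - (\<integral>x. f3 x \<partial>lborel)"
    if "integrable lborel f1" "integrable lborel f2" "integrable lborel f3"
    for k k' :: real and f1 f2 f3 :: "real^3 \<Rightarrow> real"
    using that by simp
  \<comment> \<open>In the tangential identity the trace is split into 2c and a remainder. The
    integrals become 2A, 2c times 3I by the position field, and the error.\<close>
  have "0 = (\<integral>x. (if x \<in> T then g (s x) * (2 - (x \<bullet> G (E x)) * trace (D x)) else 0) \<partial>lborel)"
    using integral_tangential_field[OF b g(1) g0(2) supp] by simp
  also have "\<dots> = (\<integral>x. 2 * (if x \<in> T then g (s x) * 1 else 0) - 2 * c * (if x \<in> T then g (s x) * (x \<bullet> G (E x)) else 0)
      - (if x \<in> T then g (s x) * ((x \<bullet> G (E x)) * (trace (D x) - 2 * c)) else 0) \<partial>lborel)"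
    by (intro Bochner_Integration.integral_cong) (auto simp: algebra_simps)
  also have "\<dots> = 2 * A - 2 * c * (3 * I) - Err"
    unfolding A_def Err_def I(3)[symmetric] by (rule comb[OF i1 i2 i3])
  finally have main: "2 * A = 6 * c * I + Err" by simp
  have "Err \<le> (\<integral>x. \<omega> * R * (if x \<in> T then g (s x) * 1 else 0) \<partial>lborel)"
    unfolding Err_def
  proof (rule integral_mono[OF i3])
    show "integrable lborel (\<lambda>x. \<omega> * R * (if x \<in> T then g (s x) * 1 else 0))" using i1 by simp
    fix x
    show "(if x \<in> T then g (s x) * ((x \<bullet> G (E x)) * (trace (D x) - 2 * c)) else 0) \<le> \<omega> * R * (if x \<in> T then g (s x) * 1 else 0)"
    proof (cases "x \<in> ?S")
      case True
      have "\<bar>(x \<bullet> G (E x)) * (trace (D x) - 2 * c)\<bar> \<le> R * \<omega>"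
        unfolding abs_mult using \<omega>[of x] R[of x] True unfolding b_def by (intro mult_mono) auto
      then have "(x \<bullet> G (E x)) * (trace (D x) - 2 * c) \<le> \<omega> * R" by (simp add: mult.commute)
      then have "g (s x) * ((x \<bullet> G (E x)) * (trace (D x) - 2 * c)) \<le> g (s x) * (\<omega> * R)"
        using g(2) by (rule mult_left_mono)
      then show ?thesis using True ST by (simp add: mult_ac)
    next
      case False
      then show ?thesis using supp[of "s x"] slab_iff[OF sub, of x] by auto
    qed
  qed
  then have ErrA: "Err \<le> \<omega> * R * A" unfolding A_def by (simp only: integral_mult_right_zero)
  have subS: "{-h-a..-a} \<subseteq> {-\<delta>0<..<\<delta>0}" using a by auto
  have measS: "slab {-h-a..-a} \<in> sets borel" using compact_slab[of "{-h-a..-a}"] by (simp add: borel_compact)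
  have fin: "emeasure lborel (slab {-h-a..-a}) < \<infinity>" using compact_slab[of "{-h-a..-a}"] emeasure_compact_finite by simp
  have "measure lborel (slab {-h-a..-a}) = (\<integral>x. indicator (slab {-h-a..-a}) x \<partial>lborel)" using measS by simp
  also have "\<dots> \<le> A" unfolding A_def
  proof (rule integral_mono[OF _ i1])
    show "integrable lborel (indicator (slab {-h-a..-a}) :: _ \<Rightarrow> real)"
      using measS fin by (intro integrable_real_indicator) auto
    show "indicator (slab {-h-a..-a}) x \<le> (if x \<in> T then g (s x) * 1 else 0)" for x
      using slab_iff[OF subS, of x] g0(4) g(2) by (auto simp: indicator_def)
  qed
  finally have SA: "measure lborel (slab {-h-a..-a}) \<le> A" .
  show pos: "measure lborel (slab {-h-a..-a}) > 0"
  proof -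
    have op: "open (slab {-h-a<..<-a})" using a by (intro open_slab) auto
    obtain p where "p \<in> M" using M_nonempty by blast
    then have "p + (- h / 2 - a) *\<^sub>R \<eta> p \<in> slab {-h-a<..<-a}" unfolding slab_def using a by force
    then have "\<not> negligible (slab {-h-a<..<-a})" using open_not_negligible[OF op] by blast
    moreover have "slab {-h-a<..<-a} \<subseteq> slab {-h-a..-a}" by (rule slab_mono) auto
    ultimately have "\<not> negligible (slab {-h-a..-a})" using negligible_subset by blast
    then have "measure lebesgue (slab {-h-a..-a}) \<noteq> 0"
      using negligible_iff_measure[of "slab {-h-a..-a}"] lmeasurable_compact[OF compact_slab[of "{-h-a..-a}"]] by simp
    then have "measure lborel (slab {-h-a..-a}) \<noteq> 0" using measS by (simp add: measure_completion)
    then show ?thesis by (simp add: zero_less_measure_iff)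
  qed
  have le: "(2 - \<omega> * R) * A \<le> 6 * c * I" using main ErrA by (simp add: algebra_simps)
  \<comment> \<open>Since \<open>\<omega> * R \<le> 1\<close>, the factor is at least 1 and the left
    side is positive. As I is nonnegative, this decides the sign of c.\<close>
  have "(2 - \<omega> * R) * A > 0" using \<omega>R pos SA by (intro mult_pos_pos) auto
  then have "c * I > 0" using le by linarith
  then show c: "c > 0" using I(1) by (auto simp: zero_less_mult_iff)
  have "(2 - \<omega> * R) * measure lborel (slab {-h-a..-a}) \<le> (2 - \<omega> * R) * A"
    using SA \<omega>R by (intro mult_left_mono) auto
  also have "\<dots> \<le> 6 * c * I" by (rule le)
  also have "\<dots> \<le> 6 * c * (K * measure lborel (inside M))" using I(2) c by (intro mult_left_mono) auto
  also have "\<dots> \<le> 6 * c * (b * measure lborel (inside M))" using K c by (intro mult_left_mono mult_right_mono) auto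
  finally show "(2 - \<omega> * R) * measure lborel (slab {-h-a..-a}) \<le> 6 * c * (h + 2 * a) * measure lborel (inside M)"
    unfolding b_def by (simp add: mult_ac)
qed

end

section \<open>Nearest points\<close>

locale cmc_tube = tube +
  fixes c :: real
  assumes elliptic: "N x = 1 \<Longrightarrow> v \<noteq> 0 \<Longrightarrow> G x \<bullet> v = 0 \<Longrightarrow> (H x *v v) \<bullet> v > 0"
    and trace_D: "p \<in> M \<Longrightarrow> trace (D p) = 2 * c"
begin

text \<open>On M this is the squared half difference of the two principal curvatures.\<close>

definition defect :: "real^3 \<Rightarrow> real" where
  "defect x = (1 - c)\<^sup>2 - det (mat 1 - D x)"

text \<open>\<open>self_adjoint_plane\<close> with Q = \<open>H (\<eta> p)\<close>: definiteness is
  ellipticity of the norm, self-adjointness is the symmetry of the Hessian of s. Setting r = 1 in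
  the determinant formula identifies k with \<open>defect p\<close>.\<close>

lemma shape_operator:
  assumes p: "p \<in> M"
  shows "defect p \<ge> 0" "det (mat 1 - r *\<^sub>R D p) = (1 - r * c)\<^sup>2 - r\<^sup>2 * defect p"
    "defect p = 0 \<Longrightarrow> G (\<eta> p) \<bullet> v = 0 \<Longrightarrow> D p *v v = c *\<^sub>R v"
    "(\<And>v. G (\<eta> p) \<bullet> v = 0 \<Longrightarrow> (H (\<eta> p) *v (v - d *\<^sub>R (D p *v v))) \<bullet> v \<ge> 0) \<Longrightarrow>
           d * c \<le> 1 \<and> (1 - d * c)\<^sup>2 - d\<^sup>2 * defect p \<ge> 0"
proof -
  have pT: "p \<in> T" using M_in_T p by blast
  have Ep: "E p = \<eta> p" using on_M[OF p] by simp
  note nz = \<eta>_nonzero[OF p]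
  have "\<exists>k\<ge>0. (\<forall>r. det (mat 1 - r *\<^sub>R D p) = (1 - r * c)\<^sup>2 - r\<^sup>2 * k) \<and>
      (\<forall>v. k = 0 \<longrightarrow> G (\<eta> p) \<bullet> v = 0 \<longrightarrow> D p *v v = c *\<^sub>R v) \<and>
      (\<forall>d. (\<forall>v. G (\<eta> p) \<bullet> v = 0 \<longrightarrow> (H (\<eta> p) *v (v - d *\<^sub>R (D p *v v))) \<bullet> v \<ge> 0) \<longrightarrow>
           d * c \<le> 1 \<and> (1 - d * c)\<^sup>2 - d\<^sup>2 * k \<ge> 0)"
  proof (rule self_adjoint_plane[of "G (\<eta> p)" "\<eta> p" "D p" "H (\<eta> p)" c])
    show "G (\<eta> p) \<bullet> \<eta> p = 1" by (rule G_\<eta>_\<eta>[OF p])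
    show "D p *v \<eta> p = 0" using D_E[OF pT] unfolding Ep .
    show "G (\<eta> p) \<bullet> (D p *v v) = 0" for v using G_D[OF pT] unfolding Ep .
    show "(H (\<eta> p) *v u) \<bullet> v = (H (\<eta> p) *v v) \<bullet> u" for u v by (rule H_symmetric[OF nz])
    show "(H (\<eta> p) *v v) \<bullet> v > 0" if "G (\<eta> p) \<bullet> v = 0" "v \<noteq> 0" for v
      by (rule elliptic[OF N_\<eta>[OF p] that(2,1)])
    show "(H (\<eta> p) *v (D p *v u)) \<bullet> v = (H (\<eta> p) *v (D p *v v)) \<bullet> u" for u v
      using HD_symmetric[OF pT] unfolding Ep .
    show "trace (D p) = 2 * c" by (rule trace_D[OF p])
  next
    fix k assume k: "k \<ge> 0" "\<And>r. det (mat 1 - r *\<^sub>R D p) = (1 - r * c)\<^sup>2 - r\<^sup>2 * k"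
      and k0: "\<And>v. k = 0 \<Longrightarrow> G (\<eta> p) \<bullet> v = 0 \<Longrightarrow> D p *v v = c *\<^sub>R v"
      and kd: "\<And>d. (\<And>v. G (\<eta> p) \<bullet> v = 0 \<Longrightarrow> (H (\<eta> p) *v (v - d *\<^sub>R (D p *v v))) \<bullet> v \<ge> 0) \<Longrightarrow>
             d * c \<le> 1 \<and> (1 - d * c)\<^sup>2 - d\<^sup>2 * k \<ge> 0"
    show ?thesis
    proof (intro exI[of _ k] conjI allI impI k)
      show "D p *v v = c *\<^sub>R v" if "k = 0" "G (\<eta> p) \<bullet> v = 0" for v by (rule k0[OF that])
      fix d assume "\<forall>v. G (\<eta> p) \<bullet> v = 0 \<longrightarrow> (H (\<eta> p) *v (v - d *\<^sub>R (D p *v v))) \<bullet> v \<ge> 0"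
      then have "d * c \<le> 1 \<and> (1 - d * c)\<^sup>2 - d\<^sup>2 * k \<ge> 0" by (intro kd) simp
      then show "d * c \<le> 1" "(1 - d * c)\<^sup>2 - d\<^sup>2 * k \<ge> 0" by auto
    qed
  qed
  then obtain k where k: "k \<ge> 0" "\<And>r. det (mat 1 - r *\<^sub>R D p) = (1 - r * c)\<^sup>2 - r\<^sup>2 * k"
    and k0: "\<And>v. k = 0 \<Longrightarrow> G (\<eta> p) \<bullet> v = 0 \<Longrightarrow> D p *v v = c *\<^sub>R v"
    and kd: "\<forall>d. (\<forall>v. G (\<eta> p) \<bullet> v = 0 \<longrightarrow> (H (\<eta> p) *v (v - d *\<^sub>R (D p *v v))) \<bullet> v \<ge> 0) \<longrightarrow>
           d * c \<le> 1 \<and> (1 - d * c)\<^sup>2 - d\<^sup>2 * k \<ge> 0"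
    by blast
  have kdef: "defect p = k" unfolding defect_def using k(2)[of 1] by simp
  show "defect p \<ge> 0" unfolding kdef by (rule k)
  show "det (mat 1 - r *\<^sub>R D p) = (1 - r * c)\<^sup>2 - r\<^sup>2 * defect p" unfolding kdef by (rule k)
  show "D p *v v = c *\<^sub>R v" if "defect p = 0" "G (\<eta> p) \<bullet> v = 0"
    using that unfolding kdef by (rule k0)
  show "d * c \<le> 1 \<and> (1 - d * c)\<^sup>2 - d\<^sup>2 * defect p \<ge> 0"
    if "\<And>v. G (\<eta> p) \<bullet> v = 0 \<Longrightarrow> (H (\<eta> p) *v (v - d *\<^sub>R (D p *v v))) \<bullet> v \<ge> 0"
    using kd that unfolding kdef by simp
qed

text \<open>At a nearest point the Minkowski ball touches M from inside; differentiating the distance twice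
  along curves in M compares the two second fundamental forms.\<close>

lemma nearest_point_second_order:
  assumes p: "p \<in> M" and y: "y = p - d *\<^sub>R \<eta> p" "y \<notin> M" and d: "d > 0"
    and min: "\<And>q. q \<in> M \<Longrightarrow> N (q - y) \<ge> d" and v: "G (\<eta> p) \<bullet> v = 0"
  shows "(H (\<eta> p) *v (v - d *\<^sub>R (D p *v v))) \<bullet> v \<ge> 0"
proof -
  have pT: "p \<in> T" using M_in_T p by blast
  have Ep: "E p = \<eta> p" using on_M[OF p] by simp
  have nz: "\<eta> p \<noteq> 0" by (rule \<eta>_nonzero[OF p])
  have "v \<in> tangent_space M p" using tangent_space_eq[OF p] v by simp
  then obtain \<gamma> e where e: "e > 0" "smooth_on {-e<..<e} \<gamma>" "\<gamma> ` {-e<..<e} \<subseteq> M"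
    and \<gamma>0: "\<gamma> 0 = p" and \<gamma>v: "(\<gamma> has_vector_derivative v) (at 0)"
    unfolding tangent_space_def curve_through_def by blast
  define \<gamma>' where "\<gamma>' = (\<lambda>t. frechet_derivative \<gamma> (at t) 1)"
  have \<gamma>M: "\<gamma> t \<in> M" if "t \<in> {-e<..<e}" for t using e(3) that by blast
  have d\<gamma>: "(\<gamma> has_derivative (\<lambda>r. r *\<^sub>R \<gamma>' t)) (at t)" if "t \<in> {-e<..<e}" for t
  proof -
    note der = smooth_on_imp_has_derivative[OF e(2) that]
    have "frechet_derivative \<gamma> (at t) r = r *\<^sub>R \<gamma>' t" for r
      unfolding \<gamma>'_def using linear_scale[OF has_derivative_linear[OF der], of r 1] by simp
    then have "frechet_derivative \<gamma> (at t) = (\<lambda>r. r *\<^sub>R \<gamma>' t)" by (rule ext)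
    then show ?thesis using der by (simp only:)
  qed
  have \<gamma>'0: "\<gamma>' 0 = v"
  proof -
    have "(\<lambda>r. r *\<^sub>R \<gamma>' 0) = (\<lambda>r. r *\<^sub>R v)"
      by (rule has_derivative_unique[OF d\<gamma> \<gamma>v[unfolded has_vector_derivative_def]]) (use e(1) in simp)
    from fun_cong[OF this, of 1] show ?thesis by simp
  qed
  have "continuous_on {-e<..<e} \<gamma>'"
    unfolding \<gamma>'_def by (rule smooth_on_imp_continuous_on[OF smooth_on_derivative[OF e(2)]])
  then have "isCont \<gamma>' 0" using e(1) by (simp add: continuous_on_eq_continuous_at)
  then have \<gamma>'_lim: "(\<gamma>' \<longlongrightarrow> v) (at_right 0)" using \<gamma>'0 unfolding isCont_def filterlim_at_split by simp
  \<comment> \<open>\<open>G (E (\<gamma> t))\<close> annihilates the velocity, so subtracting it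
    does not change the derivative of the distance. It makes B vanish at 0, and the derivative of B
    replaces a second derivative of \<gamma>.\<close>
  define B where "B = (\<lambda>t. G (\<gamma> t - y) - G (E (\<gamma> t)))"
  have h': "((\<lambda>t. N (\<gamma> t - y)) has_real_derivative B t \<bullet> \<gamma>' t) (at t)" if t: "t \<in> {-e<..<e}" for t
  proof -
    have M: "\<gamma> t \<in> M" by (rule \<gamma>M[OF t])
    then have "\<gamma> t - y \<noteq> 0" using y(2) by auto
    then have "((\<lambda>t. N (\<gamma> t - y)) has_derivative (\<lambda>r. G (\<gamma> t - y) \<bullet> (r *\<^sub>R \<gamma>' t))) (at t)"
      using d\<gamma>[OF t] by (intro has_derivative_compose[where g = N, OF _ dN]) (auto intro!: derivative_eq_intros)
    moreover have "G (E (\<gamma> t)) \<bullet> \<gamma>' t = 0"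
    proof -
      have "((\<lambda>t. s (\<gamma> t)) has_derivative (\<lambda>r. G (E (\<gamma> t)) \<bullet> (r *\<^sub>R \<gamma>' t))) (at t)"
        using M M_in_T by (intro has_derivative_compose[where g = s, OF d\<gamma>[OF t] ds]) auto
      then have "(\<lambda>r. G (E (\<gamma> t)) \<bullet> (r *\<^sub>R \<gamma>' t)) = (\<lambda>r. 0)"
        by (rule has_derivative_at_transform_eq[OF _ has_derivative_const _ t]) (use on_M \<gamma>M in auto)
      from fun_cong[OF this, of 1] show ?thesis by simp
    qed
    ultimately show ?thesis unfolding has_field_derivative_def B_def
      by (elim has_derivative_eq_rhs) (simp add: fun_eq_iff inner_diff_left mult.commute)
  qed
  have py: "p - y = d *\<^sub>R \<eta> p" using y(1) by simp
  have B0: "B 0 = 0" unfolding B_def \<gamma>0 py Ep using G_scale[OF nz d] by simp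
  \<comment> \<open>The derivative of B at 0; as p - y = d \<eta>(p), homogeneity of degree -1
    expresses \<open>H (p - y)\<close> by \<open>H (\<eta> p)\<close> and a factor 1/d.\<close>
  define b where "b = (H (\<eta> p) *v v) /\<^sub>R d - H (\<eta> p) *v (D p *v v)"
  have dB: "(B has_vector_derivative b) (at 0)"
  proof -
    have g0: "(\<gamma> has_derivative (\<lambda>r. r *\<^sub>R v)) (at 0)" using \<gamma>v unfolding has_vector_derivative_def .
    have "((\<lambda>t. G (\<gamma> t - y)) has_derivative (\<lambda>r. H (\<gamma> 0 - y) *v (r *\<^sub>R v))) (at 0)"
      using g0 nz d unfolding \<gamma>0 py
      by (intro has_derivative_compose[where g = G and f = "\<lambda>t. \<gamma> t - y"])
         (auto intro!: derivative_eq_intros dG simp: \<gamma>0 py)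
    moreover have "((\<lambda>t. G (E (\<gamma> t))) has_derivative (\<lambda>r. H (E (\<gamma> 0)) *v (D (\<gamma> 0) *v (r *\<^sub>R v)))) (at 0)"
      by (rule has_derivative_compose[where g = "\<lambda>x. G (E x)", OF g0]) (use dGE[OF pT] \<gamma>0 in simp)
    ultimately have "(B has_derivative (\<lambda>r. H (\<gamma> 0 - y) *v (r *\<^sub>R v) - H (E (\<gamma> 0)) *v (D (\<gamma> 0) *v (r *\<^sub>R v)))) (at 0)"
      unfolding B_def by (rule has_derivative_diff)
    then show ?thesis
      unfolding has_vector_derivative_def
      by (elim has_derivative_eq_rhs)
         (simp add: fun_eq_iff \<gamma>0 py Ep H_scale[OF nz d] matrix_vector_mult_scaleR b_def scaleR_diff_right)
  qed
  have bv: "b \<bullet> v \<ge> 0"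
  proof (rule ccontr)
    assume "\<not> b \<bullet> v \<ge> 0"
    then have neg: "b \<bullet> v < 0" by simp
    have "((\<lambda>t. (B (0 + t) - B 0) /\<^sub>R t) \<longlongrightarrow> b) (at 0)"
      using dB unfolding has_vector_derivative_def has_derivative_at
    proof -
      assume "bounded_linear (\<lambda>x. x *\<^sub>R b) \<and> (\<lambda>h. norm (B (0 + h) - B 0 - h *\<^sub>R b) / norm h) \<midarrow>0\<rightarrow> 0"
      then have "(\<lambda>h. norm (B (0 + h) - B 0 - h *\<^sub>R b) / norm h) \<midarrow>0\<rightarrow> 0" by blast
      then have "((\<lambda>h. norm ((B (0 + h) - B 0) /\<^sub>R h - b)) \<longlongrightarrow> 0) (at 0)"
      proof (rule Lim_transform_eventually)
        have "norm (B (0 + h) - B 0 - h *\<^sub>R b) / norm h = norm ((B (0 + h) - B 0) /\<^sub>R h - b)" if "h \<noteq> 0" for h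
        proof -
          have "(B (0 + h) - B 0) /\<^sub>R h - b = (B (0 + h) - B 0 - h *\<^sub>R b) /\<^sub>R h"
            using that by (simp add: scaleR_diff_right)
          then show ?thesis by (simp add: divide_inverse mult.commute)
        qed
        then show "\<forall>\<^sub>F h in at 0. norm (B (0 + h) - B 0 - h *\<^sub>R b) / norm h = norm ((B (0 + h) - B 0) /\<^sub>R h - b)"
          by (auto simp: eventually_at_filter)
      qed
      from tendsto_norm_zero_cancel[OF this] show ?thesis by (rule LIM_zero_cancel)
    qed
    then have "((\<lambda>t. B t /\<^sub>R t) \<longlongrightarrow> b) (at_right 0)" unfolding filterlim_at_split by (simp add: B0)
    then have "((\<lambda>t. (B t /\<^sub>R t) \<bullet> \<gamma>' t) \<longlongrightarrow> b \<bullet> v) (at_right 0)" by (intro tendsto_inner \<gamma>'_lim)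
    then have "\<forall>\<^sub>F t in at_right 0. (B t /\<^sub>R t) \<bullet> \<gamma>' t < 0" by (rule order_tendstoD(2)[OF _ neg])
    then obtain u where u: "u > 0" "\<And>t. 0 < t \<Longrightarrow> t < u \<Longrightarrow> (B t /\<^sub>R t) \<bullet> \<gamma>' t < 0"
      unfolding eventually_at_right_field by auto
    define t1 where "t1 = min (u / 2) (e / 2)"
    have t1: "0 < t1" "t1 < u" "t1 < e" unfolding t1_def using u(1) e(1) by auto
    obtain \<xi> where \<xi>: "0 < \<xi>" "\<xi> < t1" "N (\<gamma> t1 - y) - N (\<gamma> 0 - y) = (t1 - 0) * (B \<xi> \<bullet> \<gamma>' \<xi>)"
      using MVT2[OF t1(1), of "\<lambda>t. N (\<gamma> t - y)" "\<lambda>t. B t \<bullet> \<gamma>' t"] h' t1 e(1) by auto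
    have "(B \<xi> /\<^sub>R \<xi>) \<bullet> \<gamma>' \<xi> < 0" using u(2) \<xi> t1 by simp
    then have "B \<xi> \<bullet> \<gamma>' \<xi> < 0" using \<xi>(1) by (simp add: mult_less_0_iff)
    then have "t1 * (B \<xi> \<bullet> \<gamma>' \<xi>) < 0" using t1 by (simp add: mult_pos_neg)
    then have "N (\<gamma> t1 - y) < N (\<gamma> 0 - y)" using \<xi>(3) by simp
    also have "N (\<gamma> 0 - y) = d" unfolding \<gamma>0 py using N_\<eta>[OF p] d by (simp add: N_scale)
    finally show False using min[OF \<gamma>M[of t1]] t1 by auto
  qed
  have "d *\<^sub>R b = H (\<eta> p) *v (v - d *\<^sub>R (D p *v v))"
    unfolding b_def using d by (simp add: matrix_vector_mult_diff_distrib matrix_vector_mult_scaleR scaleR_diff_right)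
  moreover have "(d *\<^sub>R b) \<bullet> v \<ge> 0" using bv d by simp
  ultimately show ?thesis by simp
qed

text \<open>The unit vector from y towards a nearest point p and the vector \<eta>(p) have the same
  tangent plane, so they agree up to sign. The opposite sign would place outside points p + t
  \<eta>(p) in the open ball around y that the distance to M keeps free of them.\<close>

lemma nearest_point:
  assumes y: "y \<in> inside M"
  obtains p d where "p \<in> M" "d > 0" "y = p - d *\<^sub>R \<eta> p" "d * c \<le> 1" "(1 - d * c)\<^sup>2 - d\<^sup>2 * defect p \<ge> 0"
proof -
  have yM: "y \<notin> M" using y inside_no_overlap[of M] by blast
  have "continuous_on M (\<lambda>p. N (p - y))"
    by (rule continuous_on_compose2[OF continuous_on_N[of UNIV]]) (auto intro!: continuous_intros)
  then obtain p where p: "p \<in> M" "\<And>q. q \<in> M \<Longrightarrow> N (p - y) \<le> N (q - y)"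
    using continuous_attains_inf[OF compact_M M_nonempty] by blast
  define d where "d = N (p - y)"
  have "p - y \<noteq> 0" using p(1) yM by auto
  then have d: "d > 0" unfolding d_def by (rule N_pos)
  \<comment> \<open>A segment from y to an outside point of this ball would meet M closer to y than
    the nearest point.\<close>
  have ball: "z \<notin> outside M" if z: "N (z - y) < d" for z
  proof
    assume "z \<in> outside M"
    then have "y \<in> inside M \<inter> closed_segment y z" "z \<in> outside M \<inter> closed_segment y z" using y by auto
    then have "inside M \<inter> closed_segment y z \<noteq> {}" "outside M \<inter> closed_segment y z \<noteq> {}" by auto
    then have "M \<inter> closed_segment y z \<noteq> {}"
      by (rule inside_outside_intersect_connected[OF connected_segment(1)])
    then obtain q where q: "q \<in> M" "q \<in> closed_segment y z" by blast
    then obtain t where t: "0 \<le> t" "t \<le> 1" "q = (1 - t) *\<^sub>R y + t *\<^sub>R z" unfolding in_segment by blast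
    then have "q - y = t *\<^sub>R (z - y)" by (simp add: algebra_simps)
    then have "N (q - y) = t * N (z - y)" using t by (simp add: N_scale)
    also have "\<dots> \<le> 1 * N (z - y)" using t N_nonneg by (intro mult_right_mono) auto
    finally show False using p(2)[OF q(1)] z unfolding d_def by simp
  qed
  define w where "w = (p - y) /\<^sub>R d"
  have Nw: "N w = 1" unfolding w_def using d by (simp add: N_scale d_def[symmetric])
  have Gw: "G w = G (p - y)" unfolding w_def using G_scale[of "p - y" "inverse d"] \<open>p - y \<noteq> 0\<close> d by simp
  have ker: "G w \<bullet> v = 0" if v: "G (\<eta> p) \<bullet> v = 0" for v
  proof -
    have "v \<in> tangent_space M p" using tangent_space_eq[OF p(1)] v by simp
    then obtain \<gamma> e where e: "e > 0" "\<gamma> ` {-e<..<e} \<subseteq> M"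
      and \<gamma>0: "\<gamma> 0 = p" and \<gamma>v: "(\<gamma> has_vector_derivative v) (at 0)"
      unfolding tangent_space_def curve_through_def by blast
    have "((\<lambda>t. N (\<gamma> t - y)) has_derivative (\<lambda>r. G (\<gamma> 0 - y) \<bullet> (r *\<^sub>R v))) (at 0)"
      using \<gamma>v \<open>p - y \<noteq> 0\<close> unfolding has_vector_derivative_def
      by (intro has_derivative_compose[where g = N, OF _ dN]) (auto intro!: derivative_eq_intros simp: \<gamma>0)
    then have der: "DERIV (\<lambda>t. N (\<gamma> t - y)) 0 :> G w \<bullet> v"
      unfolding has_field_derivative_def \<gamma>0 Gw by (simp add: mult_commute_abs)
    show ?thesis
    proof (rule DERIV_local_min[OF der e(1)], intro allI impI)
      fix t assume "\<bar>0 - t\<bar> < e"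
      then have "t \<in> {-e<..<e}" by auto
      then have "\<gamma> t \<in> M" using e(2) by blast
      then show "N (\<gamma> 0 - y) \<le> N (\<gamma> t - y)" unfolding \<gamma>0 by (rule p(2))
    qed
  qed
  have "w \<noteq> - \<eta> p"
  proof
    assume "w = - \<eta> p"
    then have "d *\<^sub>R w = - d *\<^sub>R \<eta> p" by simp
    then have py: "y = p + d *\<^sub>R \<eta> p" unfolding w_def using d by (simp add: algebra_simps)
    \<comment> \<open>At most d, so the point has distance d - t from y; below \<delta>0, so it is
      known to lie outside.\<close>
    define t where "t = min d (\<delta>0 / 2)"
    have t: "0 < t" "t < \<delta>0" "t \<le> d" unfolding t_def using d \<delta>0 by auto
    have "p + t *\<^sub>R \<eta> p - y = (t - d) *\<^sub>R \<eta> p" unfolding py by (simp add: algebra_simps)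
    then have "N (p + t *\<^sub>R \<eta> p - y) = \<bar>t - d\<bar>" using N_\<eta>[OF p(1)] by (simp add: N_scale)
    then have "N (p + t *\<^sub>R \<eta> p - y) < d" using t by simp
    then show False using ball plus_side[OF p(1) t(1,2)] by blast
  qed
  then have "w = \<eta> p" using G_kernel_determines[OF N_\<eta>[OF p(1)] Nw ker] by blast
  then have "d *\<^sub>R w = d *\<^sub>R \<eta> p" by simp
  then have yp: "y = p - d *\<^sub>R \<eta> p" unfolding w_def using d by (simp add: algebra_simps)
  have so: "(H (\<eta> p) *v (v - d *\<^sub>R (D p *v v))) \<bullet> v \<ge> 0" if "G (\<eta> p) \<bullet> v = 0" for v
    by (rule nearest_point_second_order[OF p(1) yp yM d _ that]) (simp add: d_def p(2))
  have "d * c \<le> 1 \<and> (1 - d * c)\<^sup>2 - d\<^sup>2 * defect p \<ge> 0" by (rule shape_operator(4)[OF p(1) so])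
  then show ?thesis using that[OF p(1) d yp] by blast
qed

end

section \<open>Covering the interior by images of a thin slab\<close>

text \<open>The squares of 1, ..., n + 1 in reverse order. The offset reflects shifts that start at
  -h, so that \<open>1 - r i * c\<close> runs over (n + 1 - i) / n.\<close>

lemma sum_shifted_squares:
  "(\<Sum>i\<le>n. (real n + 1 - real i)\<^sup>2) = (real n + 1) * (real n + 2) * (2 * real n + 3) / 6"
proof (induction n)
  case (Suc n)
  have "(\<Sum>i\<le>Suc n. (real (Suc n) + 1 - real i)\<^sup>2)
      = (real (Suc n) + 1 - real 0)\<^sup>2 + (\<Sum>i\<le>n. (real (Suc n) + 1 - real (Suc i))\<^sup>2)"
    by (rule sum.atMost_Suc_shift)
  also have "(\<Sum>i\<le>n. (real (Suc n) + 1 - real (Suc i))\<^sup>2) = (\<Sum>i\<le>n. (real n + 1 - real i)\<^sup>2)"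
    by (intro sum.cong) (auto simp: algebra_simps)
  finally show ?case unfolding Suc.IH by (simp add: power2_eq_square field_simps)
qed simp

context tube
begin

definition slab_on :: "(real^3) set \<Rightarrow> real set \<Rightarrow> (real^3) set" where
  "slab_on W I = {p + t *\<^sub>R \<eta> p |p t. p \<in> W \<and> t \<in> I}"

lemma slab_on_subset: "W \<subseteq> M \<Longrightarrow> slab_on W I \<subseteq> slab I"
  unfolding slab_on_def slab_def by blast

lemma compact_slab_on: "compact W \<Longrightarrow> W \<subseteq> M \<Longrightarrow> compact I \<Longrightarrow> compact (slab_on W I)"
proof -
  assume W: "compact W" "W \<subseteq> M" and I: "compact I"
  have "compact ((\<lambda>z. fst z + snd z *\<^sub>R \<eta> (fst z)) ` (W \<times> I))"
    using W(2) by (intro compact_continuous_image compact_Times W I continuous_intros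
        continuous_on_compose2[OF continuous_on_\<eta>]) auto
  moreover have "(\<lambda>z. fst z + snd z *\<^sub>R \<eta> (fst z)) ` (W \<times> I) = slab_on W I" unfolding slab_on_def by force
  ultimately show ?thesis by simp
qed

lemma continuous_on_det_D: "continuous_on T (\<lambda>x. det (mat 1 - r *\<^sub>R D x))"
  by (intro continuous_on_det3 continuous_intros contD_T)

text \<open>The Jacobian matrix of the shift is \<open>mat 1 - r *\<^sub>R D x\<close>. Overlaps of
  the image with itself are harmless, as an upper bound is wanted.\<close>

lemma shift_image_bound:
  assumes K: "K \<in> lmeasurable" "K \<subseteq> T" and B: "\<And>x. x \<in> K \<Longrightarrow> \<bar>det (mat 1 - r *\<^sub>R D x)\<bar> \<le> B"
  shows "(\<lambda>x. x - r *\<^sub>R E x) ` K \<in> lmeasurable"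
    "measure lebesgue ((\<lambda>x. x - r *\<^sub>R E x) ` K) \<le> B * measure lebesgue K"
proof -
  define f' where "f' = (\<lambda>x v. (mat 1 - r *\<^sub>R D x) *v v)"
  have m: "matrix (f' x) = mat 1 - r *\<^sub>R D x" for x unfolding f'_def by simp
  have der: "((\<lambda>x. x - r *\<^sub>R E x) has_derivative f' x) (at x within K)" if "x \<in> K" for x
  proof -
    have "((\<lambda>x. x - r *\<^sub>R E x) has_derivative (\<lambda>v. v - r *\<^sub>R (D x *v v))) (at x)"
      using dE[of x] that K(2) by (auto intro!: derivative_eq_intros)
    moreover have "(\<lambda>v. v - r *\<^sub>R (D x *v v)) = f' x"
      unfolding f'_def by (simp add: fun_eq_iff matrix_vector_mult_diff_rdistrib scaleR_matrix_vector_assoc)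
    ultimately show ?thesis using has_derivative_at_withinI by metis
  qed
  have int: "(\<lambda>x. \<bar>det (matrix (f' x))\<bar>) integrable_on K"
    unfolding m
  proof (rule measurable_bounded_by_integrable_imp_integrable[where g = "\<lambda>x. B"])
    show Ks: "K \<in> sets lebesgue" using K(1) by blast
    have "continuous_on K (\<lambda>x. \<bar>det (mat 1 - r *\<^sub>R D x)\<bar>)"
      by (intro continuous_on_rabs continuous_on_subset[OF continuous_on_det_D K(2)])
    then show "(\<lambda>x. \<bar>det (mat 1 - r *\<^sub>R D x)\<bar>) \<in> borel_measurable (lebesgue_on K)"
      by (rule continuous_imp_measurable_on_sets_lebesgue[OF _ Ks])
    show "(\<lambda>x. B) integrable_on K" using K(1) by (rule integrable_on_const)
  qed (use B in auto)
  have bnd: "\<bar>det (matrix (f' x))\<bar> \<le> B" if "x \<in> K" for x unfolding m by (rule B[OF that])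
  show "(\<lambda>x. x - r *\<^sub>R E x) ` K \<in> lmeasurable"
    by (rule measurable_bounded_differentiable_image[OF K(1) der int bnd])
  show "measure lebesgue ((\<lambda>x. x - r *\<^sub>R E x) ` K) \<le> B * measure lebesgue K"
    by (rule measure_bounded_differentiable_image[OF K(1) der int bnd])
qed

text \<open>Uniform continuity on the compact set of triples (p, t, r) compares data at depth t and
  shift r with data at the foot p and a nearby shift r'.\<close>

lemma uniform_on_tube:
  fixes f :: "(real^3) \<times> real \<Rightarrow> real"
  assumes f: "continuous_on (T \<times> UNIV) f" and \<epsilon>: "\<epsilon> > 0"
  obtains b where "b > 0" "b < \<delta>0"
    "\<forall>p\<in>M. \<forall>t r r'. -b \<le> t \<and> t \<le> 0 \<and> \<bar>r\<bar> \<le> R0 \<and> \<bar>r'\<bar> \<le> R0 \<and> \<bar>r - r'\<bar> \<le> b \<longrightarrow>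
       \<bar>f (p + t *\<^sub>R \<eta> p, r) - f (p, r')\<bar> \<le> \<epsilon>"
proof -
  define F where "F = (\<lambda>z. f (fst (fst z) + snd (fst z) *\<^sub>R \<eta> (fst (fst z)), snd z))"
  let ?K = "(M \<times> {-\<delta>0/2..0}) \<times> {-R0..R0}"
  have inT: "p + t *\<^sub>R \<eta> p \<in> T" if "p \<in> M" "-\<delta>0/2 \<le> t" "t \<le> 0" for p t
    using in_T[OF that(1), of t] that \<delta>0 by (auto simp: abs_less_iff)
  have "continuous_on ?K F"
    unfolding F_def
    by (rule continuous_on_compose2[OF f])
       (use inT in \<open>auto intro!: continuous_intros continuous_on_compose2[OF continuous_on_\<eta>]\<close>)
  moreover have "compact ?K" by (intro compact_Times compact_M compact_Icc)
  ultimately have "uniformly_continuous_on ?K F" using compact_uniformly_continuous by blast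
  then obtain d where d: "d > 0" "\<And>z z'. z \<in> ?K \<Longrightarrow> z' \<in> ?K \<Longrightarrow> dist z' z < d \<Longrightarrow> dist (F z') (F z) < \<epsilon>"
    unfolding uniformly_continuous_on_def using \<epsilon> by metis
  \<comment> \<open>Depth and shift each move by at most b, so the distance stays below 2b <
    d.\<close>
  define b where "b = min (d / 3) (\<delta>0 / 2)"
  have b: "b > 0" "b < \<delta>0" "2 * b < d" "b \<le> \<delta>0 / 2" unfolding b_def using d(1) \<delta>0 by auto
  have "\<bar>f (p + t *\<^sub>R \<eta> p, r) - f (p, r')\<bar> \<le> \<epsilon>"
    if p: "p \<in> M" and t: "-b \<le> t" "t \<le> 0" and r: "\<bar>r\<bar> \<le> R0" "\<bar>r'\<bar> \<le> R0" "\<bar>r - r'\<bar> \<le> b" for p t r r'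
  proof -
    have "((p, t), r) \<in> ?K" "((p, 0), r') \<in> ?K" using p t r b \<delta>0 by auto
    moreover have "dist ((p, t), r) ((p, 0), r') \<le> dist (p, t) (p, 0) + dist r r'"
      unfolding dist_Pair_Pair by (rule sqrt_sum_squares_le_sum) auto
    then have "dist ((p, t), r) ((p, 0), r') < d" using t r b by (simp add: dist_Pair_Pair dist_real_def)
    ultimately have "dist (F ((p, t), r)) (F ((p, 0), r')) < \<epsilon>" by (intro d(2))
    then show ?thesis unfolding F_def dist_real_def by simp
  qed
  then show ?thesis using that[OF b(1,2)] by blast
qed

lemma continuous_on_shift_det: "continuous_on (T \<times> UNIV) (\<lambda>z. det (mat 1 - snd z *\<^sub>R D (fst z)))"
  by (intro continuous_on_det3 continuous_intros continuous_on_compose2[OF contD_T]) auto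

text \<open>A fixed thick slab over W is covered by about 1/h shifted copies of a slab of thickness h.\<close>

lemma slab_on_volume_lower_bound:
  assumes p0: "p0 \<in> M" and \<rho>: "\<rho> > 0"
  obtains w h0 where "w > 0" "h0 > 0" "h0 < \<delta>0"
    "\<forall>h a. 0 < h \<and> h \<le> h0 \<and> 0 < a \<and> a \<le> h \<longrightarrow> measure lebesgue (slab_on (M \<inter> cball p0 \<rho>) {-h-a..-a}) \<ge> w * h"
proof -
  let ?W = "M \<inter> cball p0 \<rho>"
  have W: "compact ?W" "?W \<subseteq> M" using compact_M by auto
  obtain b0 where b0: "b0 > 0" "b0 < \<delta>0"
    "\<forall>p\<in>M. \<forall>t r r'. -b0 \<le> t \<and> t \<le> 0 \<and> \<bar>r\<bar> \<le> 1 \<and> \<bar>r'\<bar> \<le> 1 \<and> \<bar>r - r'\<bar> \<le> b0 \<longrightarrow>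
       \<bar>(\<lambda>z. det (mat 1 - snd z *\<^sub>R D (fst z))) (p + t *\<^sub>R \<eta> p, r) - (\<lambda>z. det (mat 1 - snd z *\<^sub>R D (fst z))) (p, r')\<bar> \<le> 1"
    by (rule uniform_on_tube[OF continuous_on_shift_det, of 1 1]) auto
  \<comment> \<open>b \<le> 1 keeps the shifts in the range of uniformity. At r' = 0 the determinant
    is 1, so it is at most 2 in absolute value for shifts up to b.\<close>
  define b where "b = min b0 1"
  have b: "b > 0" "b \<le> b0" "b \<le> 1" "b < \<delta>0" unfolding b_def using b0 by auto
  have det2: "\<bar>det (mat 1 - r *\<^sub>R D x)\<bar> \<le> 2" if x: "x \<in> slab {-b..0}" and r: "\<bar>r\<bar> \<le> b" for x r
  proof -
    obtain p t where "p \<in> M" "-b \<le> t" "t \<le> 0" "x = p + t *\<^sub>R \<eta> p" using x unfolding slab_def by auto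
    then have "\<bar>det (mat 1 - r *\<^sub>R D x) - det (mat 1 - 0 *\<^sub>R D p)\<bar> \<le> 1"
      using b0(3)[rule_format, of p t r 0] r b by simp
    then show ?thesis by simp
  qed
  let ?Q = "slab_on ?W {-b/2..-b/4}"
  have Qc: "compact ?Q" by (intro compact_slab_on W) simp
  have Qm: "measure lebesgue ?Q > 0"
  proof -
    \<comment> \<open>The points with foot near p0 and depth strictly between b/4 and b/2; the one
      at depth 3b/8 over p0 shows that the set is not empty.\<close>
    define O' where "O' = T \<inter> (\<lambda>x. (s x, x - s x *\<^sub>R E x)) -` ({-b/2<..<-b/4} \<times> ball p0 \<rho>)"
    have "open O'" unfolding O'_def
      by (rule continuous_open_preimage[OF _ open_T])
         (auto intro!: continuous_intros continuous_on_s continuous_on_E open_Times)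
    moreover have "p0 + (- 3 * b / 8) *\<^sub>R \<eta> p0 \<in> O'"
    proof -
      have l: "\<bar>- 3 * b / 8\<bar> < \<delta>0" using b by auto
      show ?thesis unfolding O'_def
        using in_T[OF p0 l] s_tube[OF p0 l] E_tube[OF p0 l] b(1) \<rho> by auto
    qed
    ultimately have "\<not> negligible O'" using open_not_negligible by blast
    moreover have "O' \<subseteq> ?Q"
    proof
      fix x assume x: "x \<in> O'"
      then have xT: "x \<in> T" unfolding O'_def by blast
      define q where "q = x - s x *\<^sub>R E x"
      have "q \<in> M" "\<eta> q = E x" using foot[OF xT] unfolding q_def by auto
      moreover have "q \<in> cball p0 \<rho>" "s x \<in> {-b/2..-b/4}" using x unfolding O'_def q_def by auto
      moreover have "x = q + s x *\<^sub>R \<eta> q" unfolding \<open>\<eta> q = E x\<close> by (simp add: q_def)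
      ultimately show "x \<in> ?Q" unfolding slab_on_def by blast
    qed
    ultimately have "\<not> negligible ?Q" using negligible_subset by blast
    then have "measure lebesgue ?Q \<noteq> 0"
      using negligible_iff_measure[of ?Q] lmeasurable_compact[OF Qc] by simp
    then show ?thesis by (simp add: zero_less_measure_iff)
  qed
  show ?thesis
  proof (rule that[of "measure lebesgue ?Q / (2 * b)" "b / 4"])
    show "measure lebesgue ?Q / (2 * b) > 0" "b / 4 > 0" "b / 4 < \<delta>0" using Qm b by auto
    show "\<forall>h a. 0 < h \<and> h \<le> b / 4 \<and> 0 < a \<and> a \<le> h \<longrightarrow>
        measure lebesgue (slab_on ?W {-h-a..-a}) \<ge> measure lebesgue ?Q / (2 * b) * h"
    proof (intro allI impI)
      fix h a assume "0 < h \<and> h \<le> b / 4 \<and> 0 < a \<and> a \<le> h"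
      then have h: "0 < h" "h \<le> b / 4" "0 < a" "a \<le> h" by auto
      let ?S = "slab_on ?W {-h-a..-a}"
      have Sc: "compact ?S" by (intro compact_slab_on W) simp
      have Sm: "?S \<in> lmeasurable" by (rule lmeasurable_compact[OF Sc])
      have Ssub: "?S \<subseteq> slab {-b..0}" using slab_on_subset[OF W(2)] slab_mono[of "{-h-a..-a}" "{-b..0}"] h by force
      have ST: "?S \<subseteq> T" using Ssub slab_subset_T[of "{-b..0}"] b by force
      define n where "n = nat \<lfloor>b / (2 * h)\<rfloor>"
      have n: "real n \<le> b / (2 * h)" unfolding n_def using h b by (simp add: of_nat_floor)
      let ?\<Psi> = "\<lambda>k. (\<lambda>x. x - (real k * h) *\<^sub>R E x) ` ?S"
      have bnd: "?\<Psi> k \<in> lmeasurable \<and> measure lebesgue (?\<Psi> k) \<le> 2 * measure lebesgue ?S" if k: "k \<le> n" for k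
      proof -
        have "real k \<le> b / (2 * h)" using k n by linarith
        then have "real k * h \<le> b / 2" using h(1) by (simp add: field_simps)
        then have r: "\<bar>real k * h\<bar> \<le> b" using h b by simp
        have "\<bar>det (mat 1 - (real k * h) *\<^sub>R D x)\<bar> \<le> 2" if "x \<in> ?S" for x
          using det2[OF _ r] that Ssub by blast
        then show ?thesis using shift_image_bound[OF Sm ST] by blast
      qed
      have cover: "?Q \<subseteq> (\<Union>k\<in>{..n}. ?\<Psi> k)"
      proof
        fix x assume "x \<in> ?Q"
        then obtain p t where p: "p \<in> ?W" "-b/2 \<le> t" "t \<le> -b/4" "x = p + t *\<^sub>R \<eta> p" unfolding slab_on_def by auto
        \<comment> \<open>Its integer part k is the number of steps h that raise x from height t
          into the slab. \<open>t \<le> -b/4\<close> and \<open>a \<le> h \<le> b/4\<close> make z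
          nonnegative.\<close>
        define z where "z = (-a - t) / h"
        have z0: "z \<ge> 0" unfolding z_def using p h by (intro divide_nonneg_pos) auto
        define k where "k = nat \<lfloor>z\<rfloor>"
        have k: "real k \<le> z" "z < real k + 1" unfolding k_def using z0 by linarith+
        have "z \<le> (b / 2) / h" unfolding z_def using p h by (intro divide_right_mono) auto
        then have zb: "z \<le> b / (2 * h)" by simp
        have "k \<le> n" unfolding k_def n_def using zb by (intro nat_mono floor_mono)
        define t' where "t' = t + real k * h"
        have "real k * h \<le> z * h" "z * h < (real k + 1) * h" using k h(1) by (auto intro: mult_right_mono)
        moreover have "z * h = - a - t" unfolding z_def using h(1) by simp
        ultimately have t': "t' \<in> {-h-a..-a}" unfolding t'_def by (auto simp: algebra_simps)
        have x': "p + t' *\<^sub>R \<eta> p \<in> ?S" unfolding slab_on_def using p(1) t' by blast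
        have "E (p + t' *\<^sub>R \<eta> p) = \<eta> p" using E_tube[of p t'] p(1) t' h b by auto
        then have "x = (\<lambda>x. x - (real k * h) *\<^sub>R E x) (p + t' *\<^sub>R \<eta> p)" unfolding p(4) t'_def by (simp add: algebra_simps)
        then show "x \<in> (\<Union>k\<in>{..n}. ?\<Psi> k)" using x' \<open>k \<le> n\<close> by blast
      qed
      have "measure lebesgue ?Q \<le> measure lebesgue (\<Union>k\<in>{..n}. ?\<Psi> k)"
        using lmeasurable_compact[OF Qc] bnd
        by (intro measure_mono_fmeasurable[OF cover] fmeasurable.finite_UN) (auto dest: fmeasurableD)
      also have "\<dots> \<le> (\<Sum>k\<le>n. measure lebesgue (?\<Psi> k))"
        by (rule measure_UNION_le) (use bnd in \<open>auto dest: fmeasurableD\<close>)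
      also have "\<dots> \<le> (\<Sum>k\<le>n. 2 * measure lebesgue ?S)" using bnd by (intro sum_mono) auto
      also have "\<dots> = (real n + 1) * (2 * measure lebesgue ?S)" by simp
      also have "\<dots> \<le> (b / h) * (2 * measure lebesgue ?S)"
      proof (rule mult_right_mono)
        have "1 \<le> b / (2 * h)" using h by (simp add: field_simps)
        then show "real n + 1 \<le> b / h" using n by (simp add: field_simps)
      qed simp
      finally show "measure lebesgue ?Q / (2 * b) * h \<le> measure lebesgue ?S"
        using h(1) b(1) by (simp add: field_simps)
    qed
  qed
qed

end

section \<open>Volumes of thin slabs and the covering estimate\<close>

context cmc_tube
begin

lemma trace_D_near_M:
  assumes "\<omega> > 0"
  obtains b where "b > 0" "b < \<delta>0" "\<forall>x\<in>slab {-b..0}. \<bar>trace (D x) - 2 * c\<bar> \<le> \<omega>"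
proof -
  have "continuous_on (T \<times> UNIV) (\<lambda>z::(real^3) \<times> real. trace (D (fst z)))"
    by (rule continuous_on_compose2[OF continuous_on_trace_D]) (auto intro!: continuous_intros)
  then obtain b where b: "b > 0" "b < \<delta>0"
    "\<forall>p\<in>M. \<forall>t r r'. -b \<le> t \<and> t \<le> 0 \<and> \<bar>r\<bar> \<le> (0::real) \<and> \<bar>r'\<bar> \<le> 0 \<and> \<bar>r - r'\<bar> \<le> b \<longrightarrow>
       \<bar>(\<lambda>z::(real^3) \<times> real. trace (D (fst z))) (p + t *\<^sub>R \<eta> p, r) - (\<lambda>z. trace (D (fst z))) (p, r')\<bar> \<le> \<omega>"
    by (rule uniform_on_tube[OF _ assms])
  have "\<bar>trace (D x) - 2 * c\<bar> \<le> \<omega>" if x: "x \<in> slab {-b..0}" for x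
  proof -
    obtain p t where "p \<in> M" "-b \<le> t" "t \<le> 0" "x = p + t *\<^sub>R \<eta> p" using x unfolding slab_def by auto
    then show ?thesis using b(3)[rule_format, of p t 0 0] b(1) trace_D[of p] by simp
  qed
  then show ?thesis using that b(1,2) by blast
qed

lemma support_bound:
  obtains R where "R > 0" "\<forall>x\<in>slab {-\<delta>0/2..0}. \<bar>x \<bullet> G (E x)\<bar> \<le> R"
proof -
  have sub: "{-\<delta>0/2..0} \<subseteq> {-\<delta>0<..<\<delta>0}" using \<delta>0 by auto
  have "compact ((\<lambda>x. x \<bullet> G (E x)) ` slab {-\<delta>0/2..0})"
    by (intro compact_continuous_image compact_slab compact_Icc continuous_on_subset[OF _ slab_subset_T[OF sub]]
        continuous_on_inner continuous_on_id continuous_on_GE)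
  then have "bounded ((\<lambda>x. x \<bullet> G (E x)) ` slab {-\<delta>0/2..0})" by (rule compact_imp_bounded)
  then obtain R where "R > 0" "\<forall>z\<in>(\<lambda>x. x \<bullet> G (E x)) ` slab {-\<delta>0/2..0}. norm z \<le> R" unfolding bounded_pos by blast
  then show ?thesis using that by auto
qed

lemma thin_slab_volume:
  assumes "\<tau> > 0" "\<tau> \<le> 1/2"
  obtains b where "b > 0" "b < \<delta>0"
    "\<forall>h a. 0 < h \<and> 0 < a \<and> h + 2 * a \<le> b \<longrightarrow> c > 0 \<and>
       (2 - \<tau>) * measure lebesgue (slab {-h-a..-a}) \<le> 6 * c * (h + 2 * a) * measure lebesgue (inside M)"
proof -
  obtain R where R: "R > 0" "\<forall>x\<in>slab {-\<delta>0/2..0}. \<bar>x \<bullet> G (E x)\<bar> \<le> R" by (rule support_bound)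
  \<comment> \<open>With trace error \<omega> = \<tau> / R the product \<omega> R in
    \<open>slab_volume_bound\<close> is \<tau>.\<close>
  obtain b0 where b0: "b0 > 0" "b0 < \<delta>0" "\<forall>x\<in>slab {-b0..0}. \<bar>trace (D x) - 2 * c\<bar> \<le> \<tau> / R"
    by (rule trace_D_near_M[of "\<tau> / R"]) (use assms R in auto)
  define b where "b = min b0 (\<delta>0 / 2)"
  have b: "b > 0" "b < \<delta>0" "b \<le> b0" "b \<le> \<delta>0 / 2" unfolding b_def using b0 \<delta>0 by auto
  have "c > 0 \<and> (2 - \<tau>) * measure lebesgue (slab {-h-a..-a}) \<le> 6 * c * (h + 2 * a) * measure lebesgue (inside M)"
    if h: "0 < h" "0 < a" "h + 2 * a \<le> b" for h a
  proof -
    have sub: "slab {-(h + 2 * a)..0} \<subseteq> slab {-b0..0}" "slab {-(h + 2 * a)..0} \<subseteq> slab {-\<delta>0/2..0}"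
      using h b by (auto intro!: slab_mono)
    have 1: "\<bar>trace (D x) - 2 * c\<bar> \<le> \<tau> / R" "\<bar>x \<bullet> G (E x)\<bar> \<le> R" if "x \<in> slab {-(h + 2 * a)..0}" for x
      using b0(3) R(2) sub that by blast+
    have 2: "\<tau> / R * R \<le> 1" "\<tau> / R * R = \<tau>" using R(1) assms by auto
    have 3: "h + 2 * a < \<delta>0" using h b by linarith
    have borel: "slab {-h-a..-a} \<in> sets borel" "inside M \<in> sets borel"
      using compact_slab[of "{-h-a..-a}"] open_inside[OF compact_imp_closed[OF compact_M]] by (auto simp: borel_compact)
    show ?thesis
      using slab_volume_bound(2,3)[OF h(2,1) 3 1 2(1)] borel unfolding 2(2) by (simp add: measure_completion)
  qed
  then show ?thesis using that b(1,2) by blast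
qed

lemma c_pos: "c > 0"
proof -
  obtain b where "b > 0" "b < \<delta>0"
    "\<forall>h a. 0 < h \<and> 0 < a \<and> h + 2 * a \<le> b \<longrightarrow> c > 0 \<and>
       (2 - 1/2) * measure lebesgue (slab {-h-a..-a}) \<le> 6 * c * (h + 2 * a) * measure lebesgue (inside M)"
    by (rule thin_slab_volume[of "1/2"]) auto
  from this(1) this(3)[rule_format, of "b / 2" "b / 4"] show ?thesis by simp
qed

text \<open>If p is a point of M nearest to y and \<open>y = p - d \<eta>(p)\<close>, then \<open>y = x - r i E(x)\<close> for some point x of the
  slab on the normal through p, where \<open>r i\<close> is the multiple of h for which \<open>d - r i\<close> lies between a and
  h + a; since d can be smaller than a, the multiples start at -h.\<close>

lemma interior_covering:
  fixes n :: nat and \<beta> r :: "nat \<Rightarrow> real"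
  assumes n: "n > 0" and h: "h = 1 / (c * real n)" and a: "0 < a" "a \<le> h" and b: "2 * h \<le> b" "b < \<delta>0"
    and R0: "R0 \<ge> 1 / c" and \<epsilon>: "\<epsilon> \<ge> 0"
    and unif: "\<forall>p\<in>M. \<forall>t r r'. -b \<le> t \<and> t \<le> 0 \<and> \<bar>r\<bar> \<le> R0 \<and> \<bar>r'\<bar> \<le> R0 \<and> \<bar>r - r'\<bar> \<le> b \<longrightarrow>
       \<bar>det (mat 1 - r *\<^sub>R D (p + t *\<^sub>R \<eta> p)) - det (mat 1 - r' *\<^sub>R D p)\<bar> \<le> \<epsilon>"
    and W: "W \<subseteq> M" "compact W" and \<kappa>0: "\<forall>p\<in>W. defect p \<ge> \<kappa>0"
    and \<kappa>1: "0 \<le> \<kappa>1" "\<kappa>1 \<le> 1/4" "16 * c\<^sup>2 * \<kappa>1 \<le> \<kappa>0"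
    and r: "\<And>i. r i = (real i - 1) * h"
    and \<beta>: "\<And>i. \<beta> i = (if 1/4 \<le> r i * c \<and> r i * c \<le> 1/2 then \<kappa>1 else 0)"
  shows "measure lebesgue (inside M) \<le>
      (\<Sum>i\<le>n. (1 - r i * c)\<^sup>2 + 2 * \<epsilon>) * measure lebesgue (slab {-h-a..-a})
      - (\<Sum>i\<le>n. \<beta> i) * measure lebesgue (slab_on W {-h-a..-a})"
proof -
  have c: "c > 0" by (rule c_pos)
  have h0: "h > 0" unfolding h using c n by simp
  have hn: "h * real n = 1 / c" unfolding h using c n by simp
  let ?S = "slab {-h-a..-a}" and ?SW = "slab_on W {-h-a..-a}"
  have hb: "h + a \<le> b" using a b by linarith
  have sub: "{-h-a..-a} \<subseteq> {-\<delta>0<..<\<delta>0}" using hb b a h0 by auto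
  have ST: "?S \<subseteq> T" by (rule slab_subset_T[OF sub])
  have Sc: "compact ?S" and SWc: "compact ?SW"
    using compact_slab compact_slab_on[OF W(2,1)] by auto
  have SWS: "?SW \<subseteq> ?S" by (rule slab_on_subset[OF W(1)])
  define f where "f = (\<lambda>i x. \<bar>det (mat 1 - r i *\<^sub>R D x)\<bar>)"
  define B2 where "B2 = (\<lambda>i. (1 - r i * c)\<^sup>2 + 2 * \<epsilon>)"
  define B1 where "B1 = (\<lambda>i. B2 i - \<beta> i)"
  have B2: "B2 i \<ge> 0" for i unfolding B2_def using \<epsilon> by simp
  have B1: "B1 i \<ge> 0" for i
  proof (cases "1/4 \<le> r i * c \<and> r i * c \<le> 1/2")
    case True
    \<comment> \<open>For these shifts the square is at least 1/4, which is why
      \<open>\<kappa>1 \<le> 1/4\<close> keeps the reduced bound nonnegative.\<close>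
    then have "(1/2)\<^sup>2 \<le> (1 - r i * c)\<^sup>2" by (intro power_mono) auto
    then show ?thesis unfolding B1_def B2_def \<beta> using \<kappa>1 \<epsilon> by (simp add: power2_eq_square)
  next
    case False
    then show ?thesis unfolding B1_def \<beta> using B2 by auto
  qed
  \<comment> \<open>A normal may cease to be minimising before the shift is complete, and the
    determinant can then exceed the bound. Only points that obey the bound are moved; those reached
    from nearest points always do.\<close>
  define C1 where "C1 = (\<lambda>i. ?SW \<inter> f i -` {..B1 i})"
  define C2 where "C2 = (\<lambda>i. (?S \<inter> f i -` {..B2 i}) - ?SW)"
  have contf: "continuous_on ?S (f i)" for i
    unfolding f_def by (intro continuous_on_rabs continuous_on_subset[OF continuous_on_det_D ST])
  have C1c: "compact (C1 i)" for i
  proof -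
    have "closed (C1 i)" unfolding C1_def
      by (rule continuous_closed_preimage[OF continuous_on_subset[OF contf SWS]]) (auto simp: SWc compact_imp_closed)
    then show ?thesis using compact_Int_closed[OF SWc, of "C1 i"] unfolding C1_def by (simp add: Int_absorb1 inf_left_idem)
  qed
  have C2m: "C2 i \<in> lmeasurable" for i
  proof -
    have "closed (?S \<inter> f i -` {..B2 i})"
      by (rule continuous_closed_preimage[OF contf]) (auto simp: Sc compact_imp_closed)
    then have "compact (?S \<inter> f i -` {..B2 i})" using compact_Int_closed[OF Sc, of "?S \<inter> f i -` {..B2 i}"] by (simp add: inf_left_idem)
    then show ?thesis unfolding C2_def using SWc by (intro fmeasurable_Diff lmeasurable_compact) (auto dest: lmeasurable_compact fmeasurableD)
  qed
  let ?mS = "measure lebesgue ?S" and ?mW = "measure lebesgue ?SW"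
  have Sm: "?S \<in> lmeasurable" "?SW \<in> lmeasurable" using Sc SWc lmeasurable_compact by auto
  define P where "P = (\<lambda>i X. (\<lambda>x. x - r i *\<^sub>R E x) ` X)"
  have P1: "P i (C1 i) \<in> lmeasurable" "measure lebesgue (P i (C1 i)) \<le> B1 i * ?mW" for i
  proof -
    have m: "C1 i \<in> lmeasurable" "C1 i \<subseteq> T" using C1c lmeasurable_compact SWS ST unfolding C1_def by auto
    have bd: "\<bar>det (mat 1 - r i *\<^sub>R D x)\<bar> \<le> B1 i" if "x \<in> C1 i" for x using that unfolding C1_def f_def by simp
    show "P i (C1 i) \<in> lmeasurable" unfolding P_def by (rule shift_image_bound(1)[OF m bd])
    have "measure lebesgue (P i (C1 i)) \<le> B1 i * measure lebesgue (C1 i)"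
      unfolding P_def by (rule shift_image_bound(2)[OF m bd])
    also have "\<dots> \<le> B1 i * ?mW"
      by (intro mult_left_mono B1 measure_mono_fmeasurable) (use Sm m fmeasurableD in \<open>auto simp: C1_def\<close>)
    finally show "measure lebesgue (P i (C1 i)) \<le> B1 i * ?mW" .
  qed
  have P2: "P i (C2 i) \<in> lmeasurable" "measure lebesgue (P i (C2 i)) \<le> B2 i * (?mS - ?mW)" for i
  proof -
    have m: "C2 i \<in> lmeasurable" "C2 i \<subseteq> T" using C2m ST unfolding C2_def by auto
    have bd: "\<bar>det (mat 1 - r i *\<^sub>R D x)\<bar> \<le> B2 i" if "x \<in> C2 i" for x using that unfolding C2_def f_def by simp
    show "P i (C2 i) \<in> lmeasurable" unfolding P_def by (rule shift_image_bound(1)[OF m bd])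
    have "measure lebesgue (P i (C2 i)) \<le> B2 i * measure lebesgue (C2 i)"
      unfolding P_def by (rule shift_image_bound(2)[OF m bd])
    also have "\<dots> \<le> B2 i * measure lebesgue (?S - ?SW)"
      by (intro mult_left_mono B2 measure_mono_fmeasurable fmeasurable_Diff) (use Sm m fmeasurableD in \<open>auto simp: C2_def\<close>)
    also have "measure lebesgue (?S - ?SW) = ?mS - ?mW"
      by (rule measurable_measure_Diff) (use Sm SWS fmeasurableD in auto)
    finally show "measure lebesgue (P i (C2 i)) \<le> B2 i * (?mS - ?mW)" .
  qed
  have cover: "inside M \<subseteq> (\<Union>i\<in>{..n}. P i (C1 i) \<union> P i (C2 i))"
  proof
    fix y assume "y \<in> inside M"
    then obtain p d where p: "p \<in> M" "d > 0" "y = p - d *\<^sub>R \<eta> p" "d * c \<le> 1" "(1 - d * c)\<^sup>2 - d\<^sup>2 * defect p \<ge> 0"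
      by (rule nearest_point)
    define z where "z = (d - a) / h"
    define j where "j = \<lfloor>z\<rfloor>"
    have j: "of_int j \<le> z" "z < of_int j + 1" unfolding j_def by linarith+
    have "of_int j * h \<le> z * h" "z * h < (of_int j + 1) * h" using j h0 by (auto intro: mult_right_mono)
    moreover have "z * h = d - a" unfolding z_def using h0 by simp
    ultimately have jh: "of_int j * h \<le> d - a" "d - a < of_int j * h + h"
      by (auto simp: algebra_simps)
    have d_le: "d \<le> 1 / c" using p(4) c by (simp add: field_simps)
    have "-1 < real_of_int j + 1"
    proof -
      have "- h < d - a" using p(2) a by linarith
      then have "- h < of_int j * h + h" using jh by linarith
      then have "h * (-1) < h * (of_int j + 1)" by (simp add: algebra_simps)
      then show ?thesis using h0 by (simp only: mult_less_cancel_left_pos)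
    qed
    then have j_ge: "j \<ge> -1" by linarith
    have "of_int j * h < h * real n" using jh d_le a unfolding hn by linarith
    then have "real_of_int j < real n" using h0 by (simp add: mult.commute[of h])
    then have j_lt: "j < int n" by linarith
    define i where "i = nat (j + 1)"
    have i: "i \<le> n" "real i - 1 = of_int j" unfolding i_def using j_ge j_lt by auto
    have ri: "r i = of_int j * h" unfolding r i(2) ..
    have r_le: "r i \<le> 1 / c" unfolding ri using jh d_le a by linarith
    have r_ge: "r i \<ge> - h" unfolding ri using j_ge h0 mult_right_mono[of "-1" "of_int j" h] by simp
    have h_le: "h \<le> 1 / c" using mult_left_mono[of 1 "real n" h] n h0 hn by simp
    define t where "t = r i - d"
    have t: "t \<in> {-h-a..-a}" unfolding t_def ri using jh by auto
    have tb: "-b \<le> t" "t \<le> 0" "\<bar>r i - d\<bar> \<le> b" "\<bar>t\<bar> < \<delta>0" using t hb a h0 b unfolding t_def by auto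
    have rR: "\<bar>r i\<bar> \<le> R0" "\<bar>d\<bar> \<le> R0" using r_le r_ge h_le d_le p(2) R0 by auto
    define x where "x = p + t *\<^sub>R \<eta> p"
    have xS: "x \<in> ?S" unfolding x_def slab_def using p(1) t by blast
    have Ex: "E x = \<eta> p" unfolding x_def by (rule E_tube[OF p(1) tb(4)])
    have yx: "y = x - r i *\<^sub>R E x" unfolding Ex unfolding p(3) x_def t_def by (simp add: algebra_simps)
    \<comment> \<open>The comparison goes through the true distance d, where
      \<open>nearest_point\<close> makes the determinant nonnegative and the absolute value
      harmless; returning to \<open>r i\<close> costs a second \<epsilon>.\<close>
    have u1: "\<bar>det (mat 1 - r i *\<^sub>R D x) - det (mat 1 - d *\<^sub>R D p)\<bar> \<le> \<epsilon>"
      unfolding x_def using unif[rule_format, of p t "r i" d] p(1) tb rR by blast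
    have u2: "\<bar>det (mat 1 - r i *\<^sub>R D p) - det (mat 1 - d *\<^sub>R D p)\<bar> \<le> \<epsilon>"
      using unif[rule_format, of p 0 "r i" d] p(1) tb rR by auto
    have fx: "f i x \<le> (1 - r i * c)\<^sup>2 - (r i)\<^sup>2 * defect p + 2 * \<epsilon>"
      using u1 u2 p(5) unfolding f_def shape_operator(2)[OF p(1)] by linarith
    have "(r i)\<^sup>2 * defect p \<ge> 0" using shape_operator(1)[OF p(1)] by simp
    then have fB2: "f i x \<le> B2 i" using fx unfolding B2_def by linarith
    show "y \<in> (\<Union>i\<in>{..n}. P i (C1 i) \<union> P i (C2 i))"
    proof (cases "p \<in> W")
      case True
      have "f i x \<le> B1 i"
      proof (cases "1/4 \<le> r i * c \<and> r i * c \<le> 1/2")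
        case rc: True
        \<comment> \<open>From \<open>r i * c \<ge> 1/4\<close> and
          \<open>16 * c\<^sup>2 * \<kappa>1 \<le> \<kappa>0\<close> the defect lowers the
          determinant by at least \<kappa>1; this is the origin of the constant 16.\<close>
        have "(1/4)\<^sup>2 \<le> (r i * c)\<^sup>2" using rc by (intro power_mono) auto
        moreover have "(1/4 :: real)\<^sup>2 = 1/16" by (simp add: power2_eq_square)
        ultimately have "1/16 \<le> (r i)\<^sup>2 * c\<^sup>2" by (simp only: power_mult_distrib)
        then have "1/16 * (16 * \<kappa>1) \<le> (r i)\<^sup>2 * c\<^sup>2 * (16 * \<kappa>1)" using \<kappa>1(1) by (intro mult_right_mono) auto
        also have "\<dots> = (r i)\<^sup>2 * (16 * c\<^sup>2 * \<kappa>1)" by simp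
        also have "\<dots> \<le> (r i)\<^sup>2 * defect p" using \<kappa>1(3) \<kappa>0 True by (intro mult_left_mono) force+
        finally show ?thesis using fx rc unfolding B1_def B2_def \<beta> by simp
      next
        case False
        then show ?thesis unfolding B1_def \<beta> using fB2 by auto
      qed
      moreover have "x \<in> ?SW" unfolding x_def slab_on_def using True t by blast
      ultimately have "x \<in> C1 i" unfolding C1_def by simp
      then show ?thesis using i(1) yx unfolding P_def by blast
    next
      case False
      have "x \<notin> ?SW"
      proof
        assume "x \<in> ?SW"
        then obtain q u where q: "q \<in> W" "u \<in> {-h-a..-a}" "x = q + u *\<^sub>R \<eta> q" unfolding slab_on_def by blast
        have qM: "q \<in> M" using q(1) W(1) by blast
        have "u \<in> {-\<delta>0<..<\<delta>0}" using q(2) sub by blast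
        then have ub: "\<bar>u\<bar> < \<delta>0" by auto
        have "s x = u" "E x = \<eta> q" using s_tube[OF qM ub] E_tube[OF qM ub] unfolding q(3) by simp_all
        moreover have "s x = t" unfolding x_def by (rule s_tube[OF p(1) tb(4)])
        ultimately have "u = t" "\<eta> q = \<eta> p" using Ex by simp_all
        then have "q = p" using q(3) unfolding x_def by simp
        then show False using q(1) False by simp
      qed
      then have "x \<in> C2 i" unfolding C2_def using xS fB2 by simp
      then show ?thesis using i(1) yx unfolding P_def by blast
    qed
  qed
  have Pm: "P i (C1 i) \<union> P i (C2 i) \<in> lmeasurable" for i using P1 P2 by (intro fmeasurable.Un)
  have "inside M \<in> sets lebesgue"
    using open_inside[OF compact_imp_closed[OF compact_M]] by (intro sets_completionI_sets) auto
  then have "measure lebesgue (inside M) \<le> measure lebesgue (\<Union>i\<in>{..n}. P i (C1 i) \<union> P i (C2 i))"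
    using Pm by (intro measure_mono_fmeasurable[OF cover] fmeasurable.finite_UN) auto
  also have "\<dots> \<le> (\<Sum>i\<le>n. measure lebesgue (P i (C1 i) \<union> P i (C2 i)))"
    by (rule measure_UNION_le) (use Pm in \<open>auto dest: fmeasurableD\<close>)
  also have "\<dots> \<le> (\<Sum>i\<le>n. B2 i * ?mS - \<beta> i * ?mW)"
  proof (rule sum_mono)
    fix i
    have "measure lebesgue (P i (C1 i) \<union> P i (C2 i)) \<le> measure lebesgue (P i (C1 i)) + measure lebesgue (P i (C2 i))"
      using P1(1) P2(1) by (intro measure_Un_le) (auto dest: fmeasurableD)
    also have "\<dots> \<le> B1 i * ?mW + B2 i * (?mS - ?mW)" by (intro add_mono P1 P2)
    also have "\<dots> = B2 i * ?mS - \<beta> i * ?mW" unfolding B1_def by (simp add: algebra_simps)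
    finally show "measure lebesgue (P i (C1 i) \<union> P i (C2 i)) \<le> B2 i * ?mS - \<beta> i * ?mW" .
  qed
  also have "\<dots> = (\<Sum>i\<le>n. B2 i) * ?mS - (\<Sum>i\<le>n. \<beta> i) * ?mW"
    by (simp add: sum_subtractf sum_distrib_right)
  finally show ?thesis unfolding B2_def .
qed

end

section \<open>Surfaces of constant mean curvature are umbilic\<close>

context cmc_tube
begin

text \<open>A positive defect persists on a patch W around p0. About a quarter of the n shifts then
  save \<kappa>1 times the volume of a slab over W, which is at least w h; the total saving \<gamma>
  does not depend on \<tau>, while the factor on the right tends to 1 with \<tau>.\<close>

lemma interior_volume_gap:
  assumes p0: "p0 \<in> M" and pos: "defect p0 > 0"
  obtains \<gamma> where "\<gamma> > 0"
    "\<forall>\<tau>. 0 < \<tau> \<and> \<tau> \<le> 1/2 \<longrightarrow> measure lebesgue (inside M) + \<gamma> \<le>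
       (2 * (1 + \<tau>) ^ 3 + 12 * \<tau> * (1 + \<tau>)) * ((1 + 2 * \<tau>) / (2 - \<tau>)) * measure lebesgue (inside M)"
proof -
  let ?V = "measure lebesgue (inside M)"
  have c: "c > 0" by (rule c_pos)
  define \<kappa>0 where "\<kappa>0 = defect p0 / 2"
  have "isCont defect p0"
  proof -
    have "continuous_on T defect" unfolding defect_def[abs_def]
      using continuous_on_det_D[of 1] by (intro continuous_on_diff continuous_on_const) simp
    then show ?thesis using M_in_T p0 open_T by (auto simp: continuous_on_eq_continuous_at)
  qed
  moreover have "defect p0 > \<kappa>0" unfolding \<kappa>0_def using pos by simp
  ultimately have "\<forall>\<^sub>F x in at p0. defect x > \<kappa>0" unfolding isCont_def by (intro order_tendstoD(1))
  then obtain \<rho>1 where \<rho>1: "\<rho>1 > 0" "\<And>x. x \<noteq> p0 \<Longrightarrow> dist x p0 < \<rho>1 \<Longrightarrow> defect x > \<kappa>0"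
    unfolding eventually_at by auto
  define \<rho> where "\<rho> = \<rho>1 / 2"
  have \<rho>: "\<rho> > 0" unfolding \<rho>_def using \<rho>1 by simp
  let ?W = "M \<inter> cball p0 \<rho>"
  have W: "?W \<subseteq> M" "compact ?W" using compact_M by auto
  have \<kappa>W: "\<forall>p\<in>?W. defect p \<ge> \<kappa>0"
  proof
    fix p assume "p \<in> ?W"
    then have "dist p p0 < \<rho>1" using \<rho>1(1) unfolding \<rho>_def by (simp add: dist_commute)
    then show "defect p \<ge> \<kappa>0" using \<rho>1(2)[of p] \<open>defect p0 > \<kappa>0\<close> by (cases "p = p0") auto
  qed
  obtain w h0 where w: "w > 0" "h0 > 0" "h0 < \<delta>0"
    "\<forall>h a. 0 < h \<and> h \<le> h0 \<and> 0 < a \<and> a \<le> h \<longrightarrow> measure lebesgue (slab_on ?W {-h-a..-a}) \<ge> w * h"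
    by (rule slab_on_volume_lower_bound[OF p0 \<rho>])
  define \<kappa>1 where "\<kappa>1 = min (1/4) (\<kappa>0 / (16 * c\<^sup>2))"
  have \<kappa>1: "0 < \<kappa>1" "\<kappa>1 \<le> 1/4" "16 * c\<^sup>2 * \<kappa>1 \<le> \<kappa>0"
  proof -
    show "0 < \<kappa>1" "\<kappa>1 \<le> 1/4" unfolding \<kappa>1_def \<kappa>0_def using pos c by auto
    have "16 * c\<^sup>2 * \<kappa>1 \<le> 16 * c\<^sup>2 * (\<kappa>0 / (16 * c\<^sup>2))" unfolding \<kappa>1_def using c by (intro mult_left_mono) auto
    then show "16 * c\<^sup>2 * \<kappa>1 \<le> \<kappa>0" using c by simp
  qed
  \<comment> \<open>With n = 4m and h = 1 / (cn) this is m savings of size \<kappa>1 w h, whatever m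
    is.\<close>
  define \<gamma> where "\<gamma> = \<kappa>1 * w / (4 * c)"
  have "\<gamma> > 0" unfolding \<gamma>_def using \<kappa>1 w c by simp
  moreover have "?V + \<gamma> \<le> (2 * (1 + \<tau>) ^ 3 + 12 * \<tau> * (1 + \<tau>)) * ((1 + 2 * \<tau>) / (2 - \<tau>)) * ?V"
    if \<tau>: "0 < \<tau>" "\<tau> \<le> 1/2" for \<tau>
  proof -
    obtain b1 where b1: "b1 > 0" "b1 < \<delta>0"
      "\<forall>h a. 0 < h \<and> 0 < a \<and> h + 2 * a \<le> b1 \<longrightarrow> c > 0 \<and>
         (2 - \<tau>) * measure lebesgue (slab {-h-a..-a}) \<le> 6 * c * (h + 2 * a) * ?V"
      by (rule thin_slab_volume[OF \<tau>])
    obtain b2 where b2: "b2 > 0" "b2 < \<delta>0"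
      "\<forall>p\<in>M. \<forall>t r r'. -b2 \<le> t \<and> t \<le> 0 \<and> \<bar>r\<bar> \<le> 1 / c \<and> \<bar>r'\<bar> \<le> 1 / c \<and> \<bar>r - r'\<bar> \<le> b2 \<longrightarrow>
       \<bar>(\<lambda>z. det (mat 1 - snd z *\<^sub>R D (fst z))) (p + t *\<^sub>R \<eta> p, r) - (\<lambda>z. det (mat 1 - snd z *\<^sub>R D (fst z))) (p, r')\<bar> \<le> \<tau>"
      by (rule uniform_on_tube[OF continuous_on_shift_det \<tau>(1), of "1 / c"])
    define b where "b = min b1 (min b2 h0)"
    have b: "b > 0" "b \<le> b1" "b \<le> b2" "b \<le> h0" "b < \<delta>0" unfolding b_def using b1 b2 w by auto
    \<comment> \<open>The summand 1 / \<tau> yields \<open>u \<le> \<tau> / 2\<close>, the summand 1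
      / (cb) yields \<open>2 * h \<le> b\<close>.\<close>
    obtain m :: nat where m: "real m \<ge> 1 / \<tau> + 1 / (c * b)" using real_arch_simple by blast
    have pq: "1 / \<tau> > 0" "1 / (c * b) > 0" using \<tau> c b by auto
    have m0: "m > 0" using m pq by (cases m) auto
    define n where "n = 4 * m"
    have n: "n > 0" "real n = 4 * real m" unfolding n_def using m0 by auto
    define u where "u = 1 / real n"
    have u: "u > 0" unfolding u_def using n by simp
    have u\<tau>: "u \<le> \<tau> / 2"
    proof -
      have "1 / \<tau> \<le> real m" using m pq by linarith
      then have "1 \<le> real m * \<tau>" using \<tau> by (simp add: field_simps)
      then have "2 \<le> real n * \<tau>" unfolding n(2) by linarith
      then show ?thesis unfolding u_def using n by (simp add: field_simps)
    qed
    define h where "h = 1 / (c * real n)"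
    have h0': "h > 0" unfolding h_def using c n by simp
    have hb: "2 * h \<le> b"
    proof -
      have "1 / (c * b) \<le> real m" using m pq by linarith
      then have "1 \<le> real m * (c * b)" using c b by (simp add: field_simps)
      then have "2 \<le> real n * (c * b)" unfolding n(2) by linarith
      then show ?thesis unfolding h_def using n c by (simp add: field_simps)
    qed
    have ch: "c * h = u" unfolding h_def u_def using c by simp
    \<comment> \<open>Ramps of relative width \<tau>, so that h + 2a exceeds h by the factor 1 +
      2\<tau> only.\<close>
    define a where "a = \<tau> * h"
    have a: "0 < a" "a \<le> h" "h + 2 * a \<le> 2 * h" unfolding a_def using \<tau> h0' by auto
    define r where "r = (\<lambda>i. (real i - 1) * h)"
    define \<beta> where "\<beta> = (\<lambda>i::nat. if 1/4 \<le> r i * c \<and> r i * c \<le> 1/2 then \<kappa>1 else 0)"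
    let ?mS = "measure lebesgue (slab {-h-a..-a})" and ?mW = "measure lebesgue (slab_on ?W {-h-a..-a})"
    have cover: "?V \<le> (\<Sum>i\<le>n. (1 - r i * c)\<^sup>2 + 2 * \<tau>) * ?mS - (\<Sum>i\<le>n. \<beta> i) * ?mW"
    proof (rule interior_covering[OF n(1) h_def a(1,2) hb b(5) order_refl _ _ W \<kappa>W _ \<kappa>1(2,3)])
      show "\<forall>p\<in>M. \<forall>t r r'. -b \<le> t \<and> t \<le> 0 \<and> \<bar>r\<bar> \<le> 1 / c \<and> \<bar>r'\<bar> \<le> 1 / c \<and> \<bar>r - r'\<bar> \<le> b \<longrightarrow>
         \<bar>det (mat 1 - r *\<^sub>R D (p + t *\<^sub>R \<eta> p)) - det (mat 1 - r' *\<^sub>R D p)\<bar> \<le> \<tau>"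
      proof (intro ballI allI impI)
        fix p t r r' assume "p \<in> M" "-b \<le> t \<and> t \<le> 0 \<and> \<bar>r\<bar> \<le> 1 / c \<and> \<bar>r'\<bar> \<le> 1 / c \<and> \<bar>r - r'\<bar> \<le> b"
        then show "\<bar>det (mat 1 - r *\<^sub>R D (p + t *\<^sub>R \<eta> p)) - det (mat 1 - r' *\<^sub>R D p)\<bar> \<le> \<tau>"
          using b2(3)[rule_format, of p t r r'] b(3) by simp
      qed
    qed (use \<tau> \<kappa>1 in \<open>auto simp: r_def \<beta>_def\<close>)
    have rc: "r i * c = (real i - 1) * u" for i unfolding r_def ch[symmetric] by simp
    have nu: "real n * u = 1" unfolding u_def using n by simp
    have sum1: "(\<Sum>i\<le>n. (1 - r i * c)\<^sup>2 + 2 * \<tau>)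
        = u\<^sup>2 * ((real n + 1) * (real n + 2) * (2 * real n + 3) / 6) + 2 * \<tau> * (real n + 1)"
    proof -
      have "(1 - r i * c)\<^sup>2 = u\<^sup>2 * (real n + 1 - real i)\<^sup>2" for i
      proof -
        have "1 - r i * c = u * (real n + 1 - real i)" unfolding rc using nu by (simp add: algebra_simps)
        then show ?thesis by (simp add: power_mult_distrib)
      qed
      then have "(\<Sum>i\<le>n. (1 - r i * c)\<^sup>2 + 2 * \<tau>) = (\<Sum>i\<le>n. u\<^sup>2 * (real n + 1 - real i)\<^sup>2) + (\<Sum>i\<le>n. 2 * \<tau>)"
        by (simp add: sum.distrib)
      also have "(\<Sum>i\<le>n. u\<^sup>2 * (real n + 1 - real i)\<^sup>2) = u\<^sup>2 * (\<Sum>i\<le>n. (real n + 1 - real i)\<^sup>2)"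
        by (simp add: sum_distrib_left)
      finally show ?thesis unfolding sum_shifted_squares by simp
    qed
    have sum2: "(\<Sum>i\<le>n. \<beta> i) \<ge> real m * \<kappa>1"
    proof -
      \<comment> \<open>As n = 4m, the condition 1/4 \<le> (i - 1) / n \<le> 1/2 reads m \<le> i - 1
        \<le> 2m, which these m indices satisfy.\<close>
      have "(\<Sum>i\<in>{m+1..2*m}. \<beta> i) \<le> (\<Sum>i\<le>n. \<beta> i)"
        by (rule sum_mono2) (use \<kappa>1 in \<open>auto simp: n_def \<beta>_def\<close>)
      moreover have "\<beta> i = \<kappa>1" if i: "i \<in> {m+1..2*m}" for i
      proof -
        have "real m \<le> real i - 1" "real i - 1 \<le> 2 * real m" using i by auto
        then have "real m * u \<le> (real i - 1) * u" "(real i - 1) * u \<le> 2 * real m * u"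
          using u by (auto intro: mult_right_mono)
        moreover have "real m * u = 1/4" unfolding u_def n(2) using m0 by simp
        ultimately show ?thesis unfolding \<beta>_def rc by simp
      qed
      ultimately show ?thesis by simp
    qed
    have mW: "?mW \<ge> w * h" using w(4) a h0' hb b(4) by auto
    have "\<gamma> = (real m * \<kappa>1) * (w * h)" unfolding \<gamma>_def h_def n(2) using m0 c by (simp add: field_simps)
    also have "\<dots> \<le> (\<Sum>i\<le>n. \<beta> i) * ?mW"
      using sum2 mW \<kappa>1(1) w(1) h0' by (intro mult_mono) (auto intro: order_trans[OF _ sum2])
    finally have \<gamma>_le: "\<gamma> \<le> (\<Sum>i\<le>n. \<beta> i) * ?mW" .
    define A where "A = (\<Sum>i\<le>n. (1 - r i * c)\<^sup>2 + 2 * \<tau>)"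
    have A0: "A \<ge> 0" unfolding A_def using \<tau> by (intro sum_nonneg) auto
    have V\<gamma>: "?V + \<gamma> \<le> A * ?mS" using cover \<gamma>_le unfolding A_def by linarith
    have "(2 - \<tau>) * ?mS \<le> 6 * c * (h + 2 * a) * ?V" using b1(3) h0' a hb b(2) by auto
    also have "6 * c * (h + 2 * a) = 6 * u * (1 + 2 * \<tau>)" unfolding a_def ch[symmetric] by (simp add: algebra_simps)
    finally have "?mS \<le> 6 * u * (1 + 2 * \<tau>) * ?V / (2 - \<tau>)"
      using \<tau> by (simp add: pos_le_divide_eq mult.commute)
    then have mS: "?mS \<le> 6 * u * ((1 + 2 * \<tau>) / (2 - \<tau>)) * ?V" by simp
    have "A * ?mS \<le> A * (6 * u * ((1 + 2 * \<tau>) / (2 - \<tau>)) * ?V)" by (rule mult_left_mono[OF mS A0])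
    also have "\<dots> = (A * (6 * u)) * ((1 + 2 * \<tau>) / (2 - \<tau>)) * ?V" by simp
    also have "\<dots> \<le> (2 * (1 + \<tau>) ^ 3 + 12 * \<tau> * (1 + \<tau>)) * ((1 + 2 * \<tau>) / (2 - \<tau>)) * ?V"
    proof (intro mult_right_mono)
      \<comment> \<open>The sum of squares is cubic in n. The factor 6u of the slab volume and the
        \<open>u\<^sup>2\<close> of the summands give one u to each of its three factors, and n u =
        1 removes n.\<close>
      have gen: "(u\<^sup>2 * (Q / 6) + 2 * \<tau> * k) * (6 * u) = u * u * u * Q + 12 * \<tau> * (u * k)" for Q k
        by (simp add: power2_eq_square algebra_simps)
      have "A * (6 * u) = u * u * u * ((real n + 1) * (real n + 2) * (2 * real n + 3)) + 12 * \<tau> * (u * (real n + 1))"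
        unfolding A_def sum1 by (rule gen)
      also have "\<dots> = (real n * u + u) * (real n * u + 2 * u) * (2 * (real n * u) + 3 * u) + 12 * \<tau> * (real n * u + u)"
        by algebra
      also have "\<dots> = (1 + u) * (1 + 2 * u) * (2 + 3 * u) + 12 * \<tau> * (1 + u)" unfolding nu by simp
      also have "\<dots> \<le> (1 + \<tau>) * (1 + \<tau>) * (2 * (1 + \<tau>)) + 12 * \<tau> * (1 + \<tau>)"
        using u u\<tau> \<tau> by (intro add_mono mult_mono) auto
      also have "\<dots> = 2 * (1 + \<tau>) ^ 3 + 12 * \<tau> * (1 + \<tau>)" by (simp add: power3_eq_cube)
      finally show "A * (6 * u) \<le> 2 * (1 + \<tau>) ^ 3 + 12 * \<tau> * (1 + \<tau>)" .
    qed (use \<tau> in auto)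
    finally show ?thesis using V\<gamma> by linarith
  qed
  ultimately show ?thesis using that by blast
qed

text \<open>As \<tau> tends to 0 the factor in \<open>interior_volume_gap\<close> tends to 2 * (1/2)
  = 1, leaving V + \<gamma> \<le> V.\<close>

lemma umbilic: assumes p: "p \<in> M" shows "defect p = 0"
proof (rule ccontr)
  assume "defect p \<noteq> 0"
  then have "defect p > 0" using shape_operator(1)[OF p] by simp
  then obtain \<gamma> where \<gamma>: "\<gamma> > 0"
    "\<forall>\<tau>. 0 < \<tau> \<and> \<tau> \<le> 1/2 \<longrightarrow> measure lebesgue (inside M) + \<gamma> \<le>
       (2 * (1 + \<tau>) ^ 3 + 12 * \<tau> * (1 + \<tau>)) * ((1 + 2 * \<tau>) / (2 - \<tau>)) * measure lebesgue (inside M)"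
    by (rule interior_volume_gap[OF p])
  let ?f = "\<lambda>\<tau>. (2 * (1 + \<tau>) ^ 3 + 12 * \<tau> * (1 + \<tau>)) * ((1 + 2 * \<tau>) / (2 - \<tau>)) * measure lebesgue (inside M)"
  have "(?f \<longlongrightarrow> ?f 0) (at_right 0)" by (intro tendsto_intros) auto
  moreover have "\<forall>\<^sub>F \<tau> in at_right 0. measure lebesgue (inside M) + \<gamma> \<le> ?f \<tau>"
    unfolding eventually_at_right_field using \<gamma>(2) by (intro exI[of _ "1/2"]) auto
  ultimately have "measure lebesgue (inside M) + \<gamma> \<le> ?f 0" by (rule tendsto_lowerbound) simp
  then show False using \<gamma>(1) by simp
qed

section \<open>From umbilic surfaces to spheres\<close>

lemma umbilic_imp_sphere:
  assumes conn: "connected M"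
  obtains a where "\<forall>p\<in>M. \<eta> p = c *\<^sub>R (p - a)"
proof -
  have loc: "\<exists>U. openin (top_of_set M) U \<and> p \<in> U \<and> (\<forall>q\<in>U. \<eta> q - c *\<^sub>R q = \<eta> p - c *\<^sub>R p)" if p: "p \<in> M" for p
  proof -
    obtain V u0 \<phi> where ap: "adapted_parametrization V \<phi>" and u0: "u0 \<in> V" "\<phi> u0 = p"
      by (rule parametrization[OF p])
    have V: "open V" and sm: "smooth_on V \<phi>" and opn: "openin (top_of_set M) (\<phi> ` V)" and sub: "\<phi> ` V \<subseteq> M"
      and tan: "\<And>u a. u \<in> V \<Longrightarrow> frechet_derivative \<phi> (at u) a \<in> tangent_space M (\<phi> u)"
      using ap unfolding adapted_parametrization_def by blast+
    obtain \<psi> where hom: "homeomorphism V (\<phi> ` V) \<phi> \<psi>"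
      using ap unfolding adapted_parametrization_def by blast
    obtain e where e: "e > 0" "ball u0 e \<subseteq> V" using V u0(1) openE by blast
    have u0_in: "u0 \<in> ball u0 e" by (rule centre_in_ball[THEN iffD2, OF e(1)])
    let ?g = "\<lambda>u. E (\<phi> u) - c *\<^sub>R \<phi> u"
    have dg: "(?g has_derivative (\<lambda>a. 0)) (at u within ball u0 e)" if u: "u \<in> ball u0 e" for u
    proof -
      have uV: "u \<in> V" using u e(2) by blast
      have M: "\<phi> u \<in> M" using uV sub by blast
      note d\<phi> = smooth_on_imp_has_derivative[OF sm uV]
      have "(?g has_derivative (\<lambda>a. D (\<phi> u) *v frechet_derivative \<phi> (at u) a - c *\<^sub>R frechet_derivative \<phi> (at u) a)) (at u)"
        using M M_in_T by (intro has_derivative_diff has_derivative_compose[where g = E, OF d\<phi> dE] has_derivative_scaleR_right d\<phi>) auto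
      moreover have "D (\<phi> u) *v frechet_derivative \<phi> (at u) a = c *\<^sub>R frechet_derivative \<phi> (at u) a" for a
        by (rule shape_operator(3)[OF M umbilic[OF M] G_tangent[OF M tan[OF uV]]])
      ultimately show ?thesis by (simp add: has_derivative_at_withinI)
    qed
    have const: "?g u = ?g u0" if "u \<in> ball u0 e" for u
      by (rule has_derivative_zero_unique[OF convex_ball dg that u0_in])
    have "openin (top_of_set (\<phi> ` V)) (\<phi> ` ball u0 e)"
      using e(2) by (intro homeomorphism_imp_open_map[OF hom]) (auto simp: openin_open intro!: exI[of _ "ball u0 e"])
    then have "openin (top_of_set M) (\<phi> ` ball u0 e)" using opn openin_trans by blast
    moreover have "p \<in> \<phi> ` ball u0 e" using u0(2) u0_in by blast
    moreover have "\<eta> q - c *\<^sub>R q = \<eta> p - c *\<^sub>R p" if q: "q \<in> \<phi> ` ball u0 e" for q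
    proof -
      obtain u where u: "u \<in> ball u0 e" "q = \<phi> u" using q by blast
      have "q \<in> M" using u e(2) sub by blast
      then show ?thesis using const[OF u(1)] on_M p unfolding u(2) u0(2)[symmetric] by auto
    qed
    ultimately show ?thesis by blast
  qed
  have "(\<lambda>p. \<eta> p - c *\<^sub>R p) constant_on M"
    by (rule locally_constant_imp_constant[OF conn]) (use loc in blast)
  then obtain k where k: "\<And>p. p \<in> M \<Longrightarrow> \<eta> p - c *\<^sub>R p = k" unfolding constant_on_def by blast
  have "\<eta> p = c *\<^sub>R (p - (- (1 / c)) *\<^sub>R k)" if "p \<in> M" for p
    using k[OF that] c_pos by (simp add: algebra_simps)
  then show ?thesis using that by blast
qed

text \<open>That M lies on the sphere follows from \<open>N (\<eta> p) = 1\<close>. Conversely, a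
  lies inside M, and if a point q of the sphere were missing from M, the ray from a through q would
  avoid M and remain in the bounded set \<open>inside M\<close>.\<close>

lemma sphere_eq:
  assumes a: "\<forall>p\<in>M. \<eta> p = c *\<^sub>R (p - a)"
  shows "M = minkowski_sphere N a (1 / c)"
proof
  have c: "c > 0" by (rule c_pos)
  have NM: "N (p - a) = 1 / c" if p: "p \<in> M" for p
  proof -
    have "N (\<eta> p) = c * N (p - a)" using a p c by (simp add: N_scale)
    then show ?thesis using N_\<eta>[OF p] c by (simp add: field_simps)
  qed
  then show "M \<subseteq> minkowski_sphere N a (1 / c)" unfolding minkowski_sphere_def by blast
  show "minkowski_sphere N a (1 / c) \<subseteq> M"
  proof
    fix q assume "q \<in> minkowski_sphere N a (1 / c)"
    then have Nq: "N (q - a) = 1 / c" unfolding minkowski_sphere_def by simp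
    show "q \<in> M"
    proof (rule ccontr)
      assume qM: "q \<notin> M"
      obtain p where p: "p \<in> M" using M_nonempty by blast
      \<comment> \<open>tc < 1 puts p - t \<eta>(p) strictly between p and a, so the rest of the way
        to a stays at distance less than 1/c from a.\<close>
      define t where "t = min (\<delta>0 / 2) (1 / (2 * c))"
      have t: "0 < t" "t < \<delta>0" "t * c < 1"
      proof -
        show "0 < t" "t < \<delta>0" unfolding t_def using \<delta>0 c by auto
        have "t * c \<le> 1 / (2 * c) * c" unfolding t_def using c by (intro mult_right_mono) auto
        then show "t * c < 1" using c by simp
      qed
      let ?y = "p - t *\<^sub>R \<eta> p"
      have y: "?y \<in> inside M" by (rule minus_side[OF p t(1,2)])
      have \<eta>p: "\<eta> p = c *\<^sub>R (p - a)" using a p by blast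
      have ya: "?y - a = (1 - t * c) *\<^sub>R (p - a)" unfolding \<eta>p by (simp add: algebra_simps)
      have disj: "M \<inter> closed_segment ?y a = {}"
      proof (rule ccontr)
        assume "M \<inter> closed_segment ?y a \<noteq> {}"
        then obtain z where zM: "z \<in> M" and "z \<in> closed_segment ?y a" by blast
        then obtain \<mu> where z: "z = (1 - \<mu>) *\<^sub>R ?y + \<mu> *\<^sub>R a" "0 \<le> \<mu>" "\<mu> \<le> 1"
          unfolding in_segment(1) by blast
        have "z - a = (1 - \<mu>) *\<^sub>R (?y - a)" unfolding z(1) by (simp add: algebra_simps)
        then have "N (z - a) = (1 - \<mu>) * ((1 - t * c) * N (p - a))"
          unfolding ya using z t by (simp add: N_scale)
        also have "\<dots> \<le> 1 * ((1 - t * c) * N (p - a))" using z t N_nonneg by (intro mult_right_mono) auto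
        also have "\<dots> < 1 / c" unfolding NM[OF p] using t c by (simp add: divide_strict_right_mono)
        finally show False using NM[OF zM] by simp
      qed
      have a_in: "a \<in> inside M"
      proof (rule ccontr)
        assume "a \<notin> inside M"
        moreover have "a \<notin> M" using disj by (auto simp: ends_in_segment)
        ultimately have "a \<in> outside M" using inside_Un_outside[of M] by blast
        then have "inside M \<inter> closed_segment ?y a \<noteq> {}" "outside M \<inter> closed_segment ?y a \<noteq> {}"
          using y by auto
        then have "M \<inter> closed_segment ?y a \<noteq> {}" by (rule inside_outside_intersect_connected[OF connected_segment(1)])
        then show False using disj by blast
      qed
      \<comment> \<open>Along this ray the distance from a is \<mu>/c, so M could be met only at
        \<mu> = 1, which is the point q.\<close>
      let ?C = "(\<lambda>\<mu>. a + \<mu> *\<^sub>R (q - a)) ` {0..}"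
      have "connected ?C" by (intro connected_continuous_image continuous_intros) auto
      moreover have "?C \<inter> M = {}"
      proof (rule ccontr)
        assume "?C \<inter> M \<noteq> {}"
        then obtain \<mu> where l: "\<mu> \<ge> 0" "a + \<mu> *\<^sub>R (q - a) \<in> M" by auto
        have "N (a + \<mu> *\<^sub>R (q - a) - a) = \<mu> * (1 / c)" using l(1) Nq by (simp add: N_scale)
        then have "\<mu> = 1" using NM[OF l(2)] c by simp
        then show False using l(2) qM by simp
      qed
      moreover have "a \<in> ?C" by (rule image_eqI[of _ _ 0]) auto
      ultimately have "?C \<subseteq> inside M"
        using inside_same_component[of M a] a_in unfolding connected_component_def by blast
      then have "bounded ?C" using bounded_inside[OF compact_imp_bounded[OF compact_M]] bounded_subset by blast
      then obtain B where B: "\<And>x. x \<in> ?C \<Longrightarrow> norm x \<le> B" unfolding bounded_iff by blast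
      have qa: "norm (q - a) > 0" using Nq c by auto
      define \<mu> where "\<mu> = (\<bar>B\<bar> + norm a + 1) / norm (q - a)"
      have l0: "\<mu> \<ge> 0" unfolding \<mu>_def by simp
      have "norm (\<mu> *\<^sub>R (q - a)) = \<bar>B\<bar> + norm a + 1" unfolding \<mu>_def using qa by simp
      moreover have "norm (\<mu> *\<^sub>R (q - a)) \<le> norm (a + \<mu> *\<^sub>R (q - a)) + norm a"
        using norm_triangle_ineq4[of "a + \<mu> *\<^sub>R (q - a)" a] by simp
      moreover have "norm (a + \<mu> *\<^sub>R (q - a)) \<le> B" using l0 by (intro B) auto
      ultimately show False by linarith
    qed
  qed
qed

end

section \<open>The Minkowski mean curvature as a trace on the tube\<close>

context tube
begin

lemma surface_differential_eq:
  assumes p: "p \<in> M" and v: "v \<in> tangent_space M p"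
  shows "surface_differential M \<eta> p v = D p *v v"
proof -
  obtain \<gamma>0 where "curve_through M p v \<gamma>0" using v unfolding tangent_space_def by blast
  then show ?thesis
  proof (rule surface_differentialI)
    fix \<gamma> assume "curve_through M p v \<gamma>"
    then obtain e where e: "e > 0" "\<gamma> ` {-e<..<e} \<subseteq> M" and \<gamma>0: "\<gamma> 0 = p" and \<gamma>': "(\<gamma> has_vector_derivative v) (at 0)"
      unfolding curve_through_def by blast
    have "((\<lambda>t. E (\<gamma> t)) has_derivative (\<lambda>t. D (\<gamma> 0) *v (t *\<^sub>R v))) (at 0)"
    proof -
      have "(E has_derivative (\<lambda>w. D (\<gamma> 0) *v w)) (at (\<gamma> 0))"
        unfolding \<gamma>0 by (rule dE[OF subsetD[OF M_in_T p]])
      then show ?thesis by (rule has_derivative_compose[OF \<gamma>'[unfolded has_vector_derivative_def]])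
    qed
    then have "((\<eta> \<circ> \<gamma>) has_derivative (\<lambda>t. D (\<gamma> 0) *v (t *\<^sub>R v))) (at 0)"
    proof (rule has_derivative_transform_within_open[where s = "{-e<..<e}"])
      fix t assume "t \<in> {-e<..<e}"
      then have "\<gamma> t \<in> M" using e(2) by blast
      then show "E (\<gamma> t) = (\<eta> \<circ> \<gamma>) t" using on_M by simp
    qed (use e(1) in auto)
    then show "(\<eta> \<circ> \<gamma> has_vector_derivative D p *v v) (at 0)"
      unfolding has_vector_derivative_def \<gamma>0 by (simp add: matrix_vector_mult_scaleR)
  qed
qed

lemma minkowski_mean_curvature_eq:
  assumes p: "p \<in> M" shows "minkowski_mean_curvature M \<eta> p = 1 / 2 * trace (D p)"
proof -
  have pT: "p \<in> T" using M_in_T p by blast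
  have Ep: "E p = \<eta> p" using on_M[OF p] by simp
  have "trace_on {v. G (\<eta> p) \<bullet> v = 0} (surface_differential M \<eta> p) = trace (D p)"
  proof (rule trace_on_hyperplane)
    show "G (\<eta> p) \<bullet> \<eta> p \<noteq> 0" using G_\<eta>_\<eta>[OF p] by simp
    show "D p *v \<eta> p = 0" using D_E[OF pT] unfolding Ep .
    show "G (\<eta> p) \<bullet> (D p *v v) = 0" for v using G_D[OF pT] unfolding Ep .
    show "surface_differential M \<eta> p v = D p *v v" if "G (\<eta> p) \<bullet> v = 0" for v
      using surface_differential_eq[OF p] tangent_space_eq[OF p] that by blast
  qed
  then show ?thesis unfolding minkowski_mean_curvature_def tangent_space_eq[OF p] by simp
qed

end

theorem theorem5p1:
  fixes N :: "real^3 \<Rightarrow> real" and M :: "(real^3) set" and \<eta> :: "real^3 \<Rightarrow> real^3"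
  assumes "smooth_norm N"
    and "strictly_convex_norm N"
    and "\<forall>x \<in> minkowski_sphere N 0 1. gaussian_curvature (minkowski_sphere N 0 1) x \<noteq> 0"
    and "smooth_surface M" and "compact M" and "connected M" and "M \<noteq> {}"
    and "birkhoff_gauss_map N M \<eta>" and "outward_pointing M \<eta>"
    and "\<exists>c. c \<noteq> 0 \<and> (\<forall>p\<in>M. minkowski_mean_curvature M \<eta> p = c)"
  shows "\<exists>a r. r > 0 \<and> M = minkowski_sphere N a r"
proof -
  define G where "G = gradient N"
  define H where "H = jacobian_matrix G"
  interpret minkowski_norm N G H
    unfolding G_def H_def by (rule smooth_norm_minkowski_norm[OF assms(1,2)])
  interpret surface_in_norm N G H M \<eta>
    by unfold_locales (use assms in auto)
  obtain \<delta> s E D where t: "\<delta> > 0"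
    "open {p + t *\<^sub>R \<eta> p |p t. p \<in> M \<and> \<bar>t\<bar> < \<delta>}"
    "\<forall>p t. p \<in> M \<longrightarrow> \<bar>t\<bar> < \<delta> \<longrightarrow> s (p + t *\<^sub>R \<eta> p) = t"
    "\<forall>p t. p \<in> M \<longrightarrow> \<bar>t\<bar> < \<delta> \<longrightarrow> E (p + t *\<^sub>R \<eta> p) = \<eta> p"
    "\<forall>p t y. p \<in> M \<longrightarrow> \<bar>t\<bar> < \<delta> \<longrightarrow> y = p + t *\<^sub>R \<eta> p \<longrightarrow> (E has_derivative (\<lambda>v. D y *v v)) (at y)"
    "\<forall>p t y. p \<in> M \<longrightarrow> \<bar>t\<bar> < \<delta> \<longrightarrow> y = p + t *\<^sub>R \<eta> p \<longrightarrow> (s has_derivative (\<lambda>v. G (E y) \<bullet> v)) (at y)"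
    "continuous_on {p + t *\<^sub>R \<eta> p |p t. p \<in> M \<and> \<bar>t\<bar> < \<delta>} D"
    by (rule tube_exists)
  interpret tube N G H M \<eta> \<delta> s E D
    by unfold_locales (use t assms(9) in auto)
  obtain c where c: "\<forall>p\<in>M. minkowski_mean_curvature M \<eta> p = c" using assms(10) by blast
  have sm: "smooth_on (-{0}) N" using assms(1) unfolding smooth_norm_def by blast
  have smG: "smooth_on (-{0}) G" unfolding G_def by (rule smooth_on_gradient[OF _ sm]) (simp add: open_Compl)
  interpret cmc_tube N G H M \<eta> \<delta> s E D c
  proof
    show "(H x *v v) \<bullet> v > 0" if "N x = 1" "v \<noteq> 0" "G x \<bullet> v = 0" for x v
      by (rule elliptic_of_gaussian_curvature[OF sm smG assms(3) that])
    show "trace (D p) = 2 * c" if "p \<in> M" for p using minkowski_mean_curvature_eq[OF that] c that by simp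
  qed
  obtain a where "\<forall>p\<in>M. \<eta> p = c *\<^sub>R (p - a)" by (rule umbilic_imp_sphere[OF assms(6)])
  then have "M = minkowski_sphere N a (1 / c)" by (rule sphere_eq)
  then show ?thesis using c_pos by (intro exI[of _ a] exI[of _ "1 / c"]) simp
qed

end
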